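(* Let $(Z_t)_{t\geq 0}$ be a Rosenblatt process with self-similarity index $H\in(\frac12,1)$. Then for any $d\in\mathbb{N}$, any times $0\le t_0<t_1<\ldots<t_d$ and any $a_1,\ldots,a_d\in\mathbb{R}$, $$ \mathbb{P}\Big( \forall i=1,\ldots,d:\ \sup_{t\in[t_{i-1},t_i)} \big(Z_t - Z_{t_{i-1}}\big) \leq a_i \Big) \geq \prod_{i=1}^d \mathbb{P}\Big( \sup_{t\in[t_{i-1},t_i)} \big(Z_t - Z_{t_{i-1}}\big) \leq a_i \Big). $$
   Context: Let $(W_x)_{x\in\mathbb{R}}$ be a two-sided standard Brownian motion. For $m\in\mathbb{N}$ and $H\in(\frac12,1)$, the Hermite process of order $m$ and index $H$ is (a continuous modification of) $$Y^{(m,H)}_t = c_{H,m}\int'_{\mathbb{R}^m}\Big(\int_0^t\prod_{i=1}^m (s-x_i)_+^{\frac{H-1}{m}-\frac12}\,ds\Big)\,dW_{x_1}\cdots dW_{x_m},\qquad t\ge 0,$$ where $\int'$ denotes the $m$-fold multiple Wiener–Itô integral (excluding diagonals) and $c_{H,m}>0$ is a normalising constant. It is $H$-self-similar with stationary increments. The Rosenblatt process is the Hermite process of order $m=2$: $Z_t=Y^{(2,H)}_t$. *)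

theory Defs
  imports "HOL-Probability.Probability"
begin

definition sq_int :: "(real \<Rightarrow> real) \<Rightarrow> bool" where
  "sq_int f \<longleftrightarrow> f \<in> borel_measurable lborel \<and> integrable lborel (\<lambda>x. (f x)\<^sup>2)"

definition sq_int2 :: "(real \<times> real \<Rightarrow> real) \<Rightarrow> bool" where
  "sq_int2 f \<longleftrightarrow> f \<in> borel_measurable (lborel \<Otimes>\<^sub>M lborel)
      \<and> integrable (lborel \<Otimes>\<^sub>M lborel) (\<lambda>z. (f z)\<^sup>2)"

text \<open>Isonormal Gaussian process on L2(R), i.e. the Wiener integral
  W(f) = int f dW with respect to a two-sided standard Brownian motion:
  W is a.s. linear and W(f) is centred Gaussian with variance the squared L2 norm of f.\<close>
definition isonormal :: "'a measure \<Rightarrow> ((real \<Rightarrow> real) \<Rightarrow> 'a \<Rightarrow> real) \<Rightarrow> bool" where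
  "isonormal M W \<longleftrightarrow> prob_space M \<and>
     (\<forall>f. sq_int f \<longrightarrow> W f \<in> borel_measurable M \<and>
        (\<forall>\<theta>::real. char (distr M borel (W f)) \<theta> =
            complex_of_real (exp (- (integral\<^sup>L lborel (\<lambda>x. (f x)\<^sup>2)) * \<theta>\<^sup>2 / 2)))) \<and>
     (\<forall>f g (a::real) (b::real). sq_int f \<longrightarrow> sq_int g \<longrightarrow>
        (AE \<omega> in M. W (\<lambda>x. a * f x + b * g x) \<omega> = a * W f \<omega> + b * W g \<omega>))"

definition elem_kernel :: "nat \<Rightarrow> (nat \<Rightarrow> nat \<Rightarrow> real) \<Rightarrow> (nat \<Rightarrow> real \<Rightarrow> real) \<Rightarrow> real \<times> real \<Rightarrow> real" where
  "elem_kernel N c e z = (\<Sum>i<N. \<Sum>j<N. c i j * e i (fst z) * e j (snd z))"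

definition elem_I2 :: "((real \<Rightarrow> real) \<Rightarrow> 'a \<Rightarrow> real) \<Rightarrow> nat \<Rightarrow> (nat \<Rightarrow> nat \<Rightarrow> real)
    \<Rightarrow> (nat \<Rightarrow> real \<Rightarrow> real) \<Rightarrow> 'a \<Rightarrow> real" where
  "elem_I2 W N c e \<omega> = (\<Sum>i<N. \<Sum>j<N. c i j *
      (W (e i) \<omega> * W (e j) \<omega> - integral\<^sup>L lborel (\<lambda>x. e i x * e j x)))"

text \<open>X is (a version of) the double Wiener-Ito integral I_2(f) (diagonal excluded):
  the L2(P)-limit of I_2 of finite-rank kernels converging to f in L2(R^2).\<close>
definition is_double_wiener_integral ::
  "'a measure \<Rightarrow> ((real \<Rightarrow> real) \<Rightarrow> 'a \<Rightarrow> real) \<Rightarrow> (real \<times> real \<Rightarrow> real) \<Rightarrow> ('a \<Rightarrow> real) \<Rightarrow> bool" where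
  "is_double_wiener_integral M W f X \<longleftrightarrow> sq_int2 f \<and> X \<in> borel_measurable M \<and>
     (\<exists>(N :: nat \<Rightarrow> nat) (c :: nat \<Rightarrow> nat \<Rightarrow> nat \<Rightarrow> real) (e :: nat \<Rightarrow> nat \<Rightarrow> real \<Rightarrow> real).
        (\<forall>n i. i < N n \<longrightarrow> sq_int (e n i)) \<and>
        (\<lambda>n. \<integral>\<^sup>+ z. ennreal ((f z - elem_kernel (N n) (c n) (e n) z)\<^sup>2) \<partial>(lborel \<Otimes>\<^sub>M lborel))
           \<longlonglongrightarrow> 0 \<and>
        (\<lambda>n. \<integral>\<^sup>+ \<omega>. ennreal ((X \<omega> - elem_I2 W (N n) (c n) (e n) \<omega>)\<^sup>2) \<partial>M) \<longlonglongrightarrow> 0)"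

text \<open>Kernel of the Hermite process of order m = 2 (Rosenblatt), exponent (H-1)/2 - 1/2 = H/2 - 1,
  with the convention (u)_+^alpha = 0 for u <= 0.\<close>
definition rosenblatt_kernel :: "real \<Rightarrow> real \<Rightarrow> real \<Rightarrow> real \<times> real \<Rightarrow> real" where
  "rosenblatt_kernel H c t z = c * (LINT s:{0..t}|lborel.
      (max (s - fst z) 0) powr (H / 2 - 1) * (max (s - snd z) 0) powr (H / 2 - 1))"

text \<open>Z is a Rosenblatt process of index H on the probability space M: a continuous process
  which for every t >= 0 is a.s. equal to c * double Wiener-Ito integral of the kernel above,
  with c > 0 the normalising constant (E Z_1^2 = 1).\<close>
definition rosenblatt_process :: "'a measure \<Rightarrow> real \<Rightarrow> (real \<Rightarrow> 'a \<Rightarrow> real) \<Rightarrow> bool" where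
  "rosenblatt_process M H Z \<longleftrightarrow> prob_space M \<and> 1/2 < H \<and> H < 1 \<and>
     (\<exists>W c. isonormal M W \<and> c > 0 \<and>
        (\<forall>t\<ge>0. is_double_wiener_integral M W (rosenblatt_kernel H c t) (Z t))) \<and>
     (\<forall>t\<ge>0. Z t \<in> borel_measurable M) \<and>
     (\<forall>\<omega>\<in>space M. continuous_on {0..} (\<lambda>t. Z t \<omega>)) \<and>
     integral\<^sup>L M (\<lambda>\<omega>. (Z 1 \<omega>)\<^sup>2) = 1"

end

(* The increments of the Rosenblatt process are, formally, the integrals of X_u^2 - E X_u^2 over u, where
   X is the moving average of white noise with kernel u_+^(H/2 - 1). They are therefore increasing in the
   moduli |X_u|, and the events in question are decreasing in |X|. So it suffices that |X| satisfies the FKG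
   inequality; the general Gaussian correlation inequality is not needed.

   Discretising the noise with mesh 1/n turns X into X_k = sum_(j <= k) g_(k-j) xi_j, where xi is a standard
   Gaussian vector and the g_j are the coefficients of (1 - z)^(-H/2). The inverse filter (1 - z)^(H/2) has
   nonpositive coefficients apart from the constant term, and these decrease in modulus and add up to at least
   -1; hence the precision matrix of X has nonpositive off-diagonal entries. For a Gaussian density of this
   form, Ginibre's argument shows that the sum over all sign changes of the coordinates is log-supermodular
   in the moduli, and the four functions theorem gives the correlation inequality.

   The discretised kernels are dominated by a multiple of the Rosenblatt kernel, which is square integrable,
   so dominated convergence and the isometry of the double integral give convergence in probability. *)

theory Submission
  imports Defs
begin

section \<open>The four functions theorem for moduli\<close>

text \<open>The formal picture cannot be used as it stands: u_+^(H/2 - 1) is not square integrable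
  near 0, so X_u is not a random variable and E X_u^2 is infinite. On a grid both exist, and the
  expectations, although they blow up as the mesh shrinks, are constants that merely shift the
  thresholds. Passing to |X| is natural since X enters through squares, but a Gaussian density with
  nonnegative couplings need not be log-supermodular in the moduli; only its sum over signs is.
  Taking the coefficients of (1 - z)^(-H/2), rather than samples of the power function, makes the
  inverse filter explicit. Both filters are causal, so restricting the noise to [-n, n) leaves them
  unit triangular and exactly inverse to each other, and the precision matrix is known in finite
  dimension without inverting a covariance. The price is the asymptotics q^(c - 1) / Gamma(c) of the
  coefficients, c = H/2, which is where the constant C0 / (rGamma (H/2))^2 comes from.\<close>

lemma ennreal_add_le_add:
  fixes a b c d :: ennreal
  assumes "a \<le> c" "b \<le> c" "a * b \<le> c * d"
  shows "a + b \<le> c + d"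
proof (cases "c = \<infinity> \<or> d = \<infinity>")
  case False
  then obtain c' d' where c: "c = ennreal c'" "c' \<ge> 0" and d: "d = ennreal d'" "d' \<ge> 0"
    by (metis ennreal_cases infinity_ennreal_def)
  obtain a' b' where a: "a = ennreal a'" "a' \<ge> 0" and b: "b = ennreal b'" "b' \<ge> 0"
    using assms(1,2) False by (metis ennreal_cases infinity_ennreal_def neq_top_trans)
  have le: "a' \<le> c'" "b' \<le> c'" "a' * b' \<le> c' * d'"
    using assms a b c d by (auto simp flip: ennreal_mult)
  have "a' + b' \<le> c' + d'"
  proof (cases "c' = 0")
    case False
    \<comment> \<open>Expanding gives c' * (a' + b') <= c' * c' + a' * b'; then a' * b' <= c' * d'
      is used and c' is cancelled.\<close>
    have "0 \<le> (c' - a') * (c' - b')" using le by simp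
    then have "c' * (a' + b') \<le> c' * (c' + d')" using le(3) by (simp add: algebra_simps)
    then show ?thesis using False c by simp
  qed (use le a b d in auto)
  then show ?thesis using a b c d by (simp flip: ennreal_plus)
qed auto

text \<open>Signs are kept: in each coordinate the pair of values of \<open>max_abs\<close> and
  \<open>min_abs\<close> is (x i, y i) in one of the two orders, also when the moduli tie. The four
  functions argument on the line needs such a rearrangement of the given points.\<close>

definition max_abs :: "('i \<Rightarrow> real) \<Rightarrow> ('i \<Rightarrow> real) \<Rightarrow> 'i \<Rightarrow> real" where
  "max_abs x y = (\<lambda>i. if \<bar>x i\<bar> \<le> \<bar>y i\<bar> then y i else x i)"

definition min_abs :: "('i \<Rightarrow> real) \<Rightarrow> ('i \<Rightarrow> real) \<Rightarrow> 'i \<Rightarrow> real" where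
  "min_abs x y = (\<lambda>i. if \<bar>x i\<bar> \<le> \<bar>y i\<bar> then x i else y i)"

lemma max_abs_upd: "max_abs (x(i := r)) (y(i := s)) = (max_abs x y)(i := if \<bar>r\<bar> \<le> \<bar>s\<bar> then s else r)"
  and min_abs_upd: "min_abs (x(i := r)) (y(i := s)) = (min_abs x y)(i := if \<bar>r\<bar> \<le> \<bar>s\<bar> then r else s)"
  by (auto simp: max_abs_def min_abs_def)

lemma max_min_abs_space_PiM [simp]:
  assumes "x \<in> space (Pi\<^sub>M I (\<lambda>_. lborel))" "y \<in> space (Pi\<^sub>M I (\<lambda>_. lborel))"
  shows "max_abs x y \<in> space (Pi\<^sub>M I (\<lambda>_. lborel))" "min_abs x y \<in> space (Pi\<^sub>M I (\<lambda>_. lborel))"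
  using assms by (auto simp: space_PiM max_abs_def min_abs_def PiE_def extensional_def)

text \<open>The one-dimensional Ahlswede-Daykin step. Doubling both sides symmetrises the products
  into integrals over pairs (r, s), which leaves an inequality between values at two points.\<close>

lemma four_functions_real:
  fixes f1 f2 f3 f4 :: "real \<Rightarrow> ennreal"
  assumes [measurable]: "f1 \<in> borel_measurable borel" "f2 \<in> borel_measurable borel"
      "f3 \<in> borel_measurable borel" "f4 \<in> borel_measurable borel"
    and le: "\<And>r s. f1 r * f2 s \<le> f3 (if \<bar>r\<bar> \<le> \<bar>s\<bar> then s else r) * f4 (if \<bar>r\<bar> \<le> \<bar>s\<bar> then r else s)"
  shows "(\<integral>\<^sup>+r. f1 r \<partial>lborel) * (\<integral>\<^sup>+r. f2 r \<partial>lborel) \<le> (\<integral>\<^sup>+r. f3 r \<partial>lborel) * (\<integral>\<^sup>+r. f4 r \<partial>lborel)"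
proof -
  have dbl: "2 * ((\<integral>\<^sup>+r. f r \<partial>lborel) * (\<integral>\<^sup>+r. g r \<partial>lborel)) =
      (\<integral>\<^sup>+r. \<integral>\<^sup>+s. f r * g s + f s * g r \<partial>lborel \<partial>lborel)"
    if [measurable]: "f \<in> borel_measurable borel" "g \<in> borel_measurable borel"
    for f g :: "real \<Rightarrow> ennreal"
  proof -
    have "(\<integral>\<^sup>+r. \<integral>\<^sup>+s. f r * g s + f s * g r \<partial>lborel \<partial>lborel) =
      (\<integral>\<^sup>+r. f r * (\<integral>\<^sup>+s. g s \<partial>lborel) + (\<integral>\<^sup>+s. f s \<partial>lborel) * g r \<partial>lborel)"
      by (simp add: nn_integral_add nn_integral_cmult nn_integral_multc)
    also have "\<dots> = (\<integral>\<^sup>+r. f r \<partial>lborel) * (\<integral>\<^sup>+s. g s \<partial>lborel) + (\<integral>\<^sup>+s. f s \<partial>lborel) * (\<integral>\<^sup>+r. g r \<partial>lborel)"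
      by (simp add: nn_integral_add nn_integral_cmult nn_integral_multc)
    finally show ?thesis by (simp add: mult_2)
  qed
  have pt: "f1 r * f2 s + f1 s * f2 r \<le> f3 r * f4 s + f3 s * f4 r" for r s
  proof (cases "\<bar>r\<bar> = \<bar>s\<bar>")
    case True
    \<comment> \<open>On a tie \<open>le\<close> assigns the larger role to its second argument, so
      its two instances bound exactly the two summands.\<close>
    then show ?thesis using add_mono[OF le[of r s] le[of s r]] by (simp add: add.commute)
  next
    case False
    have *: "f1 r * f2 s + f1 s * f2 r \<le> f3 s * f4 r + f3 r * f4 s" if "\<bar>r\<bar> < \<bar>s\<bar>" for r s
    proof (rule ennreal_add_le_add)
      show "f1 r * f2 s \<le> f3 s * f4 r" "f1 s * f2 r \<le> f3 s * f4 r"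
        using le[of r s] le[of s r] that by auto
      \<comment> \<open>The product hypothesis of \<open>ennreal_add_le_add\<close> comes from the
        two diagonal instances of \<open>le\<close>, at (r, r) and (s, s).\<close>
      have "(f1 r * f2 r) * (f1 s * f2 s) \<le> (f3 r * f4 r) * (f3 s * f4 s)"
        using mult_mono[OF le[of r r] le[of s s]] by simp
      then show "f1 r * f2 s * (f1 s * f2 r) \<le> f3 s * f4 r * (f3 r * f4 s)"
        by (simp add: ac_simps)
    qed
    show ?thesis using *[of r s] *[of s r] False by (cases "\<bar>r\<bar> < \<bar>s\<bar>") (auto simp: add.commute)
  qed
  have "2 * ((\<integral>\<^sup>+r. f1 r \<partial>lborel) * (\<integral>\<^sup>+r. f2 r \<partial>lborel))
      \<le> 2 * ((\<integral>\<^sup>+r. f3 r \<partial>lborel) * (\<integral>\<^sup>+r. f4 r \<partial>lborel))"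
    by (simp add: dbl) (intro nn_integral_mono pt)
  then show ?thesis by (simp add: ennreal_mult_le_mult_iff)
qed

interpretation lborel_product: product_sigma_finite "\<lambda>_::'i. lborel :: real measure"
  by standard

text \<open>Induction over the coordinates: integrating out coordinate i leaves four functions of
  the others. They satisfy the hypothesis by the one-dimensional case on fibres, because
  \<open>max_abs\<close> and \<open>min_abs\<close> act coordinate by coordinate.\<close>

theorem four_functions_PiM:
  fixes f1 f2 f3 f4 :: "('i \<Rightarrow> real) \<Rightarrow> ennreal"
  assumes "finite I"
    and "f1 \<in> borel_measurable (Pi\<^sub>M I (\<lambda>_. lborel))" "f2 \<in> borel_measurable (Pi\<^sub>M I (\<lambda>_. lborel))"
      "f3 \<in> borel_measurable (Pi\<^sub>M I (\<lambda>_. lborel))" "f4 \<in> borel_measurable (Pi\<^sub>M I (\<lambda>_. lborel))"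
    and "\<And>x y. x \<in> space (Pi\<^sub>M I (\<lambda>_. lborel)) \<Longrightarrow> y \<in> space (Pi\<^sub>M I (\<lambda>_. lborel)) \<Longrightarrow>
      f1 x * f2 y \<le> f3 (max_abs x y) * f4 (min_abs x y)"
  shows "(\<integral>\<^sup>+x. f1 x \<partial>Pi\<^sub>M I (\<lambda>_. lborel)) * (\<integral>\<^sup>+x. f2 x \<partial>Pi\<^sub>M I (\<lambda>_. lborel))
    \<le> (\<integral>\<^sup>+x. f3 x \<partial>Pi\<^sub>M I (\<lambda>_. lborel)) * (\<integral>\<^sup>+x. f4 x \<partial>Pi\<^sub>M I (\<lambda>_. lborel))"
  using assms
proof (induction I arbitrary: f1 f2 f3 f4 rule: finite_induct)
  case empty
  have "max_abs (\<lambda>_. undefined) (\<lambda>_::'i. undefined) = (\<lambda>_. undefined)"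
    "min_abs (\<lambda>_. undefined) (\<lambda>_::'i. undefined) = (\<lambda>_. undefined)"
    by (auto simp: max_abs_def min_abs_def)
  then show ?case using empty.prems(5)[of "\<lambda>_. undefined" "\<lambda>_. undefined"]
    by (simp add: lborel_product.nn_integral_empty space_PiM)
next
  case (insert i I)
  note [measurable] = insert.prems(1-4)
  let ?P = "Pi\<^sub>M I (\<lambda>_. lborel :: real measure)" and ?Q = "Pi\<^sub>M (insert i I) (\<lambda>_. lborel :: real measure)"
  have upd: "x(i := r) \<in> space ?Q" if "x \<in> space ?P" for x r
    using that by (auto simp: space_PiM PiE_def extensional_def)
  have sect: "(\<lambda>r. f (x(i := r))) \<in> borel_measurable borel"
    if [measurable]: "f \<in> borel_measurable ?Q" and x [measurable]: "x \<in> space ?P" for f :: "_ \<Rightarrow> ennreal" and x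
  proof -
    have "(\<lambda>r. x(i := r)) \<in> borel \<rightarrow>\<^sub>M ?Q"
      by (rule measurable_PiM_single') (use x in \<open>auto simp: space_PiM PiE_def extensional_def\<close>)
    then show ?thesis by measurable
  qed
  have "(\<integral>\<^sup>+x. (\<integral>\<^sup>+r. f1 (x(i := r)) \<partial>lborel) \<partial>?P) * (\<integral>\<^sup>+x. (\<integral>\<^sup>+r. f2 (x(i := r)) \<partial>lborel) \<partial>?P)
    \<le> (\<integral>\<^sup>+x. (\<integral>\<^sup>+r. f3 (x(i := r)) \<partial>lborel) \<partial>?P) * (\<integral>\<^sup>+x. (\<integral>\<^sup>+r. f4 (x(i := r)) \<partial>lborel) \<partial>?P)"
  proof (rule insert.IH)
    fix x y assume xy: "x \<in> space ?P" "y \<in> space ?P"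
    show "(\<integral>\<^sup>+r. f1 (x(i := r)) \<partial>lborel) * (\<integral>\<^sup>+r. f2 (y(i := r)) \<partial>lborel)
      \<le> (\<integral>\<^sup>+r. f3 ((max_abs x y)(i := r)) \<partial>lborel) * (\<integral>\<^sup>+r. f4 ((min_abs x y)(i := r)) \<partial>lborel)"
    proof (rule four_functions_real)
      fix r s
      show "f1 (x(i := r)) * f2 (y(i := s)) \<le> f3 ((max_abs x y)(i := if \<bar>r\<bar> \<le> \<bar>s\<bar> then s else r)) *
          f4 ((min_abs x y)(i := if \<bar>r\<bar> \<le> \<bar>s\<bar> then r else s))"
        using insert.prems(5)[OF upd[OF xy(1), of r] upd[OF xy(2), of s]]
        by (simp only: max_abs_upd min_abs_upd)
    qed (use xy in \<open>auto intro!: sect\<close>)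
  qed measurable
  then show ?case
    using insert.hyps by (simp add: lborel_product.product_nn_integral_insert)
qed

text \<open>A triangular map with diagonal entries of modulus 1 preserves Lebesgue measure: for
  fixed earlier coordinates the last one is only reflected and translated. With b = 0 this covers
  sign changes, with s = 1 the causal filter.\<close>

lemma nn_integral_PiM_lborel_triangular:
  fixes b :: "nat \<Rightarrow> (nat \<Rightarrow> real) \<Rightarrow> real" and s :: "nat \<Rightarrow> real"
  assumes "f \<in> borel_measurable (Pi\<^sub>M {..<n} (\<lambda>_. lborel))"
    and "\<And>k. \<bar>s k\<bar> = 1"
    and b: "\<And>k. k < n \<Longrightarrow> b k \<in> borel_measurable (Pi\<^sub>M {..<k} (\<lambda>_. lborel))"
  shows "(\<integral>\<^sup>+x. f (\<lambda>k\<in>{..<n}. s k * x k + b k (restrict x {..<k})) \<partial>Pi\<^sub>M {..<n} (\<lambda>_. lborel))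
    = (\<integral>\<^sup>+x. f x \<partial>Pi\<^sub>M {..<n} (\<lambda>_. lborel))"
  using assms(1,3)
proof (induction n arbitrary: f)
  case 0
  have "(\<lambda>k\<in>{..<0}. s k * x k + b k (restrict x {..<k})) = (\<lambda>_. undefined)" for x :: "nat \<Rightarrow> real"
    by auto
  then show ?case by (simp add: lborel_product.nn_integral_empty space_PiM)
next
  case (Suc n)
  let ?T = "\<lambda>n x. \<lambda>k\<in>{..<n}. s k * x k + b k (restrict x {..<k})"
  let ?P = "Pi\<^sub>M {..<n} (\<lambda>_. lborel :: real measure)"
  note [measurable] = Suc.prems(1)[unfolded lessThan_Suc]
  have b [measurable]: "b k \<in> borel_measurable (Pi\<^sub>M {..<k} (\<lambda>_. lborel))" if "k < Suc n" for k
    using Suc.prems(2) that by blast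
  have bm [measurable]: "(\<lambda>x. b k (restrict x {..<k})) \<in> borel_measurable (Pi\<^sub>M {..<m} (\<lambda>_. lborel))"
    if "k < Suc n" "k \<le> m" for k m
  proof (rule measurable_compose[OF _ b[OF that(1)]])
    show "(\<lambda>x. restrict x {..<k}) \<in> Pi\<^sub>M {..<m} (\<lambda>_. lborel) \<rightarrow>\<^sub>M Pi\<^sub>M {..<k} (\<lambda>_. lborel :: real measure)"
      by (rule measurable_restrict_subset) (use that in auto)
  qed
  have Tm: "?T m \<in> Pi\<^sub>M {..<m} (\<lambda>_. lborel) \<rightarrow>\<^sub>M Pi\<^sub>M {..<m} (\<lambda>_. lborel)" if "m \<le> Suc n" for m
  proof (rule measurable_restrict)
    fix k assume k: "k \<in> {..<m}"
    have [measurable]: "(\<lambda>x. b k (restrict x {..<k})) \<in> borel_measurable (Pi\<^sub>M {..<m} (\<lambda>_. lborel))"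
      by (rule bm) (use k that in auto)
    show "(\<lambda>x. s k * x k + b k (restrict x {..<k})) \<in> Pi\<^sub>M {..<m} (\<lambda>_. lborel) \<rightarrow>\<^sub>M lborel"
      using k by simp
  qed
  have Tm1: "(\<lambda>x. f (?T (Suc n) x)) \<in> borel_measurable (Pi\<^sub>M (insert n {..<n}) (\<lambda>_. lborel))"
    using measurable_compose[OF Tm[of "Suc n"] Suc.prems(1)] by (simp only: lessThan_Suc[of n, symmetric])
  have Tupd: "?T (Suc n) (x(n := r)) = (?T n x)(n := s n * r + b n (restrict x {..<n}))" for x r
  proof
    fix k
    have "restrict (x(n := r)) {..<k} = restrict x {..<k}" if "k \<le> n"
      using that by (auto simp: restrict_def)
    then show "?T (Suc n) (x(n := r)) k = ((?T n x)(n := s n * r + b n (restrict x {..<n}))) k"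
      by (auto simp: restrict_def less_Suc_eq)
  qed
  have sect: "(\<lambda>r. f (x(n := r))) \<in> borel_measurable borel" if x: "x \<in> space ?P" for x
  proof -
    have "(\<lambda>r. x(n := r)) \<in> borel \<rightarrow>\<^sub>M Pi\<^sub>M (insert n {..<n}) (\<lambda>_. lborel :: real measure)"
      by (rule measurable_PiM_single') (use x in \<open>auto simp: space_PiM PiE_def extensional_def\<close>)
    then show ?thesis by measurable
  qed
  have trans: "(\<integral>\<^sup>+r. f (x(n := s n * r + c)) \<partial>lborel) = (\<integral>\<^sup>+r. f (x(n := r)) \<partial>lborel)"
    if "x \<in> space ?P" for x c
    using nn_integral_real_affine[OF sect[OF that], of "s n" c] assms(2)[of n]
    by (auto simp: add.commute)
  have "(\<integral>\<^sup>+x. f (?T (Suc n) x) \<partial>Pi\<^sub>M {..<Suc n} (\<lambda>_. lborel))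
     = (\<integral>\<^sup>+x. (\<integral>\<^sup>+r. f (?T (Suc n) (x(n := r))) \<partial>lborel) \<partial>?P)"
    unfolding lessThan_Suc[of n]
    by (rule lborel_product.product_nn_integral_insert) (use Tm1[unfolded lessThan_Suc] in simp_all)
  also have "\<dots> = (\<integral>\<^sup>+x. (\<integral>\<^sup>+r. f ((?T n x)(n := r)) \<partial>lborel) \<partial>?P)"
    unfolding Tupd by (intro nn_integral_cong trans) (use measurable_space[OF Tm[of n]] in auto)
  also have "\<dots> = (\<integral>\<^sup>+x. (\<integral>\<^sup>+r. f (x(n := r)) \<partial>lborel) \<partial>?P)"
    by (rule Suc.IH[where f = "\<lambda>x. \<integral>\<^sup>+r. f (x(n := r)) \<partial>lborel"]) (simp_all add: b)
  also have "\<dots> = (\<integral>\<^sup>+x. f x \<partial>Pi\<^sub>M {..<Suc n} (\<lambda>_. lborel))"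
    unfolding lessThan_Suc by (subst lborel_product.product_nn_integral_insert) simp_all
  finally show ?case .
qed

section \<open>Sign sums and the FKG inequality\<close>

definition sign_of :: "'i set \<Rightarrow> 'i \<Rightarrow> real" where
  "sign_of A i = (if i \<in> A then -1 else 1)"

lemma abs_sign_of [simp]: "\<bar>sign_of A i\<bar> = 1"
  and sign_of_square [simp]: "sign_of A i * sign_of A i = 1"
  by (auto simp: sign_of_def)

text \<open>Ginibre's cone of functions of a sign vector: polynomials with nonnegative coefficients.\<close>

inductive ginibre :: "(('i \<Rightarrow> real) \<Rightarrow> real) \<Rightarrow> bool" where
  const: "0 \<le> c \<Longrightarrow> ginibre (\<lambda>_. c)"
| coord: "ginibre (\<lambda>e. e i)"
| add: "ginibre F \<Longrightarrow> ginibre G \<Longrightarrow> ginibre (\<lambda>e. F e + G e)"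
| mult: "ginibre F \<Longrightarrow> ginibre G \<Longrightarrow> ginibre (\<lambda>e. F e * G e)"

text \<open>Sum and difference must be treated together, since each product rule involves both. With
  p and m for the sum and difference of the two values, p(FG) = (pF pG + mF mG) / 2 and m(FG) = (pF
  mG + mF pG) / 2.\<close>

lemma ginibre_flip:
  assumes "ginibre F"
  shows "ginibre (\<lambda>e. F (e(i := 1)) + F (e(i := -1))) \<and> ginibre (\<lambda>e. F (e(i := 1)) - F (e(i := -1)))"
  using assms
proof induction
  case (const c)
  then show ?case using ginibre.const[of "c + c"] ginibre.const[of 0] by simp
next
  case (coord j)
  have "ginibre (\<lambda>e. e j + e j)" by (intro ginibre.intros)
  then show ?case using ginibre.const[of 0] ginibre.const[of 2] by (cases "j = i") auto
next
  case (add F G)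
  have "ginibre (\<lambda>e. (F (e(i := 1)) + F (e(i := -1))) + (G (e(i := 1)) + G (e(i := -1))))"
    "ginibre (\<lambda>e. (F (e(i := 1)) - F (e(i := -1))) + (G (e(i := 1)) - G (e(i := -1))))"
    by (intro ginibre.add add.IH[THEN conjunct1] add.IH[THEN conjunct2])+
  then show ?case by (simp only: algebra_simps)
next
  case (mult F G)
  let ?p = "\<lambda>F e. F (e(i := 1)) + F (e(i := -1)) :: real" and ?m = "\<lambda>F e. F (e(i := 1)) - F (e(i := -1)) :: real"
  have "ginibre (\<lambda>e. 1/2 * (?p F e * ?p G e + ?m F e * ?m G e))"
    "ginibre (\<lambda>e. 1/2 * (?p F e * ?m G e + ?m F e * ?p G e))"
    by (rule ginibre.mult[OF ginibre.const ginibre.add[OF ginibre.mult ginibre.mult]];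
        (intro mult.IH[THEN conjunct1] mult.IH[THEN conjunct2])?; simp)+
  then show ?case by (simp add: algebra_simps del: fun_upd_apply)
qed

text \<open>The signs are summed out one at a time; by \<open>ginibre_flip\<close> the sum over a
  single sign stays in the cone.\<close>

lemma ginibre_sum_nonneg:
  assumes "finite I" "ginibre F"
  shows "(\<Sum>A\<in>Pow I. F (sign_of A)) \<ge> 0"
proof -
  \<comment> \<open>Signs outside I are frozen at 1. The empty case is then evaluation at the
    all-ones vector, where a polynomial with nonnegative coefficients is nonnegative.\<close>
  have nonneg: "ginibre F \<Longrightarrow> (\<Sum>A\<in>Pow I. F (\<lambda>i. if i \<in> I then sign_of A i else 1)) \<ge> 0"
    using assms(1)
  proof (induction I arbitrary: F rule: finite_induct)
    case empty
    have "F (\<lambda>_. 1) \<ge> 0" using empty by induction auto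
    then show ?case by simp
  next
    case (insert i I)
    let ?e = "\<lambda>A j. if j \<in> I then sign_of A j else 1"
    have 1: "(\<lambda>j. if j \<in> insert i I then sign_of A j else 1) = (?e A)(i := 1)"
      and 2: "(\<lambda>j. if j \<in> insert i I then sign_of (insert i A) j else 1) = (?e A)(i := -1)"
      if "A \<in> Pow I" for A
      using that insert.hyps by (auto simp: sign_of_def fun_eq_iff)
    have "(\<Sum>A\<in>Pow (insert i I). F (\<lambda>j. if j \<in> insert i I then sign_of A j else 1)) =
      (\<Sum>A\<in>Pow I. F ((?e A)(i := 1))) + (\<Sum>A\<in>insert i ` Pow I. F (\<lambda>j. if j \<in> insert i I then sign_of A j else 1))"
      unfolding Pow_insert using insert.hyps
      by (subst sum.union_disjoint) (auto intro!: sum.cong arg_cong[where f = F] 1 simp del: fun_upd_apply insert_iff)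
    also have "(\<Sum>A\<in>insert i ` Pow I. F (\<lambda>j. if j \<in> insert i I then sign_of A j else 1)) =
      (\<Sum>A\<in>Pow I. F ((?e A)(i := -1)))"
      using insert.hyps by (subst sum.reindex) (auto simp: inj_on_def intro!: sum.cong arg_cong[where f = F] 2 simp del: fun_upd_apply insert_iff)
    finally show ?case
      using insert.IH[OF ginibre_flip[OF insert.prems, THEN conjunct1]] by (simp only: sum.distrib)
  qed
  have "(\<lambda>i. if i \<in> I then sign_of A i else 1) = sign_of A" if "A \<in> Pow I" for A
    using that by (fastforce simp: sign_of_def fun_eq_iff)
  then have "(\<Sum>A\<in>Pow I. F (\<lambda>i. if i \<in> I then sign_of A i else 1)) = (\<Sum>A\<in>Pow I. F (sign_of A))"
    by (intro sum.cong arg_cong[where f = F]) auto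
  then show ?thesis using nonneg[OF assms(2)] by metis
qed

text \<open>The identity fg + f'g' = ((f + f')(g + g') + (f - f')(g - g')) / 2 and its counterpart
  for the difference carry the cone condition from the factors to the products.\<close>

lemma ginibre_prod:
  assumes "finite E" "\<And>e. e \<in> E \<Longrightarrow> ginibre (\<lambda>v. F e v + G e v)" "\<And>e. e \<in> E \<Longrightarrow> ginibre (\<lambda>v. F e v - G e v)"
  shows "ginibre (\<lambda>v. (\<Prod>e\<in>E. F e v) + (\<Prod>e\<in>E. G e v)) \<and> ginibre (\<lambda>v. (\<Prod>e\<in>E. F e v) - (\<Prod>e\<in>E. G e v))"
  using assms
proof (induction E rule: finite_induct)
  case empty
  then show ?case using ginibre.const[of 2] ginibre.const[of 0] by simp
next
  case (insert e E)
  let ?p = "\<lambda>v. (\<Prod>e\<in>E. F e v) + (\<Prod>e\<in>E. G e v)" and ?m = "\<lambda>v. (\<Prod>e\<in>E. F e v) - (\<Prod>e\<in>E. G e v)"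
  have *: "ginibre ?p" "ginibre ?m" using insert by auto
  have e: "ginibre (\<lambda>v. F e v + G e v)" "ginibre (\<lambda>v. F e v - G e v)" using insert.prems by auto
  have g: "ginibre (\<lambda>v. 1/2 * ((F e v + G e v) * ?p v + (F e v - G e v) * ?m v))"
    "ginibre (\<lambda>v. 1/2 * ((F e v + G e v) * ?m v + (F e v - G e v) * ?p v))"
    by (rule ginibre.mult[OF ginibre.const ginibre.add[OF ginibre.mult[OF e(1) *(1)] ginibre.mult[OF e(2) *(2)]]], simp)
       (rule ginibre.mult[OF ginibre.const ginibre.add[OF ginibre.mult[OF e(1) *(2)] ginibre.mult[OF e(2) *(1)]]], simp)
  have r: "1/2 * ((a + b) * (p + q) + (a - b) * (p - q)) = a * p + b * q"
    "1/2 * ((a + b) * (p - q) + (a - b) * (p + q)) = a * p - b * q" for a b p q :: real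
    by (simp_all add: field_simps)
  show ?case
    using g unfolding r prod.insert[OF insert.hyps] by (rule conjI)
qed

text \<open>A product of two signs is 1 or -1, so on sign vectors the exponential agrees with the
  polynomial cosh K + sinh K * (v i * v j), and |J'| <= J orders the coefficients. For i = j the
  sign product is 1 and the exponential is a constant, whatever the sign of J.\<close>

lemma ginibre_exp:
  assumes "\<bar>J'\<bar> \<le> J \<or> i = j \<and> J' = J"
  shows "\<exists>F G. ginibre (\<lambda>v. F v + G v) \<and> ginibre (\<lambda>v. F v - G v) \<and>
    (\<forall>A. F (sign_of A) = exp (J * (sign_of A i * sign_of A j)) \<and> G (sign_of A) = exp (J' * (sign_of A i * sign_of A j)))"
proof (cases "\<bar>J'\<bar> \<le> J")
  case True
  have e: "exp (K * (sign_of A i * sign_of A j)) = cosh K + sinh K * (sign_of A i * sign_of A j)" for K and A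
    using cosh_plus_sinh[of K] cosh_minus_sinh[of K] by (auto simp: sign_of_def)
  have "cosh \<bar>J'\<bar> \<le> cosh J"
    by (subst cosh_real_nonneg_le_iff) (use True in auto)
  moreover have "sinh J' \<le> sinh J" "sinh (- J') \<le> sinh J"
    using True by (simp_all only: sinh_real_le_iff abs_le_iff)
  ultimately have c: "cosh J' \<le> cosh J" "sinh J' \<le> sinh J" "0 \<le> sinh J + sinh J'"
    by simp_all
  let ?F = "\<lambda>K v. cosh K + sinh K * (v i * v j)"
  have "ginibre (\<lambda>v. (cosh J + cosh J') + (sinh J + sinh J') * (v i * v j))"
    "ginibre (\<lambda>v. (cosh J - cosh J') + (sinh J - sinh J') * (v i * v j))"
    by (rule ginibre.add[OF ginibre.const ginibre.mult[OF ginibre.const ginibre.mult[OF ginibre.coord ginibre.coord]]];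
        use c cosh_real_nonneg[of J'] in linarith)+
  then show ?thesis by (intro exI[of _ "?F J"] exI[of _ "?F J'"]) (simp add: e algebra_simps)
next
  case False
  then have *: "i = j" "J' = J" using assms by auto
  show ?thesis
    by (intro exI[of _ "\<lambda>_. exp J"]) (use * ginibre.const[of "exp J + exp J"] ginibre.const[of 0] in auto)
qed

text \<open>A Griffiths-Ginibre comparison of Ising partition functions: the difference of the
  Boltzmann weights agrees on sign vectors with an element of Ginibre's cone, hence has a
  nonnegative sum. The alternative for i = j admits diagonal couplings of either sign.\<close>

lemma ising_partition_mono:
  fixes J J' :: "'i \<Rightarrow> 'i \<Rightarrow> real"
  assumes "finite I"
    and "\<And>i j. i \<in> I \<Longrightarrow> j \<in> I \<Longrightarrow> \<bar>J' i j\<bar> \<le> J i j \<or> i = j \<and> J' i j = J i j"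
  shows "(\<Sum>A\<in>Pow I. exp (\<Sum>i\<in>I. \<Sum>j\<in>I. J' i j * (sign_of A i * sign_of A j)))
    \<le> (\<Sum>A\<in>Pow I. exp (\<Sum>i\<in>I. \<Sum>j\<in>I. J i j * (sign_of A i * sign_of A j)))"
proof -
  have "\<forall>p\<in>I \<times> I. \<exists>F G. ginibre (\<lambda>v. F v + G v) \<and> ginibre (\<lambda>v. F v - G v) \<and>
    (\<forall>A. F (sign_of A) = exp (J (fst p) (snd p) * (sign_of A (fst p) * sign_of A (snd p))) \<and>
       G (sign_of A) = exp (J' (fst p) (snd p) * (sign_of A (fst p) * sign_of A (snd p))))"
    by (intro ballI ginibre_exp) (use assms(2) in \<open>simp add: mem_Times_iff\<close>)
  from bchoice[OF this] obtain F where "\<forall>p\<in>I \<times> I. \<exists>G. ginibre (\<lambda>v. F p v + G v) \<and> ginibre (\<lambda>v. F p v - G v) \<and>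
    (\<forall>A. F p (sign_of A) = exp (J (fst p) (snd p) * (sign_of A (fst p) * sign_of A (snd p))) \<and>
       G (sign_of A) = exp (J' (fst p) (snd p) * (sign_of A (fst p) * sign_of A (snd p))))" ..
  from bchoice[OF this] obtain G where FG: "\<forall>p\<in>I \<times> I. ginibre (\<lambda>v. F p v + G p v) \<and> ginibre (\<lambda>v. F p v - G p v) \<and>
    (\<forall>A. F p (sign_of A) = exp (J (fst p) (snd p) * (sign_of A (fst p) * sign_of A (snd p))) \<and>
       G p (sign_of A) = exp (J' (fst p) (snd p) * (sign_of A (fst p) * sign_of A (snd p))))" ..
  have "0 \<le> (\<Sum>A\<in>Pow I. (\<Prod>p\<in>I \<times> I. F p (sign_of A)) - (\<Prod>p\<in>I \<times> I. G p (sign_of A)))"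
    by (rule ginibre_sum_nonneg[OF assms(1) ginibre_prod[THEN conjunct2]]) (use assms(1) FG in auto)
  then show ?thesis
    by (simp add: FG sum_subtractf sum.cartesian_product exp_sum assms(1) case_prod_beta)
qed

text \<open>If a random vector has density proportional to the exponential of the quadratic form B,
  this is the unnormalised density of its vector of moduli.\<close>

definition sign_sum :: "'i set \<Rightarrow> ('i \<Rightarrow> 'i \<Rightarrow> real) \<Rightarrow> ('i \<Rightarrow> real) \<Rightarrow> real" where
  "sign_sum I B x = (\<Sum>A\<in>Pow I. exp (\<Sum>i\<in>I. \<Sum>j\<in>I. B i j * ((sign_of A i * x i) * (sign_of A j * x j))))"

lemma sum_Pow_sym_diff:
  assumes "D \<subseteq> I"
  shows "(\<Sum>A\<in>Pow I. F (sym_diff A D)) = (\<Sum>A\<in>Pow I. F A)"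
  by (rule sum.reindex_bij_witness[of _ "\<lambda>A. sym_diff A D" "\<lambda>A. sym_diff A D"])
     (use assms in \<open>auto intro!: arg_cong[where f = F]\<close>)

lemma sign_of_sym_diff: "sign_of (sym_diff A D) i = sign_of A i * sign_of D i"
  by (auto simp: sign_of_def)

text \<open>The signs of x are absorbed into the summation index: shifting A by the set where x is
  negative permutes the subsets of I.\<close>

lemma sign_sum_abs: "sign_sum I B (\<lambda>i. \<bar>x i\<bar>) = sign_sum I B x"
proof -
  let ?D = "{i\<in>I. x i < 0}"
  let ?G = "\<lambda>A. exp (\<Sum>i\<in>I. \<Sum>j\<in>I. B i j * ((sign_of A i * x i) * (sign_of A j * x j)))"
  have "sign_of A i * \<bar>x i\<bar> = sign_of (sym_diff A ?D) i * x i" if "i \<in> I" for A i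
    using that by (auto simp: sign_of_def)
  then have "sign_sum I B (\<lambda>i. \<bar>x i\<bar>) = (\<Sum>A\<in>Pow I. ?G (sym_diff A ?D))"
    unfolding sign_sum_def by (intro sum.cong arg_cong[where f = exp] refl) simp
  also have "\<dots> = sign_sum I B x"
    unfolding sign_sum_def by (rule sum_Pow_sym_diff) auto
  finally show ?thesis .
qed

text \<open>Ginibre's duplication: substituting \<open>\<theta>\<^sub>i\<close> for the product of the two signs at \<open>i\<close> turns the product of two
  sign sums into a sum over \<open>\<theta>\<close> of ferromagnetic partition functions, and for each fixed \<open>\<theta>\<close> the couplings
  \<open>B i j * (x i * x j + \<theta>\<^sub>i * \<theta>\<^sub>j * (y i * y j))\<close> do not decrease in modulus when \<open>(x, y)\<close> is replaced by the
  pointwise maximum and minimum of the moduli.\<close>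

lemma sign_sum_supermodular:
  fixes x y :: "'i \<Rightarrow> real"
  assumes I: "finite I" and B: "\<And>i j. i \<in> I \<Longrightarrow> j \<in> I \<Longrightarrow> i \<noteq> j \<Longrightarrow> 0 \<le> B i j"
  shows "sign_sum I B x * sign_sum I B y \<le> sign_sum I B (max_abs x y) * sign_sum I B (min_abs x y)"
proof -
  let ?J = "\<lambda>x y D i j. B i j * (x i * x j + sign_of D i * sign_of D j * (y i * y j))"
  have prod: "sign_sum I B x * sign_sum I B y =
      (\<Sum>D\<in>Pow I. \<Sum>A\<in>Pow I. exp (\<Sum>i\<in>I. \<Sum>j\<in>I. ?J x y D i j * (sign_of A i * sign_of A j)))" for x y
  proof -
    let ?G = "\<lambda>A x. \<Sum>i\<in>I. \<Sum>j\<in>I. B i j * ((sign_of A i * x i) * (sign_of A j * x j))"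
    have "sign_sum I B x * sign_sum I B y = (\<Sum>A\<in>Pow I. \<Sum>C\<in>Pow I. exp (?G A x + ?G C y))"
      unfolding sign_sum_def sum_product exp_add ..
    \<comment> \<open>The second sign vector is written as that of A times \<open>sign_of D\<close>,
      so D records where the two differ.\<close>
    also have "\<dots> = (\<Sum>A\<in>Pow I. \<Sum>D\<in>Pow I. exp (?G A x + ?G (sym_diff D A) y))"
      by (intro sum.cong refl sum_Pow_sym_diff[symmetric]) auto
    also have "\<dots> = (\<Sum>D\<in>Pow I. \<Sum>A\<in>Pow I. exp (?G A x + ?G (sym_diff D A) y))"
      by (rule sum.swap)
    also have "\<dots> = (\<Sum>D\<in>Pow I. \<Sum>A\<in>Pow I. exp (\<Sum>i\<in>I. \<Sum>j\<in>I. ?J x y D i j * (sign_of A i * sign_of A j)))"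
      unfolding sign_of_sym_diff
      by (intro sum.cong arg_cong[where f = exp] refl) (simp add: sum.distrib[symmetric] algebra_simps)
    finally show ?thesis .
  qed
  have main: "sign_sum I B x * sign_sum I B y \<le> sign_sum I B (max_abs x y) * sign_sum I B (min_abs x y)"
    if nn: "\<And>i. 0 \<le> x i" "\<And>i. 0 \<le> y i" for x y :: "'i \<Rightarrow> real"
    unfolding prod
  proof (rule sum_mono, rule ising_partition_mono[OF I])
    fix D i j assume "D \<in> Pow I" and ij: "i \<in> I" "j \<in> I"
    have hl: "max_abs x y k = max (x k) (y k)" "min_abs x y k = min (x k) (y k)" for k
      using nn[of k] by (auto simp: max_abs_def min_abs_def)
    show "\<bar>?J x y D i j\<bar> \<le> ?J (max_abs x y) (min_abs x y) D i j \<or> i = j \<and> ?J x y D i j = ?J (max_abs x y) (min_abs x y) D i j"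
    proof (cases "i = j")
      case True
      \<comment> \<open>The squared sign is 1 and max^2 + min^2 = x^2 + y^2, so diagonal couplings
        do not change at all, whatever the sign of \<open>B i i\<close>.\<close>
      then show ?thesis by (auto simp: hl max_def min_def)
    next
      case False
      \<comment> \<open>For s = 1 this is p + q <= u + v; for s = -1 it holds because p and q both
        lie between v and u.\<close>
      have bnd: "\<bar>p + s * q\<bar> \<le> u + s * v" if "s = 1 \<or> s = -1"
        "p \<le> u" "q \<le> u" "v \<le> p" "v \<le> q" "p + q \<le> u + v" "0 \<le> p" "0 \<le> q" for p q u v s :: real
        using that by auto
      have "\<bar>x i * x j + s * (y i * y j)\<bar> \<le> max_abs x y i * max_abs x y j + s * (min_abs x y i * min_abs x y j)"
        if "s = 1 \<or> s = -1" for s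
      proof -
        let ?a = "x i" and ?b = "x j" and ?c = "y i" and ?d = "y j"
        have "0 \<le> (max ?a ?c - ?a) * (max ?b ?d - ?b)" "0 \<le> ?a * ?b" "0 \<le> ?c * ?d"
          using nn by simp_all
        have "?a * ?b \<le> max ?a ?c * max ?b ?d" "?c * ?d \<le> max ?a ?c * max ?b ?d"
          "min ?a ?c * min ?b ?d \<le> ?a * ?b" "min ?a ?c * min ?b ?d \<le> ?c * ?d"
          using nn by (auto intro!: mult_mono simp: le_max_iff_disj)
        \<comment> \<open>The rearrangement inequality: pairing the larger entries with each other
          does not decrease the sum of products.\<close>
        moreover have "?a * ?b + ?c * ?d \<le> max ?a ?c * max ?b ?d + min ?a ?c * min ?b ?d"
        proof -
          have "0 \<le> (?c - ?a) * (?b - ?d)" if "?a \<le> ?c" "?d \<le> ?b" using that by simp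
          moreover have "0 \<le> (?a - ?c) * (?d - ?b)" if "?c \<le> ?a" "?b \<le> ?d" using that by simp
          ultimately show ?thesis by (auto simp: max_def min_def algebra_simps)
        qed
        ultimately show ?thesis unfolding hl using bnd[OF that] \<open>0 \<le> ?a * ?b\<close> \<open>0 \<le> ?c * ?d\<close> by blast
      qed
      from mult_left_mono[OF this B[OF ij False], of "sign_of D i * sign_of D j"]
      show ?thesis using B[OF ij False] by (auto simp: abs_mult sign_of_def)
    qed
  qed
  have "(\<lambda>i. \<bar>max_abs x y i\<bar>) = max_abs (\<lambda>i. \<bar>x i\<bar>) (\<lambda>i. \<bar>y i\<bar>)" "(\<lambda>i. \<bar>min_abs x y i\<bar>) = min_abs (\<lambda>i. \<bar>x i\<bar>) (\<lambda>i. \<bar>y i\<bar>)"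
    by (auto simp: max_abs_def min_abs_def)
  then show ?thesis
    using main[of "\<lambda>i. \<bar>x i\<bar>" "\<lambda>i. \<bar>y i\<bar>"] by (metis abs_ge_zero sign_sum_abs)
qed

text \<open>Closure under smaller moduli includes invariance under sign changes, since equal moduli
  allow passing in both directions.\<close>

definition abs_decreasing :: "nat \<Rightarrow> (nat \<Rightarrow> real) set \<Rightarrow> bool" where
  "abs_decreasing n E \<longleftrightarrow> E \<in> sets (Pi\<^sub>M {..<n} (\<lambda>_. lborel)) \<and>
     (\<forall>x\<in>E. \<forall>y\<in>space (Pi\<^sub>M {..<n} (\<lambda>_. lborel)). (\<forall>i<n. \<bar>y i\<bar> \<le> \<bar>x i\<bar>) \<longrightarrow> y \<in> E)"

lemma abs_decreasing_Int: "abs_decreasing n E \<Longrightarrow> abs_decreasing n F \<Longrightarrow> abs_decreasing n (E \<inter> F)"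
  unfolding abs_decreasing_def by blast

text \<open>As E and F are invariant under sign changes, p can be replaced by the sign sum S at the
  cost of a factor 2^n. The four functions are then S times the indicators of E, of F, of the whole
  space and of the intersection, to which \<open>min_abs x y\<close> belongs. The inequality is
  homogeneous in the unnormalised density p.\<close>

theorem fkg_quadratic:
  fixes B :: "nat \<Rightarrow> nat \<Rightarrow> real"
  assumes B: "\<And>i j. i < n \<Longrightarrow> j < n \<Longrightarrow> i \<noteq> j \<Longrightarrow> 0 \<le> B i j"
    and E: "abs_decreasing n E" "abs_decreasing n F"
  defines "P \<equiv> Pi\<^sub>M {..<n} (\<lambda>_. lborel :: real measure)"
    and "p \<equiv> \<lambda>x. ennreal (exp (\<Sum>i<n. \<Sum>j<n. B i j * (x i * x j)))"
  shows "(\<integral>\<^sup>+x. indicator E x * p x \<partial>P) * (\<integral>\<^sup>+x. indicator F x * p x \<partial>P)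
    \<le> (\<integral>\<^sup>+x. indicator (E \<inter> F) x * p x \<partial>P) * (\<integral>\<^sup>+x. p x \<partial>P)"
proof -
  let ?S = "\<lambda>x. ennreal (sign_sum {..<n} B x)"
  have [measurable]: "E \<in> sets P" "F \<in> sets P" using E by (auto simp: abs_decreasing_def P_def)
  have comp [measurable]: "(\<lambda>x. x i) \<in> borel_measurable P" if "i < n" for i
    unfolding P_def using that by simp
  have pm [measurable]: "p \<in> borel_measurable P" unfolding p_def by measurable
  have Sm [measurable]: "?S \<in> borel_measurable P" unfolding sign_sum_def by measurable
  \<comment> \<open>Each change of signs preserves both Lebesgue measure and G, so the 2^n summands
    have equal integrals.\<close>
  have fold: "(\<integral>\<^sup>+x. indicator G x * ?S x \<partial>P) = 2 ^ n * (\<integral>\<^sup>+x. indicator G x * p x \<partial>P)"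
    if G: "abs_decreasing n G" for G
  proof -
    have [measurable]: "G \<in> sets P" using G by (auto simp: abs_decreasing_def P_def)
    let ?f = "\<lambda>A x. \<lambda>k\<in>{..<n}. sign_of A k * x k"
    have fsp: "?f A x \<in> space P" for A x by (auto simp: P_def space_PiM)
    have fm [measurable]: "?f A \<in> P \<rightarrow>\<^sub>M P" for A
      unfolding P_def
    proof (rule measurable_restrict)
      fix k assume "k \<in> {..<n}"
      then have [measurable]: "(\<lambda>x. x k) \<in> borel_measurable (Pi\<^sub>M {..<n} (\<lambda>_. lborel))"
        using comp[of k] by (simp add: P_def)
      show "(\<lambda>x. sign_of A k * x k) \<in> Pi\<^sub>M {..<n} (\<lambda>_. lborel) \<rightarrow>\<^sub>M lborel" by simp
    qed
    have ind: "indicator G (?f A x) = (indicator G x :: ennreal)" if x: "x \<in> space P" for A x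
    proof -
      have D: "v \<in> G" if "u \<in> G" "v \<in> space P" "\<forall>i<n. \<bar>v i\<bar> \<le> \<bar>u i\<bar>" for u v
        using G that unfolding abs_decreasing_def P_def[symmetric] by blast
      have "?f A x \<in> G \<longleftrightarrow> x \<in> G"
        by (rule iffI; erule D) (use x fsp in \<open>auto simp: abs_mult\<close>)
      then show ?thesis by (simp add: indicator_def)
    qed
    have "(\<integral>\<^sup>+x. indicator G x * ?S x \<partial>P) = (\<integral>\<^sup>+x. (\<Sum>A\<in>Pow {..<n}. indicator G x * p (?f A x)) \<partial>P)"
      unfolding sum_distrib_left[symmetric]
      by (intro nn_integral_cong) (simp add: sign_sum_def p_def)
    also have "\<dots> = (\<Sum>A\<in>Pow {..<n}. \<integral>\<^sup>+x. indicator G x * p (?f A x) \<partial>P)"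
      by (rule nn_integral_sum) measurable
    also have "\<dots> = (\<Sum>A\<in>Pow {..<n}. \<integral>\<^sup>+x. indicator G x * p x \<partial>P)"
    proof (rule sum.cong[OF refl])
      fix A
      have "(\<integral>\<^sup>+x. indicator G x * p (?f A x) \<partial>P) = (\<integral>\<^sup>+x. indicator G (?f A x) * p (?f A x) \<partial>P)"
        by (intro nn_integral_cong) (simp add: ind)
      also have "\<dots> = (\<integral>\<^sup>+x. indicator G x * p x \<partial>P)"
        using nn_integral_PiM_lborel_triangular[of "\<lambda>x. indicator G x * p x" n "sign_of A" "\<lambda>_ _. 0"]
        by (simp add: P_def[symmetric])
      finally show "(\<integral>\<^sup>+x. indicator G x * p (?f A x) \<partial>P) = (\<integral>\<^sup>+x. indicator G x * p x \<partial>P)" .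
    qed
    finally show ?thesis by (simp add: card_Pow)
  qed
  have univ: "abs_decreasing n (space P)" by (auto simp: abs_decreasing_def P_def)
  have foldp: "(\<integral>\<^sup>+x. ?S x \<partial>P) = 2 ^ n * (\<integral>\<^sup>+x. p x \<partial>P)"
    using fold[OF univ] by (simp cong: nn_integral_cong)
  have "(\<integral>\<^sup>+x. indicator E x * ?S x \<partial>P) * (\<integral>\<^sup>+x. indicator F x * ?S x \<partial>P)
    \<le> (\<integral>\<^sup>+x. ?S x \<partial>P) * (\<integral>\<^sup>+x. indicator (E \<inter> F) x * ?S x \<partial>P)"
    unfolding P_def
  proof (rule four_functions_PiM, unfold P_def[symmetric])
    fix x y assume xy: "x \<in> space P" "y \<in> space P"
    have min_abs: "min_abs x y \<in> E \<inter> F" if "x \<in> E" "y \<in> F"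
    proof -
      have "min_abs x y \<in> space P" "\<forall>i<n. \<bar>min_abs x y i\<bar> \<le> \<bar>x i\<bar>" "\<forall>i<n. \<bar>min_abs x y i\<bar> \<le> \<bar>y i\<bar>"
        using xy by (auto simp: P_def) (auto simp: min_abs_def)
      then show ?thesis using that E unfolding abs_decreasing_def P_def[symmetric] by blast
    qed
    have "?S x * ?S y \<le> ?S (max_abs x y) * ?S (min_abs x y)"
      using sign_sum_supermodular[of "{..<n}" B x y] B
      by (simp add: sign_sum_def sum_nonneg flip: ennreal_mult)
    then show "indicator E x * ?S x * (indicator F y * ?S y)
       \<le> ?S (max_abs x y) * (indicator (E \<inter> F) (min_abs x y) * ?S (min_abs x y))"
      using min_abs by (auto simp: indicator_def)
  qed simp_all
  then have "2 ^ n * (2 ^ n * ((\<integral>\<^sup>+x. indicator E x * p x \<partial>P) * (\<integral>\<^sup>+x. indicator F x * p x \<partial>P)))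
    \<le> 2 ^ n * (2 ^ n * ((\<integral>\<^sup>+x. indicator (E \<inter> F) x * p x \<partial>P) * (\<integral>\<^sup>+x. p x \<partial>P)))"
    unfolding fold[OF E(1)] fold[OF E(2)] fold[OF abs_decreasing_Int[OF E]] foldp
    by (simp add: ac_simps)
  then show ?thesis by (simp add: ennreal_mult_le_mult_iff power_eq_top_ennreal)
qed

section \<open>Gaussian vectors\<close>

abbreviation "std_normal \<equiv> density lborel (\<lambda>x. ennreal (std_normal_density x))"

lemma prob_space_std_normal: "prob_space std_normal"
  by (rule prob_space_normal_density) simp

text \<open>Under the density w / K the variable X is standard normal by Levy's theorem. The case s
  = 0 identifies K as the total mass of w; if it vanishes, so does w almost surely.\<close>

lemma (in prob_space) weighted_std_normal:
  fixes w X :: "'a \<Rightarrow> real"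
  assumes [measurable]: "w \<in> borel_measurable M" "X \<in> borel_measurable M" "A \<in> sets borel"
    and w: "\<And>\<omega>. 0 \<le> w \<omega>" "\<And>\<omega>. w \<omega> \<le> C"
    and char: "\<And>s. (CLINT \<omega>|M. complex_of_real (w \<omega>) * iexp (s * X \<omega>)) = complex_of_real (K * exp (- s\<^sup>2 / 2))"
  shows "(LINT \<omega>|M. w \<omega> * indicator A (X \<omega>)) = K * measure std_normal A"
proof -
  have int: "integrable M w"
    by (rule integrable_const_bound[of _ C]) (use w in auto)
  have K: "(LINT \<omega>|M. w \<omega>) = K"
    using char[of 0] by (simp add: integral_of_real of_real_eq_iff)
  have "0 \<le> K" unfolding K[symmetric] using w by (intro integral_nonneg_AE) auto
  show ?thesis
  proof (cases "K = 0")
    case True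
    then have "AE \<omega> in M. w \<omega> = 0"
      using integral_nonneg_eq_0_iff_AE[OF int] w K by auto
    then have "AE \<omega> in M. w \<omega> * indicator A (X \<omega>) = 0" by eventually_elim simp
    then have "(LINT \<omega>|M. w \<omega> * indicator A (X \<omega>)) = (LINT \<omega>|M. 0)"
      by (intro integral_cong_AE) auto
    then show ?thesis using True by simp
  next
    case False
    then have K0: "K > 0" using \<open>0 \<le> K\<close> by simp
    define D where "D = density M (\<lambda>\<omega>. ennreal (w \<omega> / K))"
    have sD [measurable_cong]: "sets D = sets M" by (simp add: D_def)
    have [simp]: "space D = space M" by (simp add: D_def)
    interpret D: prob_space D
    proof
      have "emeasure D (space D) = (\<integral>\<^sup>+\<omega>. ennreal (w \<omega> / K) \<partial>M)"
        by (simp add: D_def emeasure_density)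
      also have "\<dots> = ennreal (LINT \<omega>|M. w \<omega> / K)"
        by (rule nn_integral_eq_integral) (use w K0 int in auto)
      finally show "emeasure D (space D) = 1" using K K0 by simp
    qed
    have "distr D borel X = std_normal"
    proof (rule Levy_uniqueness)
      show "real_distribution (distr D borel X)" by (rule D.real_distribution_distr) simp
      show "real_distribution std_normal" by (rule real_dist_normal_dist)
      show "char (distr D borel X) = char std_normal"
      proof
        fix s
        have "char (distr D borel X) s = (CLINT \<omega>|D. iexp (s * X \<omega>))"
          by (simp add: char_def integral_distr)
        also have "\<dots> = (CLINT \<omega>|M. (w \<omega> / K) *\<^sub>R iexp (s * X \<omega>))"
          unfolding D_def by (rule integral_density) (use w K0 in auto)
        also have "\<dots> = (CLINT \<omega>|M. complex_of_real (1 / K) * (complex_of_real (w \<omega>) * iexp (s * X \<omega>)))"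
          by (simp add: scaleR_conv_of_real)
        also have "\<dots> = complex_of_real (1 / K) * (CLINT \<omega>|M. (complex_of_real (w \<omega>) * iexp (s * X \<omega>)))"
          by (rule integral_mult_right_zero)
        also have "\<dots> = char std_normal s"
          using K0 by (simp only: char char_std_normal_distribution) simp
        finally show "char (distr D borel X) s = char std_normal s" .
      qed
    qed
    then have "measure std_normal A = measure D (X -` A \<inter> space M)"
      using measure_distr[of X D borel A] by simp
    also have "\<dots> = (LINT \<omega>|D. indicator A (X \<omega>))"
    proof -
      have "measure D (X -` A \<inter> space M) = (LINT \<omega>|D. indicator (X -` A \<inter> space M) \<omega>)"
        by (subst Bochner_Integration.integral_indicator) simp
      also have "\<dots> = (LINT \<omega>|D. indicator A (X \<omega>))"
        by (rule Bochner_Integration.integral_cong) (auto simp: indicator_def)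
      finally show ?thesis .
    qed
    also have "\<dots> = (LINT \<omega>|M. (w \<omega> / K) * indicator A (X \<omega>))"
      unfolding D_def by (subst integral_density) (use w K0 in auto)
    also have "\<dots> = (LINT \<omega>|M. w \<omega> * indicator A (X \<omega>)) / K" by simp
    finally show ?thesis using K0 by simp
  qed
qed

text \<open>The weights \<open>G (2 + cos V)\<close> and \<open>G (2 + sin V)\<close> are nonnegative, so Levy's uniqueness theorem, which is only
  available on the real line, applies to them. This allows one to replace, coordinate by coordinate, the
  exponentials in a joint characteristic function by indicators.\<close>

lemma (in prob_space) weighted_std_normal_iexp:
  fixes G X V :: "'a \<Rightarrow> real"
  assumes [measurable]: "G \<in> borel_measurable M" "X \<in> borel_measurable M" "V \<in> borel_measurable M" "A \<in> sets borel"
    and G01: "\<And>\<omega>. 0 \<le> G \<omega>" "\<And>\<omega>. G \<omega> \<le> 1"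
    and base: "\<And>s c. (CLINT \<omega>|M. complex_of_real (G \<omega>) * iexp (s * X \<omega> + c * V \<omega>)) =
     complex_of_real (p * exp (- s\<^sup>2 / 2) * exp (- c\<^sup>2 * q / 2))"
  shows "(CLINT \<omega>|M. complex_of_real (G \<omega> * indicator A (X \<omega>)) * iexp (V \<omega>)) =
     complex_of_real (p * measure std_normal A * exp (- q / 2))"
proof -
  have int: "integrable M (\<lambda>\<omega>. complex_of_real (G \<omega>) * iexp (s * X \<omega> + c * V \<omega>))" for s c
    by (rule integrable_const_bound[of _ 1]) (use G01 in \<open>auto simp: norm_mult\<close>)
  \<comment> \<open>Only the frequencies c = 0, 1 and -1 of V are used; they generate 1, cos V and
    sin V.\<close>
  have lin: "(CLINT \<omega>|M. a * (complex_of_real (G \<omega>) * iexp (s * X \<omega> + 0 * V \<omega>)) +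
      (b * (complex_of_real (G \<omega>) * iexp (s * X \<omega> + 1 * V \<omega>))
       + d * (complex_of_real (G \<omega>) * iexp (s * X \<omega> + (-1) * V \<omega>)))) =
     complex_of_real (p * exp (- s\<^sup>2 / 2)) * (a + (b + d) * complex_of_real (exp (- q / 2)))" for a b d s
    by (simp only: Bochner_Integration.integral_add[OF integrable_mult_right[OF int] Bochner_Integration.integrable_add[OF integrable_mult_right[OF int] integrable_mult_right[OF int]]]
          Bochner_Integration.integral_add[OF integrable_mult_right[OF int] integrable_mult_right[OF int]] integral_mult_right_zero base)
       (simp add: algebra_simps)
  have one: "(CLINT \<omega>|M. complex_of_real (G \<omega>) * iexp (s * X \<omega>)) = complex_of_real (p * exp (- s\<^sup>2 / 2))" for s
    using base[of s 0] by simp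
  let ?e = "exp (- q / 2)"
  have cosw: "(CLINT \<omega>|M. complex_of_real (G \<omega> * (2 + cos (V \<omega>))) * iexp (s * X \<omega>))
     = complex_of_real (p * (2 + ?e) * exp (- s\<^sup>2 / 2))" for s
  proof -
    have "complex_of_real (g * (2 + cos v)) * iexp r =
      2 * (complex_of_real g * iexp (r + 0 * v)) +
      (1/2 * (complex_of_real g * iexp (r + 1 * v)) + 1/2 * (complex_of_real g * iexp (r + (-1) * v)))" for g v r :: real
      by (simp add: complex_eq_iff Re_exp Im_exp cos_add cos_diff sin_add sin_diff algebra_simps diff_divide_distrib add_divide_distrib)
    then show ?thesis by (simp only: lin) (simp add: algebra_simps)
  qed
  \<comment> \<open>Here the contributions of c = 1 and c = -1 cancel, because the right-hand side
    of \<open>base\<close> is even in c.\<close>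
  have sinw: "(CLINT \<omega>|M. complex_of_real (G \<omega> * (2 + sin (V \<omega>))) * iexp (s * X \<omega>))
     = complex_of_real (p * 2 * exp (- s\<^sup>2 / 2))" for s
  proof -
    have "complex_of_real (g * (2 + sin v)) * iexp r =
      2 * (complex_of_real g * iexp (r + 0 * v)) +
      ((- \<i>/2) * (complex_of_real g * iexp (r + 1 * v)) + \<i>/2 * (complex_of_real g * iexp (r + (-1) * v)))" for g v r :: real
      by (simp add: complex_eq_iff Re_exp Im_exp cos_add cos_diff sin_add sin_diff field_simps)
    then show ?thesis by (simp only: lin) (simp add: algebra_simps)
  qed
  let ?N = "measure std_normal A" and ?I = "\<lambda>\<omega>. indicator A (X \<omega>) :: real"
  have b2: "0 \<le> G \<omega> * (2 + t)" "G \<omega> * (2 + t) \<le> 3" if "\<bar>t\<bar> \<le> 1" for \<omega> t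
    using G01[of \<omega>] mult_mono[of "G \<omega>" 1 "2 + t" 3] that by auto
  have r1: "(LINT \<omega>|M. G \<omega> * ?I \<omega>) = p * ?N"
    by (rule weighted_std_normal[where C = 1]) (use G01 one in auto)
  have r2: "(LINT \<omega>|M. G \<omega> * (2 + cos (V \<omega>)) * ?I \<omega>) = p * (2 + ?e) * ?N"
    by (rule weighted_std_normal[where C = 3]) (use b2 cosw in auto)
  have r3: "(LINT \<omega>|M. G \<omega> * (2 + sin (V \<omega>)) * ?I \<omega>) = p * 2 * ?N"
    by (rule weighted_std_normal[where C = 3]) (use b2 sinw in auto)
  have bd: "\<bar>G \<omega> * ?I \<omega> * t\<bar> \<le> 1" if "\<bar>t\<bar> \<le> 1" for \<omega> t
    using G01[of \<omega>] that by (auto simp: abs_mult indicator_def intro!: mult_le_one)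
  have i1: "integrable M (\<lambda>\<omega>. G \<omega> * ?I \<omega>)" "integrable M (\<lambda>\<omega>. G \<omega> * ?I \<omega> * cos (V \<omega>))"
    "integrable M (\<lambda>\<omega>. G \<omega> * ?I \<omega> * sin (V \<omega>))"
    using bd[of 1] bd by (auto intro!: integrable_const_bound[of _ 1])
  have "(LINT \<omega>|M. G \<omega> * (2 + cos (V \<omega>)) * ?I \<omega>) = (LINT \<omega>|M. 2 * (G \<omega> * ?I \<omega>) + G \<omega> * ?I \<omega> * cos (V \<omega>))"
    by (simp add: algebra_simps)
  also have "\<dots> = 2 * (LINT \<omega>|M. G \<omega> * ?I \<omega>) + (LINT \<omega>|M. G \<omega> * ?I \<omega> * cos (V \<omega>))"
    using i1 by simp
  finally have c: "(LINT \<omega>|M. G \<omega> * ?I \<omega> * cos (V \<omega>)) = p * ?N * ?e"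
    unfolding r1 r2 by (simp add: algebra_simps)
  have "(LINT \<omega>|M. G \<omega> * (2 + sin (V \<omega>)) * ?I \<omega>) = (LINT \<omega>|M. 2 * (G \<omega> * ?I \<omega>) + G \<omega> * ?I \<omega> * sin (V \<omega>))"
    by (simp add: algebra_simps)
  also have "\<dots> = 2 * (LINT \<omega>|M. G \<omega> * ?I \<omega>) + (LINT \<omega>|M. G \<omega> * ?I \<omega> * sin (V \<omega>))"
    using i1 by simp
  finally have s: "(LINT \<omega>|M. G \<omega> * ?I \<omega> * sin (V \<omega>)) = 0"
    unfolding r1 r3 by (simp add: algebra_simps)
  have "(CLINT \<omega>|M. complex_of_real (G \<omega> * ?I \<omega>) * iexp (V \<omega>)) =
    (CLINT \<omega>|M. complex_of_real (G \<omega> * ?I \<omega> * cos (V \<omega>)) + \<i> * complex_of_real (G \<omega> * ?I \<omega> * sin (V \<omega>)))"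
    by (intro Bochner_Integration.integral_cong) (auto simp: complex_eq_iff Re_exp Im_exp)
  also have "\<dots> = complex_of_real (LINT \<omega>|M. G \<omega> * ?I \<omega> * cos (V \<omega>)) + \<i> * complex_of_real (LINT \<omega>|M. G \<omega> * ?I \<omega> * sin (V \<omega>))"
    using i1 by (subst Bochner_Integration.integral_add) (simp_all add: integral_of_real del: of_real_mult)
  finally show ?thesis unfolding c s by simp
qed

text \<open>Induction on k: the first k coordinates are already tested by indicators, the others
  still by exponentials. The case k = n is independence on boxes.\<close>

lemma (in prob_space) std_normal_vector_boxes:
  fixes \<xi> :: "nat \<Rightarrow> 'a \<Rightarrow> real"
  assumes meas: "\<And>i. i < n \<Longrightarrow> \<xi> i \<in> borel_measurable M"
    and char: "\<And>\<theta>. (CLINT \<omega>|M. iexp (\<Sum>i<n. \<theta> i * \<xi> i \<omega>)) = complex_of_real (exp (- (\<Sum>i<n. (\<theta> i)\<^sup>2) / 2))"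
    and A: "\<And>i. i < n \<Longrightarrow> A i \<in> sets borel" and "k \<le> n"
  shows "(CLINT \<omega>|M. complex_of_real (\<Prod>i<k. indicator (A i) (\<xi> i \<omega>)) * iexp (\<Sum>i\<in>{k..<n}. \<theta> i * \<xi> i \<omega>))
    = complex_of_real ((\<Prod>i<k. measure std_normal (A i)) * exp (- (\<Sum>i\<in>{k..<n}. (\<theta> i)\<^sup>2) / 2))"
  using \<open>k \<le> n\<close>
proof (induction k arbitrary: \<theta>)
  case 0
  then show ?case using char by (simp add: lessThan_atLeast0)
next
  case (Suc k)
  then have kn: "k < n" by simp
  have [measurable]: "\<xi> i \<in> borel_measurable M" "A i \<in> sets borel" if "i \<in> {..<k}" for i
    using that kn meas A by auto
  have [measurable]: "\<xi> i \<in> borel_measurable M" if "i \<in> {Suc k..<n}" for i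
    using that meas by auto
  let ?G = "\<lambda>\<omega>. (\<Prod>i<k. indicator (A i) (\<xi> i \<omega>)) :: real"
  let ?V = "\<lambda>\<omega>. \<Sum>i\<in>{Suc k..<n}. \<theta> i * \<xi> i \<omega>" and ?q = "\<Sum>i\<in>{Suc k..<n}. (\<theta> i)\<^sup>2"
  let ?p = "\<Prod>i<k. measure std_normal (A i)"
  have split: "{k..<n} = insert k {Suc k..<n}" using kn by auto
  have base: "(CLINT \<omega>|M. complex_of_real (?G \<omega>) * iexp (s * \<xi> k \<omega> + c * ?V \<omega>)) =
     complex_of_real (?p * exp (- s\<^sup>2 / 2) * exp (- c\<^sup>2 * ?q / 2))" for s c
  proof -
    \<comment> \<open>A free frequency s for the coordinate being converted and a common factor c
      for the later ones, as \<open>weighted_std_normal_iexp\<close> requires.\<close>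
    let ?t = "\<lambda>i. if i = k then s else c * \<theta> i"
    have "(\<Sum>i\<in>{k..<n}. ?t i * \<xi> i \<omega>) = s * \<xi> k \<omega> + c * ?V \<omega>" for \<omega>
      by (simp add: split sum_distrib_left ac_simps)
    moreover have "(\<Sum>i\<in>{k..<n}. (?t i)\<^sup>2) = s\<^sup>2 + c\<^sup>2 * ?q"
      by (simp add: split sum_distrib_left power_mult_distrib)
    moreover have "exp (- (s\<^sup>2 + c\<^sup>2 * ?q) / 2) = exp (- s\<^sup>2 / 2) * exp (- c\<^sup>2 * ?q / 2)"
      by (simp add: exp_add[symmetric] field_simps)
    ultimately show ?thesis
      using Suc.IH[of ?t] kn by (simp only: mult.assoc less_imp_le)
  qed
  have "(CLINT \<omega>|M. complex_of_real (?G \<omega> * indicator (A k) (\<xi> k \<omega>)) * iexp (?V \<omega>)) =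
     complex_of_real (?p * measure std_normal (A k) * exp (- ?q / 2))"
    by (rule weighted_std_normal_iexp[OF _ _ _ _ _ _ base])
       (use kn meas A in \<open>auto intro!: prod_nonneg prod_le_1\<close>)
  then show ?case by simp
qed

interpretation std_normal_product: product_sigma_finite "\<lambda>_::'i. std_normal"
  by (intro product_sigma_finite.intro prob_space_imp_sigma_finite prob_space_std_normal)

text \<open>Both measures are the n-fold product of standard normals, which is determined by its
  values on boxes. The four functions theorem works with densities, hence this form.\<close>

lemma (in prob_space) std_normal_vector_density:
  fixes \<xi> :: "nat \<Rightarrow> 'a \<Rightarrow> real"
  assumes meas: "\<And>i. i < n \<Longrightarrow> \<xi> i \<in> borel_measurable M"
    and char: "\<And>\<theta>. (CLINT \<omega>|M. iexp (\<Sum>i<n. \<theta> i * \<xi> i \<omega>)) = complex_of_real (exp (- (\<Sum>i<n. (\<theta> i)\<^sup>2) / 2))"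
  shows "distr M (Pi\<^sub>M {..<n} (\<lambda>_. lborel)) (\<lambda>\<omega>. \<lambda>i\<in>{..<n}. \<xi> i \<omega>) =
    density (Pi\<^sub>M {..<n} (\<lambda>_. lborel)) (\<lambda>x. \<Prod>i<n. ennreal (std_normal_density (x i)))"
proof -
  let ?P = "Pi\<^sub>M {..<n} (\<lambda>_. lborel :: real measure)"
  let ?X = "\<lambda>\<omega>. \<lambda>i\<in>{..<n}. \<xi> i \<omega>"
  interpret N: prob_space std_normal by (rule prob_space_std_normal)
  have sP: "sets ?P = sets (Pi\<^sub>M {..<n} (\<lambda>_. std_normal))"
    by (rule sets_PiM_cong) auto
  have Xm [measurable]: "?X \<in> M \<rightarrow>\<^sub>M ?P"
    by (rule measurable_restrict) (use meas in auto)
  have "distr M ?P ?X = Pi\<^sub>M {..<n} (\<lambda>_. std_normal)"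
  proof (rule std_normal_product.PiM_eqI)
    fix A :: "nat \<Rightarrow> real set" assume "\<And>i. i \<in> {..<n} \<Longrightarrow> A i \<in> sets std_normal"
    then have A: "A i \<in> sets borel" if "i < n" for i using that by auto
    have box: "Pi\<^sub>E {..<n} A \<in> sets ?P" using A by (intro sets_PiM_I_finite) auto
    have "measure M (?X -` Pi\<^sub>E {..<n} A \<inter> space M) = (LINT \<omega>|M. indicator (?X -` Pi\<^sub>E {..<n} A \<inter> space M) \<omega>)"
      by (subst Bochner_Integration.integral_indicator) simp
    also have "\<dots> = (LINT \<omega>|M. (\<Prod>i<n. indicator (A i) (\<xi> i \<omega>)))"
      by (rule Bochner_Integration.integral_cong) (auto simp: indicator_def PiE_def Pi_def)
    also have "complex_of_real \<dots> = complex_of_real (\<Prod>i<n. measure std_normal (A i))"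
      using std_normal_vector_boxes[OF meas char A order_refl] by (simp add: integral_of_real flip: of_real_prod)
    finally have "measure M (?X -` Pi\<^sub>E {..<n} A \<inter> space M) = (\<Prod>i<n. measure std_normal (A i))"
      by (simp only: of_real_eq_iff)
    then show "emeasure (distr M ?P ?X) (Pi\<^sub>E {..<n} A) = (\<Prod>i<n. emeasure std_normal (A i))"
      using box by (simp add: emeasure_distr emeasure_eq_measure N.emeasure_eq_measure prod_ennreal)
  qed (simp_all add: sP)
  moreover have "density ?P (\<lambda>x. \<Prod>i<n. ennreal (std_normal_density (x i))) = Pi\<^sub>M {..<n} (\<lambda>_. std_normal)"
  proof (rule std_normal_product.PiM_eqI)
    fix A :: "nat \<Rightarrow> real set" assume "\<And>i. i \<in> {..<n} \<Longrightarrow> A i \<in> sets std_normal"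
    then have A: "A i \<in> sets borel" if "i < n" for i using that by auto
    have box: "Pi\<^sub>E {..<n} A \<in> sets ?P" using A by (intro sets_PiM_I_finite) auto
    have "emeasure (density ?P (\<lambda>x. \<Prod>i<n. ennreal (std_normal_density (x i)))) (Pi\<^sub>E {..<n} A) =
      (\<integral>\<^sup>+x. (\<Prod>i<n. ennreal (std_normal_density (x i))) * indicator (Pi\<^sub>E {..<n} A) x \<partial>?P)"
      by (rule emeasure_density) (use box in auto)
    also have "\<dots> = (\<integral>\<^sup>+x. (\<Prod>i<n. ennreal (std_normal_density (x i)) * indicator (A i) (x i)) \<partial>?P)"
      by (rule nn_integral_cong) (auto simp: prod.distrib indicator_def space_PiM PiE_def Pi_def)
    also have "\<dots> = (\<Prod>i<n. \<integral>\<^sup>+r. ennreal (std_normal_density r) * indicator (A i) r \<partial>lborel)"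
      by (rule lborel_product.product_nn_integral_prod) (use A in auto)
    also have "\<dots> = (\<Prod>i<n. emeasure std_normal (A i))"
      by (rule prod.cong) (use A in \<open>auto simp: emeasure_density\<close>)
    finally show "emeasure (density ?P (\<lambda>x. \<Prod>i<n. ennreal (std_normal_density (x i)))) (Pi\<^sub>E {..<n} A) =
      (\<Prod>i<n. emeasure std_normal (A i))" .
  qed (simp_all add: sP)
  ultimately show ?thesis by simp
qed

section \<open>Fractional noise\<close>

text \<open>The coefficients of (1 - z)^(-c); a negative argument gives the inverse filter.\<close>

definition frac_coeff :: "real \<Rightarrow> nat \<Rightarrow> real" where
  "frac_coeff c k = pochhammer c k / fact k"

lemma frac_coeff_0 [simp]: "frac_coeff c 0 = 1"
  by (simp add: frac_coeff_def)

lemma frac_coeff_Suc: "frac_coeff c (Suc k) = frac_coeff c k * (c + k) / (k + 1)"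
  by (simp add: frac_coeff_def pochhammer_Suc field_simps)

lemma frac_coeff_nonneg: "0 \<le> c \<Longrightarrow> 0 \<le> frac_coeff c k"
  by (induction k) (auto simp: frac_coeff_Suc)

text \<open>The Vandermonde convolution with upper arguments -c and c, which add up to 0.\<close>

lemma frac_coeff_convolution:
  "Abs_fps (frac_coeff c) * Abs_fps (frac_coeff (- c)) = 1"
proof (rule fps_ext)
  fix n
  have e: "frac_coeff a k = (-1) ^ k * (- a gchoose k)" for a k
    by (simp add: frac_coeff_def gbinomial_pochhammer)
  have "fps_nth (Abs_fps (frac_coeff c) * Abs_fps (frac_coeff (- c))) n =
      (\<Sum>i = 0..n. (-1) ^ n * ((- c gchoose i) * (c gchoose (n - i))))"
    unfolding fps_mult_nth fps_nth_Abs_fps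
    by (intro sum.cong refl) (simp add: e power_add[symmetric] flip: mult.assoc)
  also have "\<dots> = (-1) ^ n * (\<Sum>i = 0..n. (- c gchoose i) * (c gchoose (n - i)))"
    by (simp add: sum_distrib_left)
  also have "\<dots> = (-1) ^ n * ((0 :: real) gchoose n)"
    by (simp add: gbinomial_Vandermonde)
  finally show "fps_nth (Abs_fps (frac_coeff c) * Abs_fps (frac_coeff (- c))) n = fps_nth 1 n"
    by (cases n) (auto simp: gbinomial_0)
qed

lemma frac_coeff_Suc': "frac_coeff c (Suc k) = c / (k + 1) * frac_coeff (c + 1) k"
  by (simp add: frac_coeff_def pochhammer_rec)

text \<open>Multiplying (1 - z)^(-c) by 1 / (1 - z) raises c by one. At -c, for c below 1, the
  right-hand side is nonnegative, which bounds the mass of the inverse filter beyond its constant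
  term.\<close>

lemma sum_frac_coeff: "(\<Sum>l\<le>N. frac_coeff c l) = frac_coeff (c + 1) N"
proof (induction N)
  case (Suc N)
  have "frac_coeff (c + 1) N + c / (N + 1) * frac_coeff (c + 1) N = frac_coeff (c + 1) N * ((c + 1 + N) / (N + 1))"
    by (simp add: field_simps)
  then show ?case using Suc frac_coeff_Suc'[of c N] by (simp add: frac_coeff_Suc)
qed simp

lemma frac_coeff_neg:
  assumes "0 < c" "c < 1"
  shows "frac_coeff (- c) (Suc k) \<le> 0"
  using assms by (simp add: frac_coeff_Suc' frac_coeff_nonneg divide_nonpos_pos mult_nonneg_nonneg)

text \<open>Consecutive coefficients have ratio (l - c) / (l + 1), which lies in [0, 1] for l >=
  1.\<close>

lemma frac_coeff_decreasing:
  assumes c: "0 < c" "c < 1" and k: "1 \<le> k" "k \<le> l"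
  shows "- frac_coeff (- c) l \<le> - frac_coeff (- c) k"
  using k(2)
proof (induction l rule: dec_induct)
  case (step l)
  then obtain l' where l': "l = Suc l'" using k by (cases l) auto
  have "(- frac_coeff (- c) l) * ((l - c) / (l + 1)) \<le> - frac_coeff (- c) l * 1"
    using c frac_coeff_neg[OF c, of l'] l' by (intro mult_left_mono) auto
  also have "(- frac_coeff (- c) l) * ((l - c) / (l + 1)) = - frac_coeff (- c) (Suc l)"
    by (simp add: frac_coeff_Suc)
  finally show ?case using step by simp
qed simp

text \<open>The precision matrix of the moving average \<open>X\<^sub>k = (\<Sum>j\<le>k. frac_coeff c (k - j) * \<xi>\<^sub>j)\<close>:
  the inverse filter has coefficients \<open>frac_coeff (- c)\<close>, all but the zeroth of which are nonpositive.\<close>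

definition precision :: "real \<Rightarrow> nat \<Rightarrow> nat \<Rightarrow> nat \<Rightarrow> real" where
  "precision c n i j = (\<Sum>k<n. (if i \<le> k then frac_coeff (- c) (k - i) else 0) * (if j \<le> k then frac_coeff (- c) (k - j) else 0))"

lemma precision_commute: "precision c n i j = precision c n j i"
  by (simp add: precision_def mult.commute)

text \<open>For \<open>i < j\<close> the term \<open>k = j\<close> is \<open>- f (j - i)\<close> with \<open>f l = - frac_coeff (- c) l\<close>, and the remaining positive
  terms add up to at most \<open>f (j - i)\<close> because \<open>f\<close> decreases and has total mass at most 1.\<close>

lemma precision_offdiag:
  assumes c: "0 < c" "c < 1" and ij: "i \<noteq> j" "i < n" "j < n"
  shows "precision c n i j \<le> 0"
proof -
  have "precision c n i j \<le> 0" if ij: "i < j" "j < n" for i j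
  proof -
    let ?m = "frac_coeff (- c)"
    have "precision c n i j = (\<Sum>k\<in>{j..<n}. ?m (k - i) * ?m (k - j))"
      unfolding precision_def by (rule sum.mono_neutral_cong_right) (use ij in auto)
    also have "\<dots> = ?m (j - i) + (\<Sum>k\<in>{Suc j..<n}. ?m (k - i) * ?m (k - j))"
      using ij by (subst sum.atLeast_Suc_lessThan) auto
    also have "(\<Sum>k\<in>{Suc j..<n}. ?m (k - i) * ?m (k - j)) \<le> (\<Sum>k\<in>{Suc j..<n}. (- ?m (j - i)) * (- ?m (k - j)))"
    proof (rule sum_mono)
      fix k assume k: "k \<in> {Suc j..<n}"
      have "- ?m (k - i) \<le> - ?m (j - i)"
        using c k ij by (intro frac_coeff_decreasing) auto
      moreover have "0 \<le> - ?m (k - j)"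
        using frac_coeff_neg[OF c, of "k - j - 1"] k by (simp add: Suc_diff_Suc)
      ultimately show "?m (k - i) * ?m (k - j) \<le> (- ?m (j - i)) * (- ?m (k - j))"
        using mult_right_mono[of "- ?m (k - i)" "- ?m (j - i)" "- ?m (k - j)"] by simp
    qed
    also have "\<dots> = (- ?m (j - i)) * (\<Sum>k\<in>{Suc j..<n}. - ?m (k - j))"
      by (simp add: sum_distrib_left)
    finally have le: "precision c n i j \<le> ?m (j - i) + (- ?m (j - i)) * (\<Sum>k\<in>{Suc j..<n}. - ?m (k - j))"
      by simp
    have "(\<Sum>k\<in>{Suc j..<n}. ?m (k - j)) = (\<Sum>l\<in>{1..n - Suc j}. ?m l)"
      by (rule sum.reindex_bij_witness[of _ "\<lambda>l. l + j" "\<lambda>k. k - j"]) auto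
    moreover have "(\<Sum>l\<le>n - Suc j. ?m l) = ?m 0 + (\<Sum>l\<in>{1..n - Suc j}. ?m l)"
      by (simp add: atMost_atLeast0 sum.atLeast_Suc_atMost)
    \<comment> \<open>The partial sum includes the constant term 1 and equals a coefficient of (1 -
      z)^(c - 1), which is nonnegative; so the other terms add up to at least -1.\<close>
    moreover have "0 \<le> (\<Sum>l\<le>n - Suc j. ?m l)"
      using c by (simp add: sum_frac_coeff frac_coeff_nonneg)
    ultimately have "(\<Sum>k\<in>{Suc j..<n}. - ?m (k - j)) \<le> 1" by (simp add: sum_negf)
    moreover have "0 \<le> - ?m (j - i)"
      using frac_coeff_neg[OF c, of "j - i - 1"] ij by (simp add: Suc_diff_Suc)
    ultimately have "(- ?m (j - i)) * (\<Sum>k\<in>{Suc j..<n}. - ?m (k - j)) \<le> (- ?m (j - i)) * 1"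
      by (rule mult_left_mono)
    then show ?thesis using le by simp
  qed
  from this[of i j] this[of j i] show ?thesis using ij by (cases "i < j") (auto simp: precision_commute)
qed

text \<open>Both filters are causal: the value at k involves indices up to k only, so the power
  series identity inverts the truncated filter exactly.\<close>

lemma frac_coeff_inverse_filter:
  assumes "k < n"
  shows "(\<Sum>i<n. (if i \<le> k then frac_coeff (- c) (k - i) else 0) * (\<Sum>j\<le>i. frac_coeff c (i - j) * x j)) = x k"
proof -
  have "(\<Sum>i<n. (if i \<le> k then frac_coeff (- c) (k - i) else 0) * (\<Sum>j\<le>i. frac_coeff c (i - j) * x j))
    = (\<Sum>i\<le>k. frac_coeff (- c) (k - i) * (\<Sum>j\<le>i. frac_coeff c (i - j) * x j))"
    by (rule sum.mono_neutral_cong_right) (use assms in auto)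
  also have "\<dots> = fps_nth ((Abs_fps x * Abs_fps (frac_coeff c)) * Abs_fps (frac_coeff (- c))) k"
    unfolding fps_mult_nth fps_nth_Abs_fps atMost_atLeast0 by (intro sum.cong refl) (simp add: mult.commute)
  also have "\<dots> = x k"
    by (simp add: mult.assoc frac_coeff_convolution)
  finally show ?thesis .
qed

text \<open>The moving average is a unit triangular image of the Gaussian vector. Expressing the
  vector through the inverse filter turns its sum of squares into the quadratic form of
  \<open>precision\<close>, whose off-diagonal signs suit \<open>fkg_quadratic\<close>.\<close>

theorem (in prob_space) fractional_noise_correlation:
  fixes \<xi> :: "nat \<Rightarrow> 'a \<Rightarrow> real"
  assumes meas: "\<And>i. i < n \<Longrightarrow> \<xi> i \<in> borel_measurable M"
    and char: "\<And>\<theta>. (CLINT \<omega>|M. iexp (\<Sum>i<n. \<theta> i * \<xi> i \<omega>)) = complex_of_real (exp (- (\<Sum>i<n. (\<theta> i)\<^sup>2) / 2))"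
    and c: "0 < c" "c < 1"
    and E: "abs_decreasing n E" "abs_decreasing n F"
  defines "X \<equiv> \<lambda>\<omega>. \<lambda>k\<in>{..<n}. \<Sum>j\<le>k. frac_coeff c (k - j) * \<xi> j \<omega>"
  shows "prob {\<omega>\<in>space M. X \<omega> \<in> E} * prob {\<omega>\<in>space M. X \<omega> \<in> F} \<le> prob {\<omega>\<in>space M. X \<omega> \<in> E \<inter> F}"
proof -
  define P where "P = Pi\<^sub>M {..<n} (\<lambda>_. lborel :: real measure)"
  \<comment> \<open>The Gaussian exponent is minus half the precision form, so nonpositive
    off-diagonal precision entries become nonnegative couplings.\<close>
  define B where "B = (\<lambda>i j. - precision c n i j / 2)"
  define p where "p = (\<lambda>x. ennreal (exp (\<Sum>i<n. \<Sum>j<n. B i j * (x i * x j))))"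
  define T where "T = (\<lambda>x. \<lambda>k\<in>{..<n}. \<Sum>j\<le>k. frac_coeff c (k - j) * x j)"
  define C where "C = ennreal ((1 / sqrt (2 * pi)) ^ n)"
  let ?Y = "\<lambda>\<omega>. \<lambda>i\<in>{..<n}. \<xi> i \<omega>"
  have comp [measurable]: "(\<lambda>x. x i) \<in> borel_measurable P" if "i < n" for i
    unfolding P_def using that by simp
  have pm [measurable]: "p \<in> borel_measurable P" unfolding p_def by measurable
  have Ym: "?Y \<in> M \<rightarrow>\<^sub>M P" unfolding P_def
    by (rule measurable_restrict) (use meas in auto)
  have Tm [measurable]: "T \<in> P \<rightarrow>\<^sub>M P"
    unfolding T_def
  proof (subst (2) P_def, rule measurable_restrict)
    fix k assume "k \<in> {..<n}"
    then have [measurable]: "(\<lambda>x. x j) \<in> borel_measurable P" if "j \<in> {..k}" for j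
      using that comp by auto
    show "(\<lambda>x. \<Sum>j\<le>k. frac_coeff c (k - j) * x j) \<in> P \<rightarrow>\<^sub>M lborel" by simp
  qed
  have dens: "(\<Prod>i<n. ennreal (std_normal_density (x i))) = C * p (T x)" for x
  proof -
    have 1: "(\<Prod>i<n. ennreal (std_normal_density (x i))) = ennreal ((1 / sqrt (2 * pi)) ^ n * exp (- (\<Sum>i<n. (x i)\<^sup>2) / 2))"
    proof -
      have "(\<Prod>i<n. std_normal_density (x i)) = (\<Prod>i<n. 1 / sqrt (2 * pi) * exp (- (x i)\<^sup>2 / 2))"
        by (simp add: std_normal_density_def)
      also have "\<dots> = (1 / sqrt (2 * pi)) ^ n * exp (\<Sum>i<n. - (x i)\<^sup>2 / 2)"
        by (simp only: prod.distrib exp_sum finite_lessThan) simp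
      also have "(\<Sum>i<n. - (x i)\<^sup>2 / 2) = - (\<Sum>i<n. (x i)\<^sup>2) / 2"
        by (simp add: sum_negf sum_divide_distrib)
      finally show ?thesis by (simp add: prod_ennreal)
    qed
    have "(\<Sum>k<n. (x k)\<^sup>2) = (\<Sum>k<n. (\<Sum>i<n. (if i \<le> k then frac_coeff (- c) (k - i) else 0) * T x i)\<^sup>2)"
    proof (rule sum.cong[OF refl])
      fix k assume k: "k \<in> {..<n}"
      have "(\<Sum>i<n. (if i \<le> k then frac_coeff (- c) (k - i) else 0) * T x i) =
        (\<Sum>i<n. (if i \<le> k then frac_coeff (- c) (k - i) else 0) * (\<Sum>j\<le>i. frac_coeff c (i - j) * x j))"
        by (rule sum.cong) (auto simp: T_def)
      then show "(x k)\<^sup>2 = (\<Sum>i<n. (if i \<le> k then frac_coeff (- c) (k - i) else 0) * T x i)\<^sup>2"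
        using frac_coeff_inverse_filter[of k n c x] k by simp
    qed
    also have "\<dots> = (\<Sum>k<n. \<Sum>i<n. \<Sum>j<n. (if i \<le> k then frac_coeff (- c) (k - i) else 0) *
        (if j \<le> k then frac_coeff (- c) (k - j) else 0) * (T x i * T x j))"
      by (simp only: power2_eq_square sum_product) (simp only: ac_simps)
    also have "\<dots> = (\<Sum>i<n. \<Sum>j<n. precision c n i j * (T x i * T x j))"
      unfolding precision_def sum_distrib_right
      by (subst sum.swap, rule sum.cong[OF refl], rule sum.swap)
    finally have "(\<Sum>i<n. \<Sum>j<n. B i j * (T x i * T x j)) = - (\<Sum>k<n. (x k)\<^sup>2) / 2"
      by (simp add: B_def sum_negf sum_divide_distrib)
    then show ?thesis unfolding 1 p_def C_def by (simp add: ennreal_mult)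
  qed
  have law: "emeasure M {\<omega>\<in>space M. X \<omega> \<in> G} = C * (\<integral>\<^sup>+x. indicator G x * p x \<partial>P)"
    if G: "abs_decreasing n G" for G
  proof -
    have [measurable]: "G \<in> sets P" using G by (auto simp: abs_decreasing_def P_def)
    have TG [measurable]: "T -` G \<inter> space P \<in> sets P" by measurable
    have XT: "X \<omega> = T (?Y \<omega>)" for \<omega>
      unfolding X_def T_def by (intro restrict_ext sum.cong) auto
    have "{\<omega>\<in>space M. X \<omega> \<in> G} = ?Y -` (T -` G \<inter> space P) \<inter> space M"
      using measurable_space[OF Ym] by (auto simp: XT)
    then have "emeasure M {\<omega>\<in>space M. X \<omega> \<in> G} = emeasure (distr M P ?Y) (T -` G \<inter> space P)"
      by (simp only: emeasure_distr[OF Ym TG])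
    also have "distr M P ?Y = density P (\<lambda>x. C * p (T x))"
      using std_normal_vector_density[OF meas char] by (simp only: P_def[symmetric] dens)
    also have "emeasure \<dots> (T -` G \<inter> space P) = (\<integral>\<^sup>+x. C * p (T x) * indicator (T -` G \<inter> space P) x \<partial>P)"
      by (rule emeasure_density) measurable
    also have "\<dots> = (\<integral>\<^sup>+x. C * (indicator G (T x) * p (T x)) \<partial>P)"
      by (rule nn_integral_cong) (auto simp: indicator_def)
    also have "\<dots> = C * (\<integral>\<^sup>+x. indicator G (T x) * p (T x) \<partial>P)"
      by (rule nn_integral_cmult) measurable
    also have "(\<integral>\<^sup>+x. indicator G (T x) * p (T x) \<partial>P) = (\<integral>\<^sup>+x. indicator G x * p x \<partial>P)"
    proof -
      let ?b = "\<lambda>k x. \<Sum>j<k. frac_coeff c (k - j) * x j"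
      \<comment> \<open>The diagonal entries of T are \<open>frac_coeff c 0\<close> = 1.\<close>
      have "(\<lambda>k\<in>{..<n}. 1 * x k + ?b k (restrict x {..<k})) = T x" for x
        unfolding T_def by (intro restrict_ext) (simp add: lessThan_Suc_atMost[symmetric])
      moreover have "?b k \<in> borel_measurable (Pi\<^sub>M {..<k} (\<lambda>_. lborel))" for k
      proof -
        have [measurable]: "(\<lambda>x. x j) \<in> borel_measurable (Pi\<^sub>M {..<k} (\<lambda>_. lborel :: real measure))"
          if "j \<in> {..<k}" for j
          using measurable_component_singleton[OF that, of "\<lambda>_. lborel :: real measure"] by simp
        show ?thesis by measurable
      qed
      ultimately show ?thesis
        using nn_integral_PiM_lborel_triangular[of "\<lambda>x. indicator G x * p x" n "\<lambda>_. 1" ?b]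
        by (simp add: P_def[symmetric])
    qed
    finally show ?thesis .
  qed
  have univ: "abs_decreasing n (space P)" by (auto simp: abs_decreasing_def P_def)
  \<comment> \<open>The whole space is itself \<open>abs_decreasing\<close>, so \<open>law\<close>
    also yields the normalisation, which turns the homogeneous inequality into one between
    probabilities.\<close>
  have tot: "C * (\<integral>\<^sup>+x. p x \<partial>P) = 1"
  proof -
    have "{\<omega>\<in>space M. X \<omega> \<in> space P} = space M" by (auto simp: X_def P_def space_PiM)
    then show ?thesis using law[OF univ] by (simp add: emeasure_space_1 cong: nn_integral_cong)
  qed
  have "emeasure M {\<omega>\<in>space M. X \<omega> \<in> E} * emeasure M {\<omega>\<in>space M. X \<omega> \<in> F}
     = C * C * ((\<integral>\<^sup>+x. indicator E x * p x \<partial>P) * (\<integral>\<^sup>+x. indicator F x * p x \<partial>P))"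
    by (simp add: law E ac_simps)
  also have "\<dots> \<le> C * C * ((\<integral>\<^sup>+x. indicator (E \<inter> F) x * p x \<partial>P) * (\<integral>\<^sup>+x. p x \<partial>P))"
    unfolding p_def P_def using precision_offdiag[OF c]
    by (intro mult_left_mono fkg_quadratic E) (auto simp: B_def)
  also have "\<dots> = emeasure M {\<omega>\<in>space M. X \<omega> \<in> E \<inter> F} * (C * (\<integral>\<^sup>+x. p x \<partial>P))"
    by (simp only: law[OF abs_decreasing_Int[OF E]] ac_simps)
  finally show ?thesis by (simp add: tot emeasure_eq_measure flip: ennreal_mult)
qed

section \<open>Double Wiener integrals\<close>

lemma sq_int_integrable_mult:
  assumes "sq_int f" "sq_int g"
  shows "integrable lborel (\<lambda>x. f x * g x)"
proof (rule Bochner_Integration.integrable_bound)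
  show "integrable lborel (\<lambda>x. (f x)\<^sup>2 + (g x)\<^sup>2)"
    using assms by (auto simp: sq_int_def)
  have "\<bar>f x * g x\<bar> \<le> (f x)\<^sup>2 + (g x)\<^sup>2" for x
    using sum_squares_bound[of "\<bar>f x\<bar>" "\<bar>g x\<bar>"] abs_ge_zero[of "f x * g x"] unfolding abs_mult power2_abs by linarith
  then show "AE x in lborel. norm (f x * g x) \<le> norm ((f x)\<^sup>2 + (g x)\<^sup>2)" by (simp add: abs_mult)
qed (use assms in \<open>auto simp: sq_int_def\<close>)

lemma sq_int_sum:
  assumes "finite I" "\<And>i. i \<in> I \<Longrightarrow> sq_int (e i)"
  shows "sq_int (\<lambda>x. \<Sum>i\<in>I. \<theta> i * e i x)"
    and "(LINT x|lborel. (\<Sum>i\<in>I. \<theta> i * e i x)\<^sup>2) = (\<Sum>i\<in>I. \<Sum>j\<in>I. \<theta> i * \<theta> j * (LINT x|lborel. e i x * e j x))"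
proof -
  have [measurable]: "e i \<in> borel_measurable lborel" if "i \<in> I" for i
    using assms(2)[OF that] by (simp add: sq_int_def)
  have eq: "(\<Sum>i\<in>I. \<theta> i * e i x)\<^sup>2 = (\<Sum>i\<in>I. \<Sum>j\<in>I. \<theta> i * \<theta> j * (e i x * e j x))" for x
    by (simp only: power2_eq_square sum_product) (simp only: ac_simps)
  have int: "integrable lborel (\<lambda>x. \<theta> i * \<theta> j * (e i x * e j x))" if "i \<in> I" "j \<in> I" for i j
    using sq_int_integrable_mult[OF assms(2)[OF that(1)] assms(2)[OF that(2)]] by simp
  have "(\<lambda>x. \<Sum>i\<in>I. \<theta> i * e i x) \<in> borel_measurable lborel"
    by measurable
  moreover have "integrable lborel (\<lambda>x. (\<Sum>i\<in>I. \<theta> i * e i x)\<^sup>2)"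
    unfolding eq using int by (intro Bochner_Integration.integrable_sum) auto
  ultimately show "sq_int (\<lambda>x. \<Sum>i\<in>I. \<theta> i * e i x)"
    unfolding sq_int_def by blast
  show "(LINT x|lborel. (\<Sum>i\<in>I. \<theta> i * e i x)\<^sup>2) = (\<Sum>i\<in>I. \<Sum>j\<in>I. \<theta> i * \<theta> j * (LINT x|lborel. e i x * e j x))"
    unfolding eq using int
    by (simp add: Bochner_Integration.integral_sum Bochner_Integration.integrable_sum)
qed

text \<open>Summing over eight sign choices, weighted by the product of the signs, leaves only the
  monomial a b c d, with coefficient 8 * 4! = 192.\<close>

lemma polarization4:
  fixes a b c d :: real
  shows "192 * (a * b * c * d) = (a+b+c+d)^4 - (a+b+c-d)^4 - (a+b-c+d)^4 - (a-b+c+d)^4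
    + (a+b-c-d)^4 + (a-b+c-d)^4 + (a-b-c+d)^4 - (a-b-c-d)^4"
  by algebra

section \<open>Moments of the Wiener integral\<close>

locale isonormal_process =
  fixes M :: "'a measure" and W :: "(real \<Rightarrow> real) \<Rightarrow> 'a \<Rightarrow> real"
  assumes isonormal: "isonormal M W"
begin

sublocale prob_space M using isonormal by (simp add: isonormal_def)

lemma W_measurable: "sq_int f \<Longrightarrow> W f \<in> borel_measurable M"
  using isonormal by (simp add: isonormal_def)

text \<open>A rescaled standard normal variable, unlike a normal density, also covers the case f = 0
  almost everywhere, where the law is a point mass.\<close>

lemma W_distr:
  assumes "sq_int f"
  shows "distr M borel (W f) = distr std_normal borel (\<lambda>x. sqrt (LINT x|lborel. (f x)\<^sup>2) * x)"
proof (rule Levy_uniqueness)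
  interpret N: prob_space std_normal by (rule prob_space_std_normal)
  let ?s = "sqrt (LINT x|lborel. (f x)\<^sup>2)"
  show "real_distribution (distr M borel (W f))"
    by (rule real_distribution_distr) (use assms W_measurable in simp)
  show "real_distribution (distr std_normal borel (\<lambda>x. ?s * x))"
    by (rule N.real_distribution_distr) simp
  have nn: "0 \<le> (LINT x|lborel. (f x)\<^sup>2)" by (rule integral_nonneg_AE) auto
  show "char (distr M borel (W f)) = char (distr std_normal borel (\<lambda>x. ?s * x))"
  proof
    fix t
    have "char (distr std_normal borel (\<lambda>x. ?s * x)) t = char std_normal (t * ?s)"
      by (simp add: char_def integral_distr ac_simps)
    also have "\<dots> = char (distr M borel (W f)) t"
      using isonormal assms nn
      by (simp add: isonormal_def char_std_normal_distribution power_mult_distrib ac_simps)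
    finally show "char (distr M borel (W f)) t = char (distr std_normal borel (\<lambda>x. ?s * x)) t" ..
  qed
qed

lemma W_moments:
  assumes "sq_int f"
  shows "integrable M (\<lambda>\<omega>. W f \<omega> ^ k)"
    and "expectation (\<lambda>\<omega>. W f \<omega> ^ 2) = (LINT x|lborel. (f x)\<^sup>2)"
    and "expectation (\<lambda>\<omega>. W f \<omega> ^ 4) = 3 * (LINT x|lborel. (f x)\<^sup>2)\<^sup>2"
proof -
  let ?s = "sqrt (LINT x|lborel. (f x)\<^sup>2)"
  have nn: "0 \<le> (LINT x|lborel. (f x)\<^sup>2)" by (rule integral_nonneg_AE) auto
  note [measurable] = W_measurable[OF assms]
  have "integrable (distr M borel (W f)) (\<lambda>x. x ^ k)"
    unfolding W_distr[OF assms]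
    by (subst integrable_distr_eq) (auto simp: power_mult_distrib intro!: integrable_std_normal_distribution_moment)
  then show "integrable M (\<lambda>\<omega>. W f \<omega> ^ k)"
    by (subst (asm) integrable_distr_eq) auto
  have mom: "expectation (\<lambda>\<omega>. W f \<omega> ^ k) = ?s ^ k * (LINT x|std_normal. x ^ k)" for k
  proof -
    have "expectation (\<lambda>\<omega>. W f \<omega> ^ k) = (LINT x|distr M borel (W f). x ^ k)"
      by (subst integral_distr) auto
    also have "\<dots> = ?s ^ k * (LINT x|std_normal. x ^ k)"
      unfolding W_distr[OF assms] by (subst integral_distr) (auto simp: power_mult_distrib)
    finally show ?thesis .
  qed
  show "expectation (\<lambda>\<omega>. W f \<omega> ^ 2) = (LINT x|lborel. (f x)\<^sup>2)"
    unfolding mom using std_normal_distribution_even_moments(1)[of 1] nn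
    by simp
  have "?s ^ 4 = (LINT x|lborel. (f x)\<^sup>2)\<^sup>2"
    using nn by (simp add: power4_eq_xxxx power2_eq_square)
  then show "expectation (\<lambda>\<omega>. W f \<omega> ^ 4) = 3 * (LINT x|lborel. (f x)\<^sup>2)\<^sup>2"
    unfolding mom using std_normal_distribution_even_moments(1)[of 2]
    by (simp add: fact_numeral)
qed

lemma W_sum:
  assumes "finite I" "\<And>i. i \<in> I \<Longrightarrow> sq_int (e i)"
  shows "AE \<omega> in M. W (\<lambda>x. \<Sum>i\<in>I. \<theta> i * e i x) \<omega> = (\<Sum>i\<in>I. \<theta> i * W (e i) \<omega>)"
  using assms
proof (induction I rule: finite_induct)
  case empty
  have "sq_int (\<lambda>_. 0)" by (simp add: sq_int_def)
  \<comment> \<open>Linearity with both coefficients 0 shows that W of the zero function vanishes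
    almost surely.\<close>
  then have "AE \<omega> in M. W (\<lambda>x. 0 * 0 + 0 * 0) \<omega> = 0 * W (\<lambda>_. 0) \<omega> + 0 * W (\<lambda>_. 0) \<omega>"
    using isonormal unfolding isonormal_def by blast
  then show ?case by simp
next
  case (insert i I)
  have "AE \<omega> in M. W (\<lambda>x. \<theta> i * e i x + 1 * (\<Sum>i\<in>I. \<theta> i * e i x)) \<omega> =
      \<theta> i * W (e i) \<omega> + 1 * W (\<lambda>x. \<Sum>i\<in>I. \<theta> i * e i x) \<omega>"
    using isonormal insert.prems sq_int_sum(1)[OF insert.hyps(1), of e \<theta>] unfolding isonormal_def by blast
  moreover have "AE \<omega> in M. W (\<lambda>x. \<Sum>i\<in>I. \<theta> i * e i x) \<omega> = (\<Sum>i\<in>I. \<theta> i * W (e i) \<omega>)"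
    using insert by auto
  ultimately show ?case
    by eventually_elim (use insert.hyps in simp)
qed

lemma W_sum_moments:
  fixes \<theta> :: "'i \<Rightarrow> real"
  assumes I: "finite I" "\<And>i. i \<in> I \<Longrightarrow> sq_int (e i)"
  defines "V \<equiv> (\<Sum>i\<in>I. \<Sum>j\<in>I. \<theta> i * \<theta> j * (LINT x|lborel. e i x * e j x))"
  shows "integrable M (\<lambda>\<omega>. (\<Sum>i\<in>I. \<theta> i * W (e i) \<omega>) ^ k)"
    and "expectation (\<lambda>\<omega>. (\<Sum>i\<in>I. \<theta> i * W (e i) \<omega>) ^ 2) = V"
    and "expectation (\<lambda>\<omega>. (\<Sum>i\<in>I. \<theta> i * W (e i) \<omega>) ^ 4) = 3 * V\<^sup>2"
proof -
  have sq: "sq_int (\<lambda>x. \<Sum>i\<in>I. \<theta> i * e i x)" "(LINT x|lborel. (\<Sum>i\<in>I. \<theta> i * e i x)\<^sup>2) = V"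
    unfolding V_def by (rule sq_int_sum; use I in simp)+
  have "AE \<omega> in M. W (\<lambda>x. \<Sum>i\<in>I. \<theta> i * e i x) \<omega> = (\<Sum>i\<in>I. \<theta> i * W (e i) \<omega>)"
    by (rule W_sum) (use I in auto)
  then have ae: "AE \<omega> in M. W (\<lambda>x. \<Sum>i\<in>I. \<theta> i * e i x) \<omega> ^ k = (\<Sum>i\<in>I. \<theta> i * W (e i) \<omega>) ^ k" for k
    by eventually_elim simp
  have [measurable]: "W (e i) \<in> borel_measurable M" if "i \<in> I" for i
    using I(2)[OF that] by (rule W_measurable)
  note [measurable] = W_measurable[OF sq(1)]
  have "(\<lambda>\<omega>. (\<Sum>i\<in>I. \<theta> i * W (e i) \<omega>) ^ k) \<in> borel_measurable M" for k by measurable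
  note eq = integral_cong_AE[OF _ this ae] integrable_cong_AE[OF _ this ae]
  show "integrable M (\<lambda>\<omega>. (\<Sum>i\<in>I. \<theta> i * W (e i) \<omega>) ^ k)"
    using W_moments(1)[OF sq(1), of k] by (subst (asm) eq(2)) measurable
  show "expectation (\<lambda>\<omega>. (\<Sum>i\<in>I. \<theta> i * W (e i) \<omega>) ^ 2) = V"
    using W_moments(2)[OF sq(1)] unfolding sq(2) by (subst (asm) eq(1)) measurable
  show "expectation (\<lambda>\<omega>. (\<Sum>i\<in>I. \<theta> i * W (e i) \<omega>) ^ 4) = 3 * V\<^sup>2"
    using W_moments(3)[OF sq(1)] unfolding sq(2) by (subst (asm) eq(1)) measurable
qed

lemma W_product:
  assumes "sq_int f" "sq_int g"
  shows "integrable M (\<lambda>\<omega>. W f \<omega> * W g \<omega>)"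
    and "expectation (\<lambda>\<omega>. W f \<omega> * W g \<omega>) = (LINT x|lborel. f x * g x)"
proof -
  let ?e = "\<lambda>b. if b then f else g"
  have sq: "sq_int (?e b)" for b using assms by simp
  have *: "integrable M (\<lambda>\<omega>. (W f \<omega> + s * W g \<omega>) ^ 2)"
    "expectation (\<lambda>\<omega>. (W f \<omega> + s * W g \<omega>) ^ 2) =
       (LINT x|lborel. f x * f x) + 2 * s * (LINT x|lborel. f x * g x) + s * s * (LINT x|lborel. g x * g x)" for s
    using W_sum_moments(1,2)[of UNIV ?e, OF _ sq, of "\<lambda>b. if b then 1 else s"]
    by (simp_all add: UNIV_bool ac_simps)
  have eq: "W f \<omega> * W g \<omega> = ((W f \<omega> + 1 * W g \<omega>) ^ 2 - (W f \<omega> + (-1) * W g \<omega>) ^ 2) / 4" for \<omega>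
    by (simp add: power2_eq_square algebra_simps)
  show "integrable M (\<lambda>\<omega>. W f \<omega> * W g \<omega>)"
    unfolding eq by (intro integrable_divide Bochner_Integration.integrable_diff *)
  show "expectation (\<lambda>\<omega>. W f \<omega> * W g \<omega>) = (LINT x|lborel. f x * g x)"
    unfolding eq integral_divide_zero Bochner_Integration.integral_diff[OF *(1) *(1)] *(2) by simp
qed

text \<open>The Wick formula for four jointly Gaussian variables. Every linear combination is almost
  surely a Wiener integral, with fourth moment three times its squared variance, so
  \<open>polarization4\<close> yields the mixed moment.\<close>

lemma W_product4:
  assumes "sq_int f1" "sq_int f2" "sq_int f3" "sq_int f4"
  defines "r \<equiv> \<lambda>f g. LINT x|lborel. f x * g x :: real"
  shows "integrable M (\<lambda>\<omega>. W f1 \<omega> * W f2 \<omega> * W f3 \<omega> * W f4 \<omega>)"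
    and "expectation (\<lambda>\<omega>. W f1 \<omega> * W f2 \<omega> * W f3 \<omega> * W f4 \<omega>) = r f1 f2 * r f3 f4 + r f1 f3 * r f2 f4 + r f1 f4 * r f2 f3"
proof -
  \<comment> \<open>Pairs of booleans serve as an index set with four elements.\<close>
  let ?e = "\<lambda>p. if fst p then if snd p then f1 else f2 else if snd p then f3 else f4"
  let ?t = "\<lambda>s2 s3 s4 p. if fst p then if snd p then 1 else s2 else if snd p then s3 else s4"
  have sq: "sq_int (?e p)" for p using assms by simp
  have U: "(UNIV :: (bool \<times> bool) set) = {(True, True), (True, False), (False, True), (False, False)}"
    by auto
  let ?V = "\<lambda>s2 s3 s4. r f1 f1 + s2 * s2 * r f2 f2 + s3 * s3 * r f3 f3 + s4 * s4 * r f4 f4 + 2 * (s2 * r f1 f2 + s3 * r f1 f3 + s4 * r f1 f4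
     + s2 * s3 * r f2 f3 + s2 * s4 * r f2 f4 + s3 * s4 * r f3 f4)"
  have *: "integrable M (\<lambda>\<omega>. (W f1 \<omega> + s2 * W f2 \<omega> + s3 * W f3 \<omega> + s4 * W f4 \<omega>) ^ 4)"
    "expectation (\<lambda>\<omega>. (W f1 \<omega> + s2 * W f2 \<omega> + s3 * W f3 \<omega> + s4 * W f4 \<omega>) ^ 4) = 3 * (?V s2 s3 s4)\<^sup>2" for s2 s3 s4
  proof -
    have "(\<Sum>p\<in>UNIV. ?t s2 s3 s4 p * W (?e p) \<omega>) = W f1 \<omega> + s2 * W f2 \<omega> + s3 * W f3 \<omega> + s4 * W f4 \<omega>" for \<omega>
      by (simp add: U)
    moreover have "(\<Sum>p\<in>UNIV. \<Sum>q\<in>UNIV. ?t s2 s3 s4 p * ?t s2 s3 s4 q * (LINT x|lborel. ?e p x * ?e q x)) = ?V s2 s3 s4"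
      by (simp add: U r_def algebra_simps)
    ultimately show "integrable M (\<lambda>\<omega>. (W f1 \<omega> + s2 * W f2 \<omega> + s3 * W f3 \<omega> + s4 * W f4 \<omega>) ^ 4)"
      "expectation (\<lambda>\<omega>. (W f1 \<omega> + s2 * W f2 \<omega> + s3 * W f3 \<omega> + s4 * W f4 \<omega>) ^ 4) = 3 * (?V s2 s3 s4)\<^sup>2"
      using W_sum_moments(1,3)[of UNIV ?e "?t s2 s3 s4", OF _ sq] by (simp_all only: finite)
  qed
  let ?X = "\<lambda>s2 s3 s4 \<omega>. (W f1 \<omega> + s2 * W f2 \<omega> + s3 * W f3 \<omega> + s4 * W f4 \<omega>) ^ 4"
  have eq: "W f1 \<omega> * W f2 \<omega> * W f3 \<omega> * W f4 \<omega> = (?X 1 1 1 \<omega> - ?X 1 1 (-1) \<omega> - ?X 1 (-1) 1 \<omega> - ?X (-1) 1 1 \<omega>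
    + ?X 1 (-1) (-1) \<omega> + ?X (-1) 1 (-1) \<omega> + ?X (-1) (-1) 1 \<omega> - ?X (-1) (-1) (-1) \<omega>) / 192" for \<omega>
    using polarization4[of "W f1 \<omega>" "W f2 \<omega>" "W f3 \<omega>" "W f4 \<omega>"] by simp
  show "integrable M (\<lambda>\<omega>. W f1 \<omega> * W f2 \<omega> * W f3 \<omega> * W f4 \<omega>)"
    unfolding eq by (intro integrable_divide Bochner_Integration.integrable_diff Bochner_Integration.integrable_add *)
  have "expectation (\<lambda>\<omega>. W f1 \<omega> * W f2 \<omega> * W f3 \<omega> * W f4 \<omega>) =
   (3 * (?V 1 1 1)\<^sup>2 - 3 * (?V 1 1 (-1))\<^sup>2 - 3 * (?V 1 (-1) 1)\<^sup>2 - 3 * (?V (-1) 1 1)\<^sup>2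
    + 3 * (?V 1 (-1) (-1))\<^sup>2 + 3 * (?V (-1) 1 (-1))\<^sup>2 + 3 * (?V (-1) (-1) 1)\<^sup>2 - 3 * (?V (-1) (-1) (-1))\<^sup>2) / 192"
    unfolding eq integral_divide_zero
    by (simp only: Bochner_Integration.integral_diff Bochner_Integration.integral_add
        Bochner_Integration.integrable_diff Bochner_Integration.integrable_add *)
  also have "\<dots> = r f1 f2 * r f3 f4 + r f1 f3 * r f2 f4 + r f1 f4 * r f2 f3"
    by (simp add: power2_eq_square) algebra
  finally show "expectation (\<lambda>\<omega>. W f1 \<omega> * W f2 \<omega> * W f3 \<omega> * W f4 \<omega>) = r f1 f2 * r f3 f4 + r f1 f3 * r f2 f4 + r f1 f4 * r f2 f3" .
qed

end

section \<open>The mean square bound for double integrals\<close>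

lemma lborel_pair_product:
  fixes a b :: "real \<Rightarrow> real"
  assumes a: "integrable lborel a" and b: "integrable lborel b"
  shows "integrable (lborel \<Otimes>\<^sub>M lborel) (\<lambda>z. a (fst z) * b (snd z))"
    and "(LINT z|(lborel \<Otimes>\<^sub>M lborel). a (fst z) * b (snd z)) = (LINT x|lborel. a x) * (LINT y|lborel. b y)"
proof -
  have [measurable]: "a \<in> borel_measurable borel" "b \<in> borel_measurable borel" using a b by auto
  show int: "integrable (lborel \<Otimes>\<^sub>M lborel) (\<lambda>z. a (fst z) * b (snd z))"
    by (rule lborel_pair.Fubini_integrable) (use a b in \<open>auto simp: abs_mult\<close>)
  show "(LINT z|(lborel \<Otimes>\<^sub>M lborel). a (fst z) * b (snd z)) = (LINT x|lborel. a x) * (LINT y|lborel. b y)"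
    using lborel_pair.integral_fst'[OF int] by simp
qed

lemma integral_sum_mult_sum:
  fixes a b :: "'p \<Rightarrow> 'z \<Rightarrow> real"
  assumes "\<forall>p\<in>P. \<forall>q\<in>P. integrable N (\<lambda>x. a p x * b q x) \<and> (LINT x|N. a p x * b q x) = G p q"
  shows "integrable N (\<lambda>x. (\<Sum>p\<in>P. C p * a p x) * (\<Sum>p\<in>P. C p * b p x))"
     "(LINT x|N. (\<Sum>p\<in>P. C p * a p x) * (\<Sum>p\<in>P. C p * b p x)) = (\<Sum>p\<in>P. \<Sum>q\<in>P. C p * C q * G p q)"
proof -
  have square: "(\<Sum>p\<in>P. C p * a p) * (\<Sum>p\<in>P. C p * b p) = (\<Sum>p\<in>P. \<Sum>q\<in>P. C p * C q * (a p * b q))" for a b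
    by (simp only: sum_product) (simp only: ac_simps)
  show "integrable N (\<lambda>x. (\<Sum>p\<in>P. C p * a p x) * (\<Sum>p\<in>P. C p * b p x))"
     "(LINT x|N. (\<Sum>p\<in>P. C p * a p x) * (\<Sum>p\<in>P. C p * b p x)) = (\<Sum>p\<in>P. \<Sum>q\<in>P. C p * C q * G p q)"
    unfolding square using assms by (simp_all add: Bochner_Integration.integral_sum Bochner_Integration.integrable_sum)
qed

text \<open>The index set is arbitrary so that the difference of two elementary kernels is again of
  this form, over the disjoint sum.\<close>

definition rank_kernel :: "'i set \<Rightarrow> ('i \<Rightarrow> 'i \<Rightarrow> real) \<Rightarrow> ('i \<Rightarrow> real \<Rightarrow> real) \<Rightarrow> real \<times> real \<Rightarrow> real" where
  "rank_kernel I c e z = (\<Sum>i\<in>I. \<Sum>j\<in>I. c i j * e i (fst z) * e j (snd z))"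

context isonormal_process
begin

definition rank_I2 :: "'i set \<Rightarrow> ('i \<Rightarrow> 'i \<Rightarrow> real) \<Rightarrow> ('i \<Rightarrow> real \<Rightarrow> real) \<Rightarrow> 'a \<Rightarrow> real" where
  "rank_I2 I c e \<omega> = (\<Sum>i\<in>I. \<Sum>j\<in>I. c i j * (W (e i) \<omega> * W (e j) \<omega> - integral\<^sup>L lborel (\<lambda>x. e i x * e j x)))"

text \<open>With K' for the kernel K with its arguments exchanged, the second moment is <K, K> + <K,
  K'>, and <K, K'> is at most <K, K>. The kernels are not symmetrised, hence an inequality with
  factor 2.\<close>

lemma rank_I2_isometry:
  fixes e :: "'i \<Rightarrow> real \<Rightarrow> real"
  assumes I: "finite I" and sq: "\<And>i. i \<in> I \<Longrightarrow> sq_int (e i)"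
  shows "(\<integral>\<^sup>+\<omega>. ennreal ((rank_I2 I c e \<omega>)\<^sup>2) \<partial>M) \<le>
    2 * (\<integral>\<^sup>+z. ennreal ((rank_kernel I c e z)\<^sup>2) \<partial>(lborel \<Otimes>\<^sub>M lborel))"
proof -
  define r where "r = (\<lambda>i j. LINT x|lborel. e i x * e j x)"
  define \<psi> where "\<psi> = (\<lambda>p \<omega>. W (e (fst p)) \<omega> * W (e (snd p)) \<omega> - r (fst p) (snd p))"
  define \<phi> where "\<phi> = (\<lambda>p z. e (fst p) (fst z) * e (snd p) (snd z))"
  define C where "C = (\<lambda>p. c (fst p) (snd p))"
  let ?P = "I \<times> I" and ?L = "lborel \<Otimes>\<^sub>M lborel :: (real \<times> real) measure"
  let ?q = "\<lambda>p. (snd p, fst p)"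
  have rc: "r i j = r j i" for i j by (simp add: r_def mult.commute)
  have J: "rank_I2 I c e \<omega> = (\<Sum>p\<in>?P. C p * \<psi> p \<omega>)" for \<omega>
    by (simp add: rank_I2_def sum.cartesian_product \<psi>_def C_def r_def case_prod_beta)
  have K: "rank_kernel I c e z = (\<Sum>p\<in>?P. C p * \<phi> p z)" for z
    by (simp add: rank_kernel_def sum.cartesian_product \<phi>_def C_def case_prod_beta mult.assoc)
  have \<psi>: "integrable M (\<lambda>\<omega>. \<psi> p \<omega> * \<psi> q \<omega>) \<and>
     expectation (\<lambda>\<omega>. \<psi> p \<omega> * \<psi> q \<omega>) = r (fst p) (fst q) * r (snd p) (snd q) + r (fst p) (snd q) * r (snd p) (fst q)"
    if "p \<in> ?P" "q \<in> ?P" for p q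
  proof -
    obtain i j k l where p: "p = (i, j)" and q: "q = (k, l)" by (cases p, cases q) auto
    have s: "sq_int (e i)" "sq_int (e j)" "sq_int (e k)" "sq_int (e l)" using that sq p q by auto
    have eq: "\<psi> p \<omega> * \<psi> q \<omega> = W (e i) \<omega> * W (e j) \<omega> * W (e k) \<omega> * W (e l) \<omega> - r k l * (W (e i) \<omega> * W (e j) \<omega>)
        - r i j * (W (e k) \<omega> * W (e l) \<omega>) + r i j * r k l" for \<omega>
      by (simp add: \<psi>_def p q algebra_simps)
    note 4 = W_product4[OF s] and 2 = W_product[OF s(1,2)] W_product[OF s(3,4)]
    have "integrable M (\<lambda>\<omega>. \<psi> p \<omega> * \<psi> q \<omega>)"
      unfolding eq using 4 2 by simp
    \<comment> \<open>Centring cancels the pairing inside each product and leaves the two pairings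
      across.\<close>
    moreover have "expectation (\<lambda>\<omega>. \<psi> p \<omega> * \<psi> q \<omega>) = r i k * r j l + r i l * r j k"
      unfolding eq using 4 2 by (simp add: r_def prob_space)
    ultimately show ?thesis by (simp add: p q)
  qed
  have \<phi>: "integrable ?L (\<lambda>z. \<phi> p z * \<phi> q z) \<and> (LINT z|?L. \<phi> p z * \<phi> q z) = r (fst p) (fst q) * r (snd p) (snd q)"
    if "p \<in> ?P" "q \<in> ?P" for p q
  proof -
    have eq: "\<phi> p z * \<phi> q z = (e (fst p) (fst z) * e (fst q) (fst z)) * (e (snd p) (snd z) * e (snd q) (snd z))" for z
      by (simp add: \<phi>_def)
    show ?thesis unfolding eq r_def
      using that by (intro conjI lborel_pair_product sq_int_integrable_mult sq) auto
  qed
  have swap: "?q p \<in> ?P" if "p \<in> ?P" for p using that by auto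
  let ?K = "\<lambda>z. \<Sum>p\<in>?P. C p * \<phi> p z" and ?K' = "\<lambda>z. \<Sum>p\<in>?P. C p * \<phi> (?q p) z" and ?J = "\<lambda>\<omega>. \<Sum>p\<in>?P. C p * \<psi> p \<omega>"
  let ?G1 = "\<lambda>p q. r (fst p) (fst q) * r (snd p) (snd q)" and ?G2 = "\<lambda>p q. r (fst p) (snd q) * r (snd p) (fst q)"
  have \<phi>2: "integrable ?L (\<lambda>z. \<phi> p z * \<phi> (?q q) z) \<and> (LINT z|?L. \<phi> p z * \<phi> (?q q) z) = ?G2 p q"
    if "p \<in> ?P" "q \<in> ?P" for p q
    using \<phi>[OF that(1) swap[OF that(2)]] by simp
  have \<phi>3: "integrable ?L (\<lambda>z. \<phi> (?q p) z * \<phi> (?q q) z) \<and> (LINT z|?L. \<phi> (?q p) z * \<phi> (?q q) z) = ?G1 p q"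
    if "p \<in> ?P" "q \<in> ?P" for p q
    using \<phi>[OF swap[OF that(1)] swap[OF that(2)]] by (simp add: mult.commute)
  have JJ: "integrable M (\<lambda>z. ?J z * ?J z)"
    "(LINT z|M. ?J z * ?J z) = (\<Sum>p\<in>?P. \<Sum>q\<in>?P. C p * C q * (r (fst p) (fst q) * r (snd p) (snd q) + r (fst p) (snd q) * r (snd p) (fst q)))"
    by (rule integral_sum_mult_sum[where P = ?P and C = C and a = "\<psi>" and b = "\<psi>" and G = "\<lambda>p q. r (fst p) (fst q) * r (snd p) (snd q) + r (fst p) (snd q) * r (snd p) (fst q)"];
        intro ballI \<psi>; assumption)+
  have KK: "integrable ?L (\<lambda>z. ?K z * ?K z)"
    "(LINT z|?L. ?K z * ?K z) = (\<Sum>p\<in>?P. \<Sum>q\<in>?P. C p * C q * (r (fst p) (fst q) * r (snd p) (snd q)))"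
    by (rule integral_sum_mult_sum[where P = ?P and C = C and a = "\<phi>" and b = "\<phi>" and G = "\<lambda>p q. r (fst p) (fst q) * r (snd p) (snd q)"];
        intro ballI \<phi>; assumption)+
  have KK': "integrable ?L (\<lambda>z. ?K z * ?K' z)"
    "(LINT z|?L. ?K z * ?K' z) = (\<Sum>p\<in>?P. \<Sum>q\<in>?P. C p * C q * (r (fst p) (snd q) * r (snd p) (fst q)))"
    by (rule integral_sum_mult_sum[where P = ?P and C = C and a = "\<phi>" and b = "\<lambda>p. \<phi> (?q p)" and G = "\<lambda>p q. r (fst p) (snd q) * r (snd p) (fst q)"];
        intro ballI \<phi>2; assumption)+
  have K'K': "integrable ?L (\<lambda>z. ?K' z * ?K' z)"
    "(LINT z|?L. ?K' z * ?K' z) = (\<Sum>p\<in>?P. \<Sum>q\<in>?P. C p * C q * (r (fst p) (fst q) * r (snd p) (snd q)))"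
    by (rule integral_sum_mult_sum[where P = ?P and C = C and a = "\<lambda>p. \<phi> (?q p)" and b = "\<lambda>p. \<phi> (?q p)" and G = "\<lambda>p q. r (fst p) (fst q) * r (snd p) (snd q)"];
        intro ballI \<phi>3; assumption)+
  have "expectation (\<lambda>\<omega>. ?J \<omega> * ?J \<omega>) = (LINT z|?L. ?K z * ?K z) + (LINT z|?L. ?K z * ?K' z)"
    unfolding JJ(2) KK(2) KK'(2) by (simp add: sum.distrib[symmetric] distrib_left)
  \<comment> \<open>The two squares have the same integral, since exchanging the arguments leaves
    the Gram entries unchanged.\<close>
  also have "(LINT z|?L. ?K z * ?K' z) \<le> (LINT z|?L. (?K z * ?K z + ?K' z * ?K' z) / 2)"
  proof (rule integral_mono)
    show "?K z * ?K' z \<le> (?K z * ?K z + ?K' z * ?K' z) / 2" for z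
      using sum_squares_bound[of "?K z" "?K' z"] by (simp add: power2_eq_square)
  qed (use KK(1) KK'(1) K'K'(1) in auto)
  also have "\<dots> = (LINT z|?L. ?K z * ?K z)"
    using KK(1) K'K'(1) by (simp add: KK(2) K'K'(2))
  finally have le: "expectation (\<lambda>\<omega>. ?J \<omega> * ?J \<omega>) \<le> 2 * (LINT z|?L. ?K z * ?K z)" by simp
  have "(\<integral>\<^sup>+\<omega>. ennreal ((rank_I2 I c e \<omega>)\<^sup>2) \<partial>M) = ennreal (expectation (\<lambda>\<omega>. ?J \<omega> * ?J \<omega>))"
    unfolding J power2_eq_square by (rule nn_integral_eq_integral[OF JJ(1)]) auto
  also have "\<dots> \<le> ennreal (2 * (LINT z|?L. ?K z * ?K z))" by (rule ennreal_leI[OF le])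
  also have "\<dots> = 2 * ennreal (LINT z|?L. ?K z * ?K z)" by (simp add: ennreal_mult')
  also have "ennreal (LINT z|?L. ?K z * ?K z) = (\<integral>\<^sup>+z. ennreal ((rank_kernel I c e z)\<^sup>2) \<partial>?L)"
    unfolding K power2_eq_square by (rule nn_integral_eq_integral[OF KK(1), symmetric]) auto
  finally show ?thesis .
qed

lemma nn_integral_square_triangle:
  fixes f g h :: "'b \<Rightarrow> real"
  assumes [measurable]: "f \<in> borel_measurable N" "g \<in> borel_measurable N" "h \<in> borel_measurable N"
  shows "(\<integral>\<^sup>+x. ennreal ((f x - h x)\<^sup>2) \<partial>N) \<le> 2 * (\<integral>\<^sup>+x. ennreal ((f x - g x)\<^sup>2) \<partial>N) + 2 * (\<integral>\<^sup>+x. ennreal ((g x - h x)\<^sup>2) \<partial>N)"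
proof -
  have le: "(f x - h x)\<^sup>2 \<le> 2 * (f x - g x)\<^sup>2 + 2 * (g x - h x)\<^sup>2" for x
    using sum_squares_bound[of "f x - g x" "g x - h x"] by (simp add: power2_eq_square algebra_simps)
  have "(\<integral>\<^sup>+x. ennreal ((f x - h x)\<^sup>2) \<partial>N) \<le> (\<integral>\<^sup>+x. 2 * ennreal ((f x - g x)\<^sup>2) + 2 * ennreal ((g x - h x)\<^sup>2) \<partial>N)"
  proof (rule nn_integral_mono)
    fix x
    have "ennreal ((f x - h x)\<^sup>2) \<le> ennreal (2 * (f x - g x)\<^sup>2 + 2 * (g x - h x)\<^sup>2)"
      by (rule ennreal_leI[OF le])
    then show "ennreal ((f x - h x)\<^sup>2) \<le> 2 * ennreal ((f x - g x)\<^sup>2) + 2 * ennreal ((g x - h x)\<^sup>2)"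
      by (simp add: ennreal_mult')
  qed
  also have "\<dots> = 2 * (\<integral>\<^sup>+x. ennreal ((f x - g x)\<^sup>2) \<partial>N) + 2 * (\<integral>\<^sup>+x. ennreal ((g x - h x)\<^sup>2) \<partial>N)"
    by (simp add: nn_integral_add nn_integral_cmult)
  finally show ?thesis .
qed

lemma elem_kernel_measurable:
  assumes "\<And>i. i < N \<Longrightarrow> sq_int (e i)"
  shows "elem_kernel N c e \<in> borel_measurable (lborel \<Otimes>\<^sub>M lborel)"
proof -
  have [measurable]: "e i \<in> borel_measurable borel" if "i \<in> {..<N}" for i
    using assms that by (simp add: sq_int_def)
  show ?thesis unfolding elem_kernel_def[abs_def] by measurable
qed

lemma elem_I2_measurable:
  assumes "\<And>i. i < N \<Longrightarrow> sq_int (e i)"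
  shows "elem_I2 W N c e \<in> borel_measurable M"
proof -
  have [measurable]: "W (e i) \<in> borel_measurable M" if "i \<in> {..<N}" for i
    using assms that by (simp add: W_measurable)
  show ?thesis unfolding elem_I2_def[abs_def] by measurable
qed

lemma elem_I2_diff:
  assumes 1: "\<And>i. i < N1 \<Longrightarrow> sq_int (e1 i)" and 2: "\<And>i. i < N2 \<Longrightarrow> sq_int (e2 i)"
  shows "(\<integral>\<^sup>+\<omega>. ennreal ((elem_I2 W N1 c1 e1 \<omega> - elem_I2 W N2 c2 e2 \<omega>)\<^sup>2) \<partial>M) \<le>
    2 * (\<integral>\<^sup>+z. ennreal ((elem_kernel N1 c1 e1 z - elem_kernel N2 c2 e2 z)\<^sup>2) \<partial>(lborel \<Otimes>\<^sub>M lborel))"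
proof -
  let ?I = "{..<N1} <+> {..<N2}" and ?e = "case_sum e1 e2"
  \<comment> \<open>Block diagonal over the disjoint sum, with the second block negated.\<close>
  let ?c = "\<lambda>i j. case i of Inl i \<Rightarrow> (case j of Inl j \<Rightarrow> c1 i j | Inr _ \<Rightarrow> 0)
    | Inr i \<Rightarrow> (case j of Inl _ \<Rightarrow> 0 | Inr j \<Rightarrow> - c2 i j)"
  have "rank_I2 ?I ?c ?e \<omega> = elem_I2 W N1 c1 e1 \<omega> - elem_I2 W N2 c2 e2 \<omega>" for \<omega>
    by (simp add: rank_I2_def elem_I2_def sum.Plus sum_negf)
  moreover have "rank_kernel ?I ?c ?e z = elem_kernel N1 c1 e1 z - elem_kernel N2 c2 e2 z" for z
    by (simp add: rank_kernel_def elem_kernel_def sum.Plus sum_negf)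
  moreover have "sq_int (?e i)" if "i \<in> ?I" for i using that 1 2 by auto
  ultimately show ?thesis using rank_I2_isometry[of ?I ?e ?c] by simp
qed

text \<open>X comes with some approximating sequence, which may have nothing in common with e.
  Passing through its n-th member gives the constant 8 = 2 * 2 * 2, from two triangle inequalities
  and \<open>elem_I2_diff\<close>; the terms that depend on n tend to 0.\<close>

lemma double_wiener_integral_approx:
  assumes X: "is_double_wiener_integral M W f X" and e: "\<And>i. i < N \<Longrightarrow> sq_int (e i)"
  shows "(\<integral>\<^sup>+\<omega>. ennreal ((X \<omega> - elem_I2 W N c e \<omega>)\<^sup>2) \<partial>M) \<le>
    8 * (\<integral>\<^sup>+z. ennreal ((f z - elem_kernel N c e z)\<^sup>2) \<partial>(lborel \<Otimes>\<^sub>M lborel))"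
proof -
  let ?L = "lborel \<Otimes>\<^sub>M lborel :: (real \<times> real) measure"
  have [measurable]: "f \<in> borel_measurable ?L" "X \<in> borel_measurable M"
    using X by (auto simp: is_double_wiener_integral_def sq_int2_def)
  obtain N' c' e' where e': "\<And>n i. i < N' n \<Longrightarrow> sq_int (e' n i)"
    and f: "(\<lambda>n. \<integral>\<^sup>+ z. ennreal ((f z - elem_kernel (N' n) (c' n) (e' n) z)\<^sup>2) \<partial>?L) \<longlonglongrightarrow> 0"
    and lim: "(\<lambda>n. \<integral>\<^sup>+ \<omega>. ennreal ((X \<omega> - elem_I2 W (N' n) (c' n) (e' n) \<omega>)\<^sup>2) \<partial>M) \<longlonglongrightarrow> 0"
    using X unfolding is_double_wiener_integral_def by blast
  let ?k = "\<lambda>n. elem_kernel (N' n) (c' n) (e' n)" and ?J = "\<lambda>n. elem_I2 W (N' n) (c' n) (e' n)"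
  let ?F = "\<integral>\<^sup>+z. ennreal ((f z - elem_kernel N c e z)\<^sup>2) \<partial>?L"
  note [measurable] = elem_I2_measurable[OF e] elem_kernel_measurable[OF e]
  note [measurable] = elem_I2_measurable[of "N' n" "e' n" for n, OF e'] elem_kernel_measurable[of "N' n" "e' n" for n, OF e']
  have "(\<integral>\<^sup>+\<omega>. ennreal ((X \<omega> - elem_I2 W N c e \<omega>)\<^sup>2) \<partial>M) \<le>
     2 * (\<integral>\<^sup>+ \<omega>. ennreal ((X \<omega> - ?J n \<omega>)\<^sup>2) \<partial>M) + 8 * (\<integral>\<^sup>+ z. ennreal ((f z - ?k n z)\<^sup>2) \<partial>?L) + 8 * ?F" for n
  proof -
    have "(\<integral>\<^sup>+\<omega>. ennreal ((X \<omega> - elem_I2 W N c e \<omega>)\<^sup>2) \<partial>M) \<le>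
      2 * (\<integral>\<^sup>+ \<omega>. ennreal ((X \<omega> - ?J n \<omega>)\<^sup>2) \<partial>M) + 2 * (\<integral>\<^sup>+ \<omega>. ennreal ((?J n \<omega> - elem_I2 W N c e \<omega>)\<^sup>2) \<partial>M)"
      by (rule nn_integral_square_triangle) measurable
    also have "(\<integral>\<^sup>+ \<omega>. ennreal ((?J n \<omega> - elem_I2 W N c e \<omega>)\<^sup>2) \<partial>M) \<le>
      2 * (\<integral>\<^sup>+ z. ennreal ((?k n z - elem_kernel N c e z)\<^sup>2) \<partial>?L)"
      by (rule elem_I2_diff[OF e' e])
    also have "(\<integral>\<^sup>+ z. ennreal ((?k n z - elem_kernel N c e z)\<^sup>2) \<partial>?L) \<le>
      2 * (\<integral>\<^sup>+ z. ennreal ((?k n z - f z)\<^sup>2) \<partial>?L) + 2 * ?F"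
      by (rule nn_integral_square_triangle) measurable
    also have "(\<integral>\<^sup>+ z. ennreal ((?k n z - f z)\<^sup>2) \<partial>?L) = (\<integral>\<^sup>+ z. ennreal ((f z - ?k n z)\<^sup>2) \<partial>?L)"
      by (simp add: power2_commute)
    finally show ?thesis by (simp add: distrib_left mult_left_mono add_left_mono flip: mult.assoc add.assoc)
  qed
  moreover have "(\<lambda>n. 2 * (\<integral>\<^sup>+ \<omega>. ennreal ((X \<omega> - ?J n \<omega>)\<^sup>2) \<partial>M) + 8 * (\<integral>\<^sup>+ z. ennreal ((f z - ?k n z)\<^sup>2) \<partial>?L) + 8 * ?F)
     \<longlonglongrightarrow> 2 * 0 + 8 * 0 + 8 * ?F"
    by (intro tendsto_add ennreal_tendsto_cmult lim f tendsto_const) auto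
  ultimately show ?thesis
    by (intro LIMSEQ_le_const[where X = "\<lambda>n. 2 * (\<integral>\<^sup>+ \<omega>. ennreal ((X \<omega> - ?J n \<omega>)\<^sup>2) \<partial>M) + 8 * (\<integral>\<^sup>+ z. ennreal ((f z - ?k n z)\<^sup>2) \<partial>?L) + 8 * ?F"]) auto
qed

end

section \<open>Discretisation of the kernel\<close>

text \<open>The limit formula for 1 / Gamma, up to a factor (c + q) and powers of q. The shift by 2
  matches the upper bound for n * (u - x) in \<open>cell_index_diff\<close>.\<close>

lemma frac_coeff_asymp:
  assumes "0 < c"
  shows "(\<lambda>q. frac_coeff c q / (real q + 2) powr (c - 1)) \<longlonglongrightarrow> rGamma c"
proof -
  have n: "(\<lambda>q. inverse (real q)) \<longlonglongrightarrow> 0" by (rule lim_inverse_n)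
  have "(\<lambda>q. rGamma_series c q * (inverse (1 + 2 * inverse (real q)) powr c * ((1 + 2 * inverse (real q)) / (1 + c * inverse (real q)))))
      \<longlonglongrightarrow> rGamma c * (inverse (1 + 2 * 0) powr c * ((1 + 2 * 0) / (1 + c * 0)))"
    by (intro tendsto_intros n) auto
  moreover have "\<forall>\<^sub>F q in sequentially. rGamma_series c q * (inverse (1 + 2 * inverse (real q)) powr c * ((1 + 2 * inverse (real q)) / (1 + c * inverse (real q))))
     = frac_coeff c q / (real q + 2) powr (c - 1)"
    using eventually_gt_at_top[of 0]
  proof eventually_elim
    fix q :: nat assume q: "0 < q"
    have "exp (c * ln (real q)) = real q powr c" using q by (simp add: powr_def)
    then have "rGamma_series c q = frac_coeff c q * (c + q) / real q powr c"
      by (simp add: rGamma_series_def frac_coeff_def pochhammer_Suc)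
    moreover have "inverse (1 + 2 * inverse (real q)) = real q / (q + 2)"
      using q by (simp add: field_simps)
    moreover have "(1 + 2 * inverse (real q)) / (1 + c * inverse (real q)) = (real q + 2) / (c + q)"
    proof -
      have "1 + 2 * inverse (real q) = (real q + 2) / real q" "1 + c * inverse (real q) = (c + q) / real q"
        using q by (simp_all add: field_simps)
      then show ?thesis using q by simp
    qed
    moreover have "(real q + 2) powr (c - 1) = (real q + 2) powr c / (real q + 2)"
      by (simp add: powr_diff)
    moreover have "c + real q \<noteq> 0" using assms by simp
    ultimately show "rGamma_series c q * (inverse (1 + 2 * inverse (real q)) powr c * ((1 + 2 * inverse (real q)) / (1 + c * inverse (real q))))
     = frac_coeff c q / (real q + 2) powr (c - 1)"
      using q by (simp add: powr_divide add.commute)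
  qed
  ultimately have "(\<lambda>q. frac_coeff c q / (real q + 2) powr (c - 1)) \<longlonglongrightarrow> rGamma c * (inverse (1 + 2 * 0) powr c * ((1 + 2 * 0) / (1 + c * 0)))"
    by (rule Lim_transform_eventually)
  then show ?thesis by simp
qed

lemma frac_coeff_bound:
  assumes "0 < c"
  obtains C where "C > 0" "\<And>q. frac_coeff c q \<le> C * (real q + 2) powr (c - 1)"
proof -
  have "Bseq (\<lambda>q. frac_coeff c q / (real q + 2) powr (c - 1))"
    using frac_coeff_asymp[OF assms] by (rule convergentI[THEN convergent_imp_Bseq])
  then obtain C where C: "C > 0" "\<And>q. \<bar>frac_coeff c q / (real q + 2) powr (c - 1)\<bar> \<le> C"
    by (auto simp: Bseq_def)
  have "frac_coeff c q \<le> C * (real q + 2) powr (c - 1)" for q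
    using C(2)[of q] by (simp add: abs_le_iff divide_le_eq)
  then show ?thesis using C(1) that by blast
qed

section \<open>The discretised Rosenblatt kernel\<close>

definition power_kernel :: "real \<Rightarrow> real \<Rightarrow> real \<Rightarrow> real" where
  "power_kernel c u x = (max (u - x) 0) powr (c - 1)"

lemma power_kernel_nonneg [simp]: "0 \<le> power_kernel c u x"
  by (simp add: power_kernel_def)

lemma power_kernel_measurable [measurable]:
  "(\<lambda>u. power_kernel c u x) \<in> borel_measurable borel"
  "(\<lambda>p. power_kernel c (f p) (g p)) \<in> borel_measurable N"
  if "f \<in> borel_measurable N" "g \<in> borel_measurable N"
  using that by (simp_all add: power_kernel_def)

lemma integrable_power_kernel:
  assumes "0 < c"
  shows "integrable lborel (\<lambda>u. indicator {0..t} u * power_kernel c u y)"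
proof -
  let ?T = "max 0 (t - y)"
  have "(\<lambda>v. v powr (c - 1)) integrable_on {0..?T}"
    using has_integral_powr_from_0[of "c - 1" ?T] assms by (auto simp: integrable_on_def)
  then have "(\<lambda>v. v powr (c - 1)) absolutely_integrable_on {0..?T}"
    by (rule nonnegative_absolutely_integrable_1) auto
  then have "integrable lebesgue (\<lambda>v. indicator {0..?T} v * v powr (c - 1))"
    by (simp add: set_integrable_def)
  then have "integrable lborel (\<lambda>v. indicator {0..?T} v * v powr (c - 1))"
    by (subst (asm) integrable_completion) auto
  then have int: "integrable lborel (\<lambda>u. indicator {0..?T} (- y + 1 * u) * (- y + 1 * u) powr (c - 1))"
    by (rule lborel_integrable_real_affine) simp
  show ?thesis
    by (rule Bochner_Integration.integrable_bound[OF int])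
       (auto simp: indicator_def power_kernel_def max_def)
qed

text \<open>Off the diagonal, only the singularity at the larger of x and y touches the support of
  the product, and there the other factor is bounded by a power of their distance.\<close>

lemma integrable_power_kernel_mult:
  assumes c: "0 < c" "c < 1" and "x \<noteq> y"
  shows "integrable lborel (\<lambda>u. indicator {0..t} u * (power_kernel c u x * power_kernel c u y))"
proof -
  have *: "integrable lborel (\<lambda>u. indicator {0..t} u * (power_kernel c u x * power_kernel c u y))" if "x < y" for x y
  proof (rule Bochner_Integration.integrable_bound)
    show "integrable lborel (\<lambda>u. (y - x) powr (c - 1) * (indicator {0..t} u * power_kernel c u y))"
      using integrable_power_kernel[OF c(1)] by simp
    have "power_kernel c u x * power_kernel c u y \<le> (y - x) powr (c - 1) * power_kernel c u y" for u
    proof (cases "u \<le> y")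
      case False
      then have "(u - x) powr (c - 1) \<le> (y - x) powr (c - 1)"
        using that c by (intro powr_mono2') auto
      then show ?thesis using False that
        by (intro mult_right_mono) (auto simp: power_kernel_def)
    qed (simp add: power_kernel_def)
    then show "AE u in lborel. norm (indicator {0..t} u * (power_kernel c u x * power_kernel c u y))
        \<le> norm ((y - x) powr (c - 1) * (indicator {0..t} u * power_kernel c u y))"
      by (auto simp: indicator_def abs_mult)
  qed measurable
  show ?thesis using *[of x y] *[of y x] assms(3) by (cases "x < y") (auto simp: mult.commute)
qed

text \<open>The discretisation with mesh \<open>1/n\<close> starts at \<open>-n\<close>.\<close>

definition cell_index :: "nat \<Rightarrow> real \<Rightarrow> nat" where
  "cell_index n x = nat \<lfloor>real n * (x + real n)\<rfloor>"

lemma cell_index_measurable [measurable]: "cell_index n \<in> borel \<rightarrow>\<^sub>M count_space UNIV"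
  unfolding cell_index_def[abs_def] by measurable

lemma cell_index_bounds:
  assumes "- real n \<le> x"
  shows "real (cell_index n x) \<le> real n * (x + real n)" "real n * (x + real n) < real (cell_index n x) + 1"
proof -
  have "0 \<le> real n * (x + real n)" using assms by simp
  then show "real (cell_index n x) \<le> real n * (x + real n)" "real n * (x + real n) < real (cell_index n x) + 1"
    unfolding cell_index_def by (simp_all add: of_nat_nat)
qed

text \<open>The bound on x matters: \<open>nat\<close> sends negative floors to 0, so without it
  cell 0 would contain everything to the left of -n.\<close>

definition cell :: "nat \<Rightarrow> nat \<Rightarrow> real set" where
  "cell n j = {x. - real n \<le> x \<and> cell_index n x = j}"

lemma cell_eq:
  assumes "0 < n"
  shows "cell n j = {real j / n - n ..< (real j + 1) / n - n}"
proof -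
  have "x \<in> cell n j \<longleftrightarrow> real j \<le> real n * (x + n) \<and> real n * (x + n) < real j + 1" for x
  proof
    assume "x \<in> cell n j"
    then show "real j \<le> real n * (x + n) \<and> real n * (x + n) < real j + 1"
      using cell_index_bounds[of n x] by (auto simp: cell_def)
  next
    assume *: "real j \<le> real n * (x + n) \<and> real n * (x + n) < real j + 1"
    then have "\<lfloor>real n * (x + n)\<rfloor> = int j" by (simp add: floor_eq_iff)
    moreover have "0 \<le> x + n" using * assms
      by (metis of_nat_0_le_iff of_nat_0_less_iff order_trans zero_le_mult_iff not_le)
    ultimately show "x \<in> cell n j" by (simp add: cell_def cell_index_def)
  qed
  moreover have "real j / n - n \<le> x \<longleftrightarrow> real j \<le> real n * (x + n)" for x
    using assms by (simp add: diff_le_eq pos_divide_le_eq mult.commute)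
  moreover have "x < (real j + 1) / n - n \<longleftrightarrow> real n * (x + n) < real j + 1" for x
    using assms by (simp add: less_diff_eq pos_less_divide_eq mult.commute)
  ultimately show ?thesis by (intro set_eqI) (simp only: atLeastLessThan_iff)
qed

lemma measure_cell: "0 < n \<Longrightarrow> measure lborel (cell n j) = 1 / n"
  by (simp add: cell_eq add_divide_distrib)

lemma cell_measurable [measurable]: "cell n j \<in> sets borel"
  unfolding cell_def by measurable

text \<open>A discrete counterpart of \<open>power_kernel\<close>: with q close to n * (u - x),
  \<open>frac_coeff c q\<close> is about (n * (u - x))^(c - 1) / Gamma(c), and the prefactor removes
  the power of n. The cell of u itself is skipped, so that the support lies in x < u and lag 0
  belongs to the cell just before.\<close>

definition noise_kernel :: "real \<Rightarrow> nat \<Rightarrow> real \<Rightarrow> real \<Rightarrow> real" where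
  "noise_kernel c n u x = (if - real n \<le> x \<and> cell_index n x < cell_index n u
     then real n powr (1 - c) * frac_coeff c (cell_index n u - cell_index n x - 1) else 0)"

lemma noise_kernel_nonneg: "0 < c \<Longrightarrow> 0 \<le> noise_kernel c n u x"
  by (simp add: noise_kernel_def frac_coeff_nonneg)

text \<open>Exactly q full cells of width 1 / n lie strictly between the cells of x and u; the rest
  of u - x comes from parts of these two cells.\<close>

lemma cell_index_diff:
  assumes n: "0 < n" and x: "- real n \<le> x" "cell_index n x < cell_index n u"
  defines "q \<equiv> cell_index n u - cell_index n x - 1"
  shows "x < u" "u - x < (real q + 2) / n" "real q < real n * (u - x)"
proof -
  have "- real n \<le> u"
  proof (rule ccontr)
    assume "\<not> - real n \<le> u"
    then have "real n * (u + real n) \<le> 0" by (simp add: mult_nonneg_nonpos)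
    then have "cell_index n u = 0" by (simp add: cell_index_def)
    then show False using x by simp
  qed
  note b = cell_index_bounds[OF this] cell_index_bounds[OF x(1)]
  have q: "real q = real (cell_index n u) - real (cell_index n x) - 1"
    unfolding q_def using x(2) by (simp add: of_nat_diff)
  show q1: "real q < real n * (u - x)" using b unfolding q by (simp add: algebra_simps)
  have "0 \<le> real q" by simp
  then have "0 < real n * (u - x)" using q1 by linarith
  then show "x < u" by (simp add: zero_less_mult_iff)
  have "real n * (u - x) < real q + 2" using b unfolding q by (simp add: algebra_simps)
  then show "u - x < (real q + 2) / n" using n by (simp add: field_simps)
qed

text \<open>Separates a factor that is bounded and tends to \<open>rGamma c\<close> from a power
  whose base exceeds u - x and tends to it; for c < 1 the latter is dominated by the corresponding
  power of u - x.\<close>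

lemma noise_kernel_eq:
  assumes "0 < n" "- real n \<le> x" "cell_index n x < cell_index n u"
  defines "q \<equiv> cell_index n u - cell_index n x - 1"
  shows "noise_kernel c n u x = frac_coeff c q / (real q + 2) powr (c - 1) * ((real q + 2) / n) powr (c - 1)"
proof -
  have "real n powr (1 - c) = 1 / real n powr (c - 1)"
    using powr_minus_divide[of "real n" "c - 1"] by simp
  then show ?thesis using assms by (simp add: noise_kernel_def powr_divide)
qed

lemma noise_kernel_bound:
  assumes c: "0 < c" "c < 1" and C: "\<And>q. frac_coeff c q \<le> C * (real q + 2) powr (c - 1)" "0 < C" and n: "0 < n"
  shows "noise_kernel c n u x \<le> C * power_kernel c u x"
proof (cases "- real n \<le> x \<and> cell_index n x < cell_index n u")
  case True
  define q where "q = cell_index n u - cell_index n x - 1"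
  note d = cell_index_diff[OF n conjunct1[OF True] conjunct2[OF True], folded q_def]
  have "noise_kernel c n u x = frac_coeff c q / (real q + 2) powr (c - 1) * ((real q + 2) / n) powr (c - 1)"
    unfolding q_def using noise_kernel_eq n True by blast
  also have "\<dots> \<le> C * (u - x) powr (c - 1)"
  proof (rule mult_mono)
    show "frac_coeff c q / (real q + 2) powr (c - 1) \<le> C" using C(1)[of q] by (simp add: divide_le_eq)
    show "((real q + 2) / n) powr (c - 1) \<le> (u - x) powr (c - 1)"
      using d c by (intro powr_mono2') auto
  qed (use C in auto)
  finally show ?thesis using d by (simp add: power_kernel_def)
next
  case False
  then show ?thesis using C by (auto simp: noise_kernel_def)
qed

lemma noise_kernel_tendsto:
  assumes c: "0 < c" "c < 1" and "u \<noteq> x"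
  shows "(\<lambda>n. noise_kernel c n u x) \<longlonglongrightarrow> rGamma c * power_kernel c u x"
proof (cases "x < u")
  case False
  have "noise_kernel c n u x = 0" for n
    using cell_index_diff(1)[of n x u] False by (cases "n = 0") (auto simp: noise_kernel_def cell_index_def)
  then show ?thesis using False assms by (simp add: power_kernel_def)
next
  case True
  define q where "q = (\<lambda>n. cell_index n u - cell_index n x - 1)"
  have lin: "\<forall>\<^sub>F n in sequentially. K \<le> real n * (u - x)" for K
  proof -
    have "filterlim (\<lambda>n. (u - x) * real n) at_top sequentially"
      using True by (intro filterlim_tendsto_pos_mult_at_top[OF tendsto_const] filterlim_real_sequentially) simp
    then show ?thesis by (simp add: filterlim_at_top mult.commute)
  qed
  have ev: "\<forall>\<^sub>F n in sequentially. 0 < n \<and> - real n \<le> x \<and> cell_index n x < cell_index n u"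
  proof -
    have "\<forall>\<^sub>F n in sequentially. - x \<le> real n"
      using filterlim_real_sequentially by (simp add: filterlim_at_top)
    then show ?thesis using lin[of 1] eventually_gt_at_top[of 0]
    proof eventually_elim
      fix n :: nat assume n: "- x \<le> real n" "1 \<le> real n * (u - x)" "0 < n"
      have "real (cell_index n x) \<le> real n * (x + real n)" "real n * (u + real n) < real (cell_index n u) + 1"
        using n True by (intro cell_index_bounds; linarith)+
      then have "real (cell_index n x) < real (cell_index n u)" using n(2) by (simp add: algebra_simps)
      then show "0 < n \<and> - real n \<le> x \<and> cell_index n x < cell_index n u" using n by simp
    qed
  qed
  have ql: "filterlim q at_top sequentially"
    unfolding filterlim_at_top
  proof
    fix K :: nat
    show "\<forall>\<^sub>F n in sequentially. K \<le> q n"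
      using ev lin[of "real K + 2"]
    proof eventually_elim
      fix n assume n: "0 < n \<and> - real n \<le> x \<and> cell_index n x < cell_index n u" "real K + 2 \<le> real n * (u - x)"
      then have "u - x < (real (q n) + 2) / n" using cell_index_diff(2)[of n x u] by (simp add: q_def)
      then have "real n * (u - x) < real (q n) + 2" using n by (simp add: field_simps)
      then have "real K < real (q n)" using n(2) by linarith
      then show "K \<le> q n" by simp
    qed
  qed
  have r: "(\<lambda>n. (real (q n) + 2) / n) \<longlonglongrightarrow> u - x"
  proof (rule tendsto_sandwich)
    show "\<forall>\<^sub>F n in sequentially. u - x \<le> (real (q n) + 2) / n"
      using ev by eventually_elim (use cell_index_diff(2) in \<open>force simp: q_def less_imp_le\<close>)
    show "\<forall>\<^sub>F n in sequentially. (real (q n) + 2) / n \<le> (u - x) + 2 * inverse (real n)"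
      using ev
    proof eventually_elim
      fix n assume n: "0 < n \<and> - real n \<le> x \<and> cell_index n x < cell_index n u"
      then have "real (q n) < real n * (u - x)" using cell_index_diff(3)[of n x u] by (simp add: q_def)
      then have "real (q n) / n < u - x" using n by (simp add: divide_less_eq mult.commute)
      then show "(real (q n) + 2) / n \<le> (u - x) + 2 * inverse (real n)"
        by (simp add: distrib_right divide_inverse)
    qed
    show "(\<lambda>n. u - x + 2 * inverse (real n)) \<longlonglongrightarrow> u - x"
      using tendsto_add[OF tendsto_const[of "u - x"] tendsto_mult[OF tendsto_const[of 2] lim_inverse_n]] by simp
  qed simp
  have "(\<lambda>n. frac_coeff c (q n) / (real (q n) + 2) powr (c - 1) * ((real (q n) + 2) / n) powr (c - 1))
     \<longlonglongrightarrow> rGamma c * (u - x) powr (c - 1)"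
    by (intro tendsto_mult filterlim_compose[OF frac_coeff_asymp ql] tendsto_powr r tendsto_const) (use c True in auto)
  moreover have "\<forall>\<^sub>F n in sequentially. frac_coeff c (q n) / (real (q n) + 2) powr (c - 1) * ((real (q n) + 2) / n) powr (c - 1)
     = noise_kernel c n u x"
    using ev by eventually_elim (simp add: noise_kernel_eq q_def)
  ultimately have "(\<lambda>n. noise_kernel c n u x) \<longlonglongrightarrow> rGamma c * (u - x) powr (c - 1)"
    by (rule Lim_transform_eventually)
  then show ?thesis using True by (simp add: power_kernel_def)
qed

text \<open>Up to the factor sqrt n, the integrand whose Wiener integral is the k-th value of the
  moving average of the cell noises.\<close>

definition cell_filter :: "real \<Rightarrow> nat \<Rightarrow> nat \<Rightarrow> real \<Rightarrow> real" where
  "cell_filter c n k x = (\<Sum>j\<le>k. frac_coeff c (k - j) * indicator (cell n j) x)"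

lemma cell_filter_eq:
  "cell_filter c n k x = (if - real n \<le> x \<and> cell_index n x \<le> k then frac_coeff c (k - cell_index n x) else 0)"
proof -
  have "cell_filter c n k x = (\<Sum>j\<le>k. if j = cell_index n x then (if - real n \<le> x then frac_coeff c (k - j) else 0) else 0)"
    unfolding cell_filter_def by (intro sum.cong) (auto simp: indicator_def cell_def)
  also have "\<dots> = (if - real n \<le> x \<and> cell_index n x \<le> k then frac_coeff c (k - cell_index n x) else 0)"
    by (subst sum.delta) auto
  finally show ?thesis .
qed

text \<open>Filter k is used on cell k + 1, because only noise from strictly earlier cells enters.
  Monotonicity of the weight in t makes increments nonnegative combinations of squares.\<close>

definition approx_weight :: "nat \<Rightarrow> nat \<Rightarrow> real \<Rightarrow> real" where
  "approx_weight n k t = measure lborel (cell n (Suc k) \<inter> {0..t})"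

lemma approx_weight_mono: "s \<le> t \<Longrightarrow> approx_weight n k s \<le> approx_weight n k t"
  unfolding approx_weight_def
proof (rule measure_mono_fmeasurable)
  have "cell n (Suc k) \<inter> {0..t} \<in> lmeasurable"
    by (rule bounded_set_imp_lmeasurable) auto
  then show "cell n (Suc k) \<inter> {0..t} \<in> fmeasurable lborel"
    by (auto simp: fmeasurable_def)
qed auto

text \<open>For nonnegative \<kappa> a nonnegative combination of rank-one matrices, so that the
  double integral becomes a combination of squares up to a constant. The 2 * n * n cells of width 1
  / n cover [-n, n).\<close>

definition approx_coeff :: "real \<Rightarrow> real \<Rightarrow> nat \<Rightarrow> real \<Rightarrow> nat \<Rightarrow> nat \<Rightarrow> real" where
  "approx_coeff \<kappa> c n t i j = (\<Sum>k<2 * n * n. \<kappa> * (real n powr (1 - c))\<^sup>2 * approx_weight n k t *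
     ((if i \<le> k then frac_coeff c (k - i) else 0) * (if j \<le> k then frac_coeff c (k - j) else 0)))"

text \<open>With v arbitrary, the same rearrangement serves the kernel, where v is a product of
  indicators, and the double integral, where v is a centred product of Gaussians.\<close>

lemma approx_coeff_sum:
  "(\<Sum>i<2*n*n. \<Sum>j<2*n*n. approx_coeff \<kappa> c n t i j * v i j) =
   (\<Sum>k<2*n*n. \<kappa> * (real n powr (1 - c))\<^sup>2 * approx_weight n k t *
     (\<Sum>i\<le>k. \<Sum>j\<le>k. frac_coeff c (k - i) * frac_coeff c (k - j) * v i j))"
proof -
  let ?w = "\<lambda>k. \<kappa> * (real n powr (1 - c))\<^sup>2 * approx_weight n k t"
  let ?g = "\<lambda>k i. if i \<le> k then frac_coeff c (k - i) else 0"
  have r: "(\<Sum>i\<le>k. \<Sum>j\<le>k. frac_coeff c (k - i) * frac_coeff c (k - j) * v i j) =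
      (\<Sum>i<2*n*n. \<Sum>j<2*n*n. ?g k i * ?g k j * v i j)"
    if "k < 2*n*n" for k
  proof -
    have "(\<Sum>i<2*n*n. \<Sum>j<2*n*n. ?g k i * ?g k j * v i j) = (\<Sum>i\<le>k. \<Sum>j<2*n*n. ?g k i * ?g k j * v i j)"
      by (rule sum.mono_neutral_right) (use that in auto)
    also have "\<dots> = (\<Sum>i\<le>k. \<Sum>j\<le>k. ?g k i * ?g k j * v i j)"
      by (rule sum.cong[OF refl], rule sum.mono_neutral_right) (use that in auto)
    also have "\<dots> = (\<Sum>i\<le>k. \<Sum>j\<le>k. frac_coeff c (k - i) * frac_coeff c (k - j) * v i j)"
      by (intro sum.cong refl) simp
    finally show ?thesis ..
  qed
  have "(\<Sum>i<2*n*n. \<Sum>j<2*n*n. approx_coeff \<kappa> c n t i j * v i j) =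
    (\<Sum>i<2*n*n. \<Sum>j<2*n*n. \<Sum>k<2*n*n. ?w k * (?g k i * ?g k j * v i j))"
    unfolding approx_coeff_def sum_distrib_right by (simp only: mult.assoc)
  also have "\<dots> = (\<Sum>i<2*n*n. \<Sum>k<2*n*n. \<Sum>j<2*n*n. ?w k * (?g k i * ?g k j * v i j))"
    by (rule sum.cong[OF refl], rule sum.swap)
  also have "\<dots> = (\<Sum>k<2*n*n. \<Sum>i<2*n*n. \<Sum>j<2*n*n. ?w k * (?g k i * ?g k j * v i j))"
    by (rule sum.swap)
  also have "\<dots> = (\<Sum>k<2*n*n. ?w k * (\<Sum>i\<le>k. \<Sum>j\<le>k. frac_coeff c (k - i) * frac_coeff c (k - j) * v i j))"
    by (rule sum.cong[OF refl]) (simp only: r lessThan_iff sum_distrib_left)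
  finally show ?thesis .
qed

definition approx_kernel :: "real \<Rightarrow> real \<Rightarrow> nat \<Rightarrow> real \<Rightarrow> real \<times> real \<Rightarrow> real" where
  "approx_kernel \<kappa> c n t = elem_kernel (2 * n * n) (approx_coeff \<kappa> c n t) (\<lambda>j. indicator (cell n j))"

lemma approx_kernel_eq_sum:
  "approx_kernel \<kappa> c n t z = (\<Sum>k<2*n*n. \<kappa> * (real n powr (1 - c))\<^sup>2 * approx_weight n k t *
     (cell_filter c n k (fst z) * cell_filter c n k (snd z)))"
proof -
  have "(\<Sum>i\<le>k. \<Sum>j\<le>k. frac_coeff c (k - i) * frac_coeff c (k - j) * (indicator (cell n i) (fst z) * indicator (cell n j) (snd z)))
    = cell_filter c n k (fst z) * cell_filter c n k (snd z)" for k
    unfolding cell_filter_def sum_product by (simp only: ac_simps)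
  then show ?thesis
    unfolding approx_kernel_def elem_kernel_def mult.assoc[of "approx_coeff \<kappa> c n t i j" for i j]
    by (simp only: approx_coeff_sum)
qed

text \<open>For fixed z the product of the discretised kernels is constant in u on every cell, so
  integration over [0, t] weights each value by the length of the overlap.\<close>

lemma approx_kernel_eq_integral:
  assumes n: "0 < n" and t: "0 \<le> t" "t < real n"
  shows "approx_kernel \<kappa> c n t z =
    \<kappa> * (LINT u|lborel. indicator {0..t} u * (noise_kernel c n u (fst z) * noise_kernel c n u (snd z)))"
proof -
  let ?a = "\<lambda>k. (real n powr (1 - c))\<^sup>2 * (cell_filter c n k (fst z) * cell_filter c n k (snd z))"
  have eq: "indicator {0..t} u * (noise_kernel c n u (fst z) * noise_kernel c n u (snd z)) =
    (\<Sum>k<2*n*n. indicator (cell n (Suc k) \<inter> {0..t}) u * ?a k)" for u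
  proof (cases "u \<in> {0..t}")
    case True
    then have un: "- real n \<le> u" by simp
    note b = cell_index_bounds[OF un]
    \<comment> \<open>As u >= 0 is at distance at least n from the left end -n, its cell is not the
      first one and has a predecessor k.\<close>
    have "1 * 1 \<le> real n * (u + real n)" using True n by (intro mult_mono) auto
    then have "0 < cell_index n u" using b by linarith
    then obtain k where k: "cell_index n u = Suc k" by (cases "cell_index n u") auto
    \<comment> \<open>The bound u <= t < n keeps the cell among the first 2 * n * n.\<close>
    have "real n * (u + real n) < real n * (real n + real n)"
      using True t n by (intro mult_strict_left_mono) auto
    then have "real (Suc k) < real (2 * n * n)" using b k by (simp add: algebra_simps)
    then have "Suc k < 2 * n * n" by (simp only: of_nat_less_iff)
    then have k2: "k < 2 * n * n" by simp
    have nk: "noise_kernel c n u x = real n powr (1 - c) * cell_filter c n k x" for x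
      by (simp add: noise_kernel_def cell_filter_eq k less_Suc_eq_le)
    have "(\<Sum>l<2*n*n. indicator (cell n (Suc l) \<inter> {0..t}) u * ?a l) = (\<Sum>l<2*n*n. if l = k then ?a k else 0)"
      using True un k by (intro sum.cong) (auto simp: indicator_def cell_def)
    also have "\<dots> = ?a k" using k2 by simp
    finally show ?thesis using True by (simp add: nk power2_eq_square)
  qed simp
  have fin: "emeasure lborel (cell n (Suc k) \<inter> {0..t}) < \<infinity>" for k
  proof -
    have "emeasure lborel (cell n (Suc k) \<inter> {0..t}) \<le> emeasure lborel {0..t}" by (rule emeasure_mono) auto
    also have "\<dots> < \<infinity>" by (simp add: t)
    finally show ?thesis .
  qed
  have "(LINT u|lborel. indicator {0..t} u * (noise_kernel c n u (fst z) * noise_kernel c n u (snd z))) =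
    (\<Sum>k<2*n*n. LINT u|lborel. indicator (cell n (Suc k) \<inter> {0..t}) u * ?a k)"
    unfolding eq by (rule Bochner_Integration.integral_sum) (use fin in auto)
  also have "\<dots> = (\<Sum>k<2*n*n. approx_weight n k t * ?a k)"
    by (intro sum.cong) (auto simp: approx_weight_def)
  finally show ?thesis
    unfolding approx_kernel_eq_sum by (simp add: sum_distrib_left ac_simps)
qed

lemma noise_kernel_measurable [measurable]: "(\<lambda>u. noise_kernel c n u x) \<in> borel_measurable borel"
  unfolding noise_kernel_def by measurable

text \<open>Dominated convergence in u at a fixed point off the diagonal, where the product of the
  two singular factors is integrable.\<close>

lemma approx_kernel_tendsto:
  assumes c: "0 < c" "c < 1" and t: "0 \<le> t" and xy: "fst z \<noteq> snd z"
  shows "(\<lambda>n. approx_kernel \<kappa> c n t z) \<longlonglongrightarrow>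
    \<kappa> * (rGamma c)\<^sup>2 * (LINT u|lborel. indicator {0..t} u * (power_kernel c u (fst z) * power_kernel c u (snd z)))"
proof -
  obtain C where C: "0 < C" "\<And>q. frac_coeff c q \<le> C * (real q + 2) powr (c - 1)"
    using frac_coeff_bound[OF c(1)] by blast
  let ?x = "fst z" and ?y = "snd z"
  let ?f = "\<lambda>n u. indicator {0..t} u * (noise_kernel c n u ?x * noise_kernel c n u ?y)"
  \<comment> \<open>The index is shifted past n = 0, where there is no mesh and
    \<open>noise_kernel_bound\<close> does not apply.\<close>
  have "(\<lambda>n. LINT u|lborel. ?f (Suc n) u) \<longlonglongrightarrow>
    (LINT u|lborel. indicator {0..t} u * ((rGamma c * power_kernel c u ?x) * (rGamma c * power_kernel c u ?y)))"
  proof (rule integral_dominated_convergence)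
    show "integrable lborel (\<lambda>u. C\<^sup>2 * (indicator {0..t} u * (power_kernel c u ?x * power_kernel c u ?y)))"
      using integrable_power_kernel_mult[OF c xy] by simp
    show "AE u in lborel. norm (?f (Suc n) u) \<le> C\<^sup>2 * (indicator {0..t} u * (power_kernel c u ?x * power_kernel c u ?y))" for n
    proof (rule AE_I2)
      fix u
      have "noise_kernel c (Suc n) u ?x * noise_kernel c (Suc n) u ?y \<le> (C * power_kernel c u ?x) * (C * power_kernel c u ?y)"
        using C noise_kernel_nonneg[OF c(1)] by (intro mult_mono noise_kernel_bound c) auto
      then show "norm (?f (Suc n) u) \<le> C\<^sup>2 * (indicator {0..t} u * (power_kernel c u ?x * power_kernel c u ?y))"
        using noise_kernel_nonneg[OF c(1)] by (auto simp: indicator_def abs_mult power2_eq_square ac_simps)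
    qed
    show "AE u in lborel. (\<lambda>n. ?f (Suc n) u) \<longlonglongrightarrow>
       indicator {0..t} u * ((rGamma c * power_kernel c u ?x) * (rGamma c * power_kernel c u ?y))"
      using AE_lborel_singleton[of ?x] AE_lborel_singleton[of ?y]
      by eventually_elim (intro tendsto_mult tendsto_const LIMSEQ_Suc noise_kernel_tendsto c)
  qed measurable
  then have "(\<lambda>n. \<kappa> * (LINT u|lborel. ?f n u)) \<longlonglongrightarrow>
    \<kappa> * (LINT u|lborel. indicator {0..t} u * ((rGamma c * power_kernel c u ?x) * (rGamma c * power_kernel c u ?y)))"
    by (intro tendsto_mult tendsto_const) (rule LIMSEQ_imp_Suc)
  also have "(\<lambda>u. indicator {0..t} u * ((rGamma c * power_kernel c u ?x) * (rGamma c * power_kernel c u ?y))) =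
     (\<lambda>u. (rGamma c)\<^sup>2 * (indicator {0..t} u * (power_kernel c u ?x * power_kernel c u ?y)))"
    by (simp add: fun_eq_iff power2_eq_square)
  finally have lim: "(\<lambda>n. \<kappa> * (LINT u|lborel. ?f n u)) \<longlonglongrightarrow>
    \<kappa> * (rGamma c)\<^sup>2 * (LINT u|lborel. indicator {0..t} u * (power_kernel c u ?x * power_kernel c u ?y))"
    by (simp add: mult.assoc)
  have "\<forall>\<^sub>F n in sequentially. t < real n"
    using filterlim_real_sequentially by (simp add: filterlim_at_top_dense)
  then have "\<forall>\<^sub>F n in sequentially. \<kappa> * (LINT u|lborel. ?f n u) = approx_kernel \<kappa> c n t z"
    using eventually_gt_at_top[of 0] by eventually_elim (simp add: approx_kernel_eq_integral t)
  then show ?thesis using lim by (rule Lim_transform_eventually[rotated])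
qed

lemma rosenblatt_kernel_eq:
  "rosenblatt_kernel H c t z =
    c * (LINT u|lborel. indicator {0..t} u * (power_kernel (H/2) u (fst z) * power_kernel (H/2) u (snd z)))"
  by (simp add: rosenblatt_kernel_def set_lebesgue_integral_def power_kernel_def)

lemma approx_kernel_bound:
  assumes c: "0 < c" "c < 1" and xy: "fst z \<noteq> snd z" and "0 \<le> \<kappa>"
    and C: "\<And>q. frac_coeff c q \<le> C * (real q + 2) powr (c - 1)" "0 < C"
    and n: "0 < n" and t: "0 \<le> t" "t < real n"
  shows "0 \<le> approx_kernel \<kappa> c n t z"
    and "approx_kernel \<kappa> c n t z \<le> \<kappa> * C\<^sup>2 * (LINT u|lborel. indicator {0..t} u * (power_kernel c u (fst z) * power_kernel c u (snd z)))"
proof -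
  let ?x = "fst z" and ?y = "snd z"
  note eq = approx_kernel_eq_integral[OF n t, of \<kappa> c z]
  have nn: "0 \<le> indicator {0..t} u * (noise_kernel c n u ?x * noise_kernel c n u ?y)" for u
    using noise_kernel_nonneg[OF c(1)] by (auto simp: indicator_def)
  show "0 \<le> approx_kernel \<kappa> c n t z"
    unfolding eq using \<open>0 \<le> \<kappa>\<close> nn by (intro mult_nonneg_nonneg integral_nonneg_AE) auto
  have le: "indicator {0..t} u * (noise_kernel c n u ?x * noise_kernel c n u ?y) \<le>
     C\<^sup>2 * (indicator {0..t} u * (power_kernel c u ?x * power_kernel c u ?y))" for u
  proof -
    have "noise_kernel c n u ?x * noise_kernel c n u ?y \<le> (C * power_kernel c u ?x) * (C * power_kernel c u ?y)"
      using C noise_kernel_nonneg[OF c(1)] by (intro mult_mono noise_kernel_bound c n) auto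
    then show ?thesis by (auto simp: indicator_def power2_eq_square ac_simps)
  qed
  have int: "integrable lborel (\<lambda>u. C\<^sup>2 * (indicator {0..t} u * (power_kernel c u ?x * power_kernel c u ?y)))"
    using integrable_power_kernel_mult[OF c xy] by simp
  have "(LINT u|lborel. indicator {0..t} u * (noise_kernel c n u ?x * noise_kernel c n u ?y)) \<le>
     (LINT u|lborel. C\<^sup>2 * (indicator {0..t} u * (power_kernel c u ?x * power_kernel c u ?y)))"
  proof (rule integral_mono_AE[OF _ int])
    show "integrable lborel (\<lambda>u. indicator {0..t} u * (noise_kernel c n u ?x * noise_kernel c n u ?y))"
      by (rule Bochner_Integration.integrable_bound[OF int]) (use le nn in \<open>auto intro!: AE_I2 order_trans[OF _ abs_ge_self]\<close>)
  qed (use le in auto)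
  then show "approx_kernel \<kappa> c n t z \<le> \<kappa> * C\<^sup>2 * (LINT u|lborel. indicator {0..t} u * (power_kernel c u ?x * power_kernel c u ?y))"
    unfolding eq using \<open>0 \<le> \<kappa>\<close> by (simp add: mult_left_mono mult.assoc)
qed

lemma sq_int_cell: "0 < n \<Longrightarrow> sq_int (indicator (cell n j))"
proof -
  assume "0 < n"
  have "(\<lambda>x. (indicator (cell n j) x)\<^sup>2) = (indicator (cell n j) :: real \<Rightarrow> real)"
    by (auto simp: indicator_def)
  then show ?thesis
    using \<open>0 < n\<close> by (auto simp: sq_int_def cell_eq add_divide_distrib intro!: integrable_real_indicator)
qed

lemma AE_lborel_pair_offdiag: "AE z in lborel \<Otimes>\<^sub>M lborel. fst z \<noteq> (snd z :: real)"
proof (rule lborel_pair.AE_pair_measure)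
  show "{x \<in> space (lborel \<Otimes>\<^sub>M lborel). fst x \<noteq> (snd x :: real)} \<in> sets (lborel \<Otimes>\<^sub>M lborel)"
    by measurable
  have "AE y in lborel. x \<noteq> (y :: real)" for x
    using AE_lborel_singleton[of x] by eventually_elim simp
  then show "AE x in lborel. AE y in lborel. fst (x, y) \<noteq> (snd (x, y) :: real)" by simp
qed

text \<open>The approximations are dominated by a multiple of the limit kernel itself, so its
  assumed square integrability supplies the majorant. The denominator of \<kappa> cancels the
  constant that appears in \<open>approx_kernel_tendsto\<close>.\<close>

theorem approx_kernel_L2:
  fixes H C0 t :: real
  assumes H: "0 < H" "H < 2" and C0: "0 < C0" and t: "0 \<le> t"
    and sq: "sq_int2 (rosenblatt_kernel H C0 t)"
  defines "\<kappa> \<equiv> C0 / (rGamma (H/2))\<^sup>2"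
  shows "(\<lambda>n. \<integral>\<^sup>+z. ennreal ((rosenblatt_kernel H C0 t z - approx_kernel \<kappa> (H/2) n t z)\<^sup>2) \<partial>(lborel \<Otimes>\<^sub>M lborel)) \<longlonglongrightarrow> 0"
proof -
  let ?L = "lborel \<Otimes>\<^sub>M lborel :: (real \<times> real) measure" and ?c = "H/2"
  let ?f = "rosenblatt_kernel H C0 t" and ?g = "\<lambda>n. approx_kernel \<kappa> ?c n t"
  have c: "0 < ?c" "?c < 1" using H by auto
  have rG: "rGamma ?c > 0" using c by (simp add: rGamma_inverse_Gamma)
  have \<kappa>: "\<kappa> > 0" using C0 rG by (simp add: \<kappa>_def)
  obtain C where C: "0 < C" "\<And>q. frac_coeff ?c q \<le> C * (real q + 2) powr (?c - 1)"
    using frac_coeff_bound[OF c(1)] by blast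
  \<comment> \<open>From n0 on the mesh is positive and the grid reaches beyond t.\<close>
  define n0 where "n0 = nat \<lceil>t\<rceil> + 1"
  have n0: "0 < n + n0" "t < real (n + n0)" for n
    unfolding n0_def using real_nat_ceiling_ge[of t] by linarith+
  \<comment> \<open>Off the diagonal, ?f and ?g are at most 1 and \<kappa> * C^2 / C0 times
    ?f.\<close>
  define D where "D = (1 + \<kappa> * C\<^sup>2 / C0)\<^sup>2"
  have [measurable]: "?f \<in> borel_measurable ?L" using sq by (simp add: sq_int2_def)
  have gm [measurable]: "?g n \<in> borel_measurable ?L" for n
    unfolding approx_kernel_def elem_kernel_def[abs_def] by measurable
  have "(\<lambda>n. \<integral>\<^sup>+z. ennreal ((?f z - ?g (n + n0) z)\<^sup>2) \<partial>?L) \<longlonglongrightarrow> (\<integral>\<^sup>+z. 0 \<partial>?L)"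
  proof (rule nn_integral_dominated_convergence[where w = "\<lambda>z. ennreal (D * (?f z)\<^sup>2)"])
    have "integrable ?L (\<lambda>z. D * (?f z)\<^sup>2)" using sq by (simp add: sq_int2_def)
    then have "(\<integral>\<^sup>+z. ennreal (D * (?f z)\<^sup>2) \<partial>?L) = ennreal (LINT z|?L. D * (?f z)\<^sup>2)"
      by (rule nn_integral_eq_integral) (auto simp: D_def)
    then show "(\<integral>\<^sup>+z. ennreal (D * (?f z)\<^sup>2) \<partial>?L) < \<infinity>" by simp
    show "AE z in ?L. ennreal ((?f z - ?g (n + n0) z)\<^sup>2) \<le> ennreal (D * (?f z)\<^sup>2)" for n
      using AE_lborel_pair_offdiag
    proof eventually_elim
      fix z :: "real \<times> real" assume z: "fst z \<noteq> snd z"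
      let ?I = "LINT u|lborel. indicator {0..t} u * (power_kernel ?c u (fst z) * power_kernel ?c u (snd z))"
      note b = approx_kernel_bound[OF c z less_imp_le[OF \<kappa>] C(2,1) n0(1) t n0(2), of n]
      have I: "0 \<le> ?I" by (rule integral_nonneg_AE) (auto simp: indicator_def)
      have f: "?f z = C0 * ?I" by (rule rosenblatt_kernel_eq)
      have f0: "0 \<le> ?f z" unfolding f using I C0 by simp
      have "\<kappa> * C\<^sup>2 * ?I = (\<kappa> * C\<^sup>2 / C0) * ?f z" unfolding f using C0 by simp
      then have g: "?g (n + n0) z \<le> (\<kappa> * C\<^sup>2 / C0) * ?f z" using b(2) by linarith
      have nn: "0 \<le> \<kappa> * C\<^sup>2 / C0" using \<kappa> C0 by simp
      have "\<bar>?f z - ?g (n + n0) z\<bar> \<le> (1 + \<kappa> * C\<^sup>2 / C0) * ?f z"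
        using g b(1) f0 mult_nonneg_nonneg[OF nn f0] by (simp add: abs_le_iff algebra_simps)
      then have "(?f z - ?g (n + n0) z)\<^sup>2 \<le> ((1 + \<kappa> * C\<^sup>2 / C0) * ?f z)\<^sup>2"
        using power_mono[OF _ abs_ge_zero, of "?f z - ?g (n + n0) z" _ 2] by (metis power2_abs)
      then show "ennreal ((?f z - ?g (n + n0) z)\<^sup>2) \<le> ennreal (D * (?f z)\<^sup>2)"
        by (intro ennreal_leI) (simp add: D_def power_mult_distrib)
    qed
    show "AE z in ?L. (\<lambda>n. ennreal ((?f z - ?g (n + n0) z)\<^sup>2)) \<longlonglongrightarrow> 0"
      using AE_lborel_pair_offdiag
    proof eventually_elim
      fix z :: "real \<times> real" assume z: "fst z \<noteq> snd z"
      have "\<kappa> * (rGamma ?c)\<^sup>2 = C0" using rG by (simp add: \<kappa>_def)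
      then have "(\<lambda>n. ?g n z) \<longlonglongrightarrow> ?f z"
        using approx_kernel_tendsto[OF c t z, of \<kappa>] by (simp add: rosenblatt_kernel_eq)
      then have "(\<lambda>n. ?g (n + n0) z) \<longlonglongrightarrow> ?f z" by (rule LIMSEQ_ignore_initial_segment)
      then have "(\<lambda>n. ennreal ((?f z - ?g (n + n0) z)\<^sup>2)) \<longlonglongrightarrow> ennreal ((?f z - ?f z)\<^sup>2)"
        by (intro tendsto_ennrealI tendsto_power tendsto_diff tendsto_const)
      then show "(\<lambda>n. ennreal ((?f z - ?g (n + n0) z)\<^sup>2)) \<longlonglongrightarrow> 0" by simp
    qed
  qed measurable
  then have "(\<lambda>n. \<integral>\<^sup>+z. ennreal ((?f z - ?g (n + n0) z)\<^sup>2) \<partial>?L) \<longlonglongrightarrow> 0" by simp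
  then show ?thesis by (rule LIMSEQ_offset)
qed

section \<open>The approximating process and its increments\<close>

context isonormal_process
begin

text \<open>A cell has measure 1 / n, so the factor sqrt n normalises to unit variance.\<close>

definition cell_noise :: "nat \<Rightarrow> nat \<Rightarrow> 'a \<Rightarrow> real" where
  "cell_noise n j \<omega> = sqrt n * W (indicator (cell n j)) \<omega>"

lemma cell_noise_measurable: "0 < n \<Longrightarrow> cell_noise n j \<in> borel_measurable M"
  unfolding cell_noise_def[abs_def] using W_measurable[OF sq_int_cell] by measurable

lemma cell_noise_char:
  assumes n: "0 < n"
  shows "(CLINT \<omega>|M. iexp (\<Sum>i<m. \<theta> i * cell_noise n i \<omega>)) = complex_of_real (exp (- (\<Sum>i<m. (\<theta> i)\<^sup>2) / 2))"
proof -
  let ?e = "\<lambda>i. indicator (cell n i) :: real \<Rightarrow> real" and ?t = "\<lambda>i. \<theta> i * sqrt n"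
  let ?f = "\<lambda>x. \<Sum>i<m. ?t i * ?e i x"
  have sq: "sq_int ?f" by (rule sq_int_sum) (use sq_int_cell n in auto)
  note [measurable] = W_measurable[OF sq] cell_noise_measurable[OF n]
  have r: "(LINT x|lborel. ?e i x * ?e j x) = (if i = j then 1 / n else 0)" for i j
  proof -
    have "(\<lambda>x. ?e i x * ?e j x) = (if i = j then ?e i else (\<lambda>_. 0))"
      by (auto simp: indicator_def cell_def fun_eq_iff)
    then show ?thesis using measure_cell[OF n, of i] by (cases "i = j") simp_all
  qed
  have "(LINT x|lborel. (?f x)\<^sup>2) = (\<Sum>i<m. \<Sum>j<m. ?t i * ?t j * (LINT x|lborel. ?e i x * ?e j x))"
    by (rule sq_int_sum) (use sq_int_cell n in auto)
  also have "\<dots> = (\<Sum>i<m. \<Sum>j<m. if i = j then (\<theta> i)\<^sup>2 else 0)"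
    using n by (intro sum.cong refl) (auto simp: r power2_eq_square field_simps)
  also have "\<dots> = (\<Sum>i<m. (\<theta> i)\<^sup>2)" by simp
  finally have V: "(LINT x|lborel. (?f x)\<^sup>2) = (\<Sum>i<m. (\<theta> i)\<^sup>2)" .
  have "AE \<omega> in M. W ?f \<omega> = (\<Sum>i<m. ?t i * W (?e i) \<omega>)"
    by (rule W_sum) (use sq_int_cell n in auto)
  then have "AE \<omega> in M. iexp (\<Sum>i<m. \<theta> i * cell_noise n i \<omega>) = iexp (W ?f \<omega>)"
    by eventually_elim (simp add: cell_noise_def mult.assoc)
  then have "(CLINT \<omega>|M. iexp (\<Sum>i<m. \<theta> i * cell_noise n i \<omega>)) = (CLINT \<omega>|M. iexp (W ?f \<omega>))"
    by (intro integral_cong_AE) measurable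
  also have "\<dots> = char (distr M borel (W ?f)) 1"
    unfolding char_def by (subst integral_distr[OF W_measurable[OF sq]]) simp_all
  also have "\<dots> = complex_of_real (exp (- (LINT x|lborel. (?f x)\<^sup>2) * 1\<^sup>2 / 2))"
    using isonormal sq unfolding isonormal_def by blast
  finally show ?thesis unfolding V by simp
qed

definition approx_process :: "real \<Rightarrow> real \<Rightarrow> nat \<Rightarrow> real \<Rightarrow> 'a \<Rightarrow> real" where
  "approx_process \<kappa> c n t = elem_I2 W (2 * n * n) (approx_coeff \<kappa> c n t) (\<lambda>j. indicator (cell n j))"

lemma approx_process_measurable: "0 < n \<Longrightarrow> approx_process \<kappa> c n t \<in> borel_measurable M"
  unfolding approx_process_def by (rule elem_I2_measurable) (rule sq_int_cell)

text \<open>The expectation of the square from which it is subtracted below; being deterministic, it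
  leaves monotonicity in the moduli intact.\<close>

definition centering :: "real \<Rightarrow> nat \<Rightarrow> nat \<Rightarrow> real" where
  "centering c n k = (\<Sum>i\<le>k. \<Sum>j\<le>k. frac_coeff c (k - i) * frac_coeff c (k - j) *
     (LINT x|lborel. indicator (cell n i) x * indicator (cell n j) x))"

lemma approx_process_eq:
  assumes n: "0 < n"
  shows "approx_process \<kappa> c n t \<omega> = (\<Sum>k<2*n*n. \<kappa> * (real n powr (1 - c))\<^sup>2 * approx_weight n k t *
     ((\<Sum>j\<le>k. frac_coeff c (k - j) * cell_noise n j \<omega>)\<^sup>2 / n - centering c n k))"
proof -
  let ?v = "\<lambda>i j. W (indicator (cell n i)) \<omega> * W (indicator (cell n j)) \<omega> - (LINT x|lborel. indicator (cell n i) x * indicator (cell n j) x)"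
  have "(\<Sum>j\<le>k. frac_coeff c (k - j) * cell_noise n j \<omega>)\<^sup>2 / n - centering c n k =
    (\<Sum>i\<le>k. \<Sum>j\<le>k. frac_coeff c (k - i) * frac_coeff c (k - j) * ?v i j)" for k
  proof -
    have "(\<Sum>j\<le>k. frac_coeff c (k - j) * cell_noise n j \<omega>) = sqrt n * (\<Sum>j\<le>k. frac_coeff c (k - j) * W (indicator (cell n j)) \<omega>)"
      by (simp add: cell_noise_def sum_distrib_left ac_simps)
    then have "(\<Sum>j\<le>k. frac_coeff c (k - j) * cell_noise n j \<omega>)\<^sup>2 / n = (\<Sum>j\<le>k. frac_coeff c (k - j) * W (indicator (cell n j)) \<omega>)\<^sup>2"
      using n by (simp add: power_mult_distrib)
    then show ?thesis
      by (simp add: centering_def power2_eq_square sum_product right_diff_distrib sum_subtractf ac_simps)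
  qed
  then show ?thesis
    unfolding approx_process_def elem_I2_def by (simp only: approx_coeff_sum)
qed

lemma approx_process_correlation2:
  assumes c: "0 < c" "c < 1" and n: "0 < n"
    and E: "abs_decreasing (2*n*n) E" "abs_decreasing (2*n*n) F"
  defines "X \<equiv> \<lambda>\<omega>. \<lambda>k\<in>{..<2*n*n}. \<Sum>j\<le>k. frac_coeff c (k - j) * cell_noise n j \<omega>"
  shows "prob {\<omega>\<in>space M. X \<omega> \<in> E} * prob {\<omega>\<in>space M. X \<omega> \<in> F} \<le> prob {\<omega>\<in>space M. X \<omega> \<in> E \<inter> F}"
  unfolding X_def
  by (rule fractional_noise_correlation[OF cell_noise_measurable[OF n] cell_noise_char[OF n] c E])

text \<open>An increment of the approximating process is a nonnegative combination of squares, up to a constant, so the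
  events below are decreasing in the moduli of the fractional noise.\<close>

lemma approx_process_correlation:
  fixes d :: nat
  assumes c: "0 < c" "c < 1" and n: "0 < n" and \<kappa>: "0 \<le> \<kappa>"
    and F: "\<And>i. i \<in> {1..d} \<Longrightarrow> finite (F i)" "\<And>i s. i \<in> {1..d} \<Longrightarrow> s \<in> F i \<Longrightarrow> t0 i \<le> s"
  defines "Y \<equiv> approx_process \<kappa> c n"
  shows "(\<Prod>i=1..d. prob {\<omega>\<in>space M. \<forall>s\<in>F i. Y s \<omega> - Y (t0 i) \<omega> \<le> b i})
    \<le> prob {\<omega>\<in>space M. \<forall>i\<in>{1..d}. \<forall>s\<in>F i. Y s \<omega> - Y (t0 i) \<omega> \<le> b i}"
proof -
  define P where "P = Pi\<^sub>M {..<2*n*n} (\<lambda>_. lborel :: real measure)"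
  define X where "X = (\<lambda>\<omega>. \<lambda>k\<in>{..<2*n*n}. \<Sum>j\<le>k. frac_coeff c (k - j) * cell_noise n j \<omega>)"
  define Q where "Q = (\<lambda>s r x. \<Sum>k<2*n*n. \<kappa> * (real n powr (1 - c))\<^sup>2 * (approx_weight n k s - approx_weight n k r) *
    ((x k)\<^sup>2 / n - centering c n k))"
  define E where "E = (\<lambda>i. {x\<in>space P. \<forall>s\<in>F i. Q s (t0 i) x \<le> b i})"
  have [measurable]: "(\<lambda>x. x k) \<in> borel_measurable P" if "k \<in> {..<2*n*n}" for k
    using measurable_component_singleton[OF that, of "\<lambda>_. lborel :: real measure"] by (simp add: P_def)
  have Qm [measurable]: "Q s r \<in> borel_measurable P" for s r
    unfolding Q_def by measurable
  have incr: "Y s \<omega> - Y r \<omega> = Q s r (X \<omega>)" for s r \<omega>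
    unfolding Y_def Q_def approx_process_eq[OF n] sum_subtractf[symmetric]
    by (rule sum.cong) (simp_all add: X_def algebra_simps)
  have Q_mono: "Q s r y \<le> Q s r x" if "r \<le> s" "\<forall>k<2*n*n. \<bar>y k\<bar> \<le> \<bar>x k\<bar>" for s r x y
    unfolding Q_def
  proof (rule sum_mono)
    fix k assume "k \<in> {..<2*n*n}"
    then have "(y k)\<^sup>2 \<le> (x k)\<^sup>2" using that by (simp add: abs_le_square_iff)
    then show "\<kappa> * (real n powr (1 - c))\<^sup>2 * (approx_weight n k s - approx_weight n k r) * ((y k)\<^sup>2 / n - centering c n k)
      \<le> \<kappa> * (real n powr (1 - c))\<^sup>2 * (approx_weight n k s - approx_weight n k r) * ((x k)\<^sup>2 / n - centering c n k)"
      using \<kappa> approx_weight_mono[OF that(1)] by (intro mult_left_mono diff_right_mono divide_right_mono) auto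
  qed
  have dec: "abs_decreasing (2*n*n) (E i)" if i: "i \<in> {1..d}" for i
    unfolding abs_decreasing_def P_def[symmetric]
  proof (intro conjI ballI impI)
    show "E i \<in> sets P"
      unfolding E_def using F(1)[OF i] by measurable
    fix x y assume *: "x \<in> E i" "y \<in> space P" "\<forall>k<2*n*n. \<bar>y k\<bar> \<le> \<bar>x k\<bar>"
    have "Q s (t0 i) y \<le> b i" if "s \<in> F i" for s
    proof -
      have "Q s (t0 i) y \<le> Q s (t0 i) x" by (rule Q_mono[OF F(2)[OF i that] *(3)])
      also have "\<dots> \<le> b i" using *(1) that by (simp add: E_def)
      finally show ?thesis .
    qed
    then show "y \<in> E i" using *(2) by (simp add: E_def)
  qed
  have ev: "{\<omega>\<in>space M. \<forall>s\<in>F i. Y s \<omega> - Y (t0 i) \<omega> \<le> b i} = {\<omega>\<in>space M. X \<omega> \<in> E i}" for i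
    unfolding incr E_def by (auto simp: X_def P_def space_PiM)
  \<comment> \<open>Events are joined one at a time, as intersections remain decreasing;
    \<open>space P\<close> gives the empty intersection its meaning.\<close>
  have "m \<le> d \<Longrightarrow> (\<Prod>i=1..m. prob {\<omega>\<in>space M. X \<omega> \<in> E i}) \<le> prob {\<omega>\<in>space M. X \<omega> \<in> (space P \<inter> (\<Inter>i\<in>{1..m}. E i))} \<and>
     abs_decreasing (2*n*n) (space P \<inter> (\<Inter>i\<in>{1..m}. E i))" for m
  proof (induction m)
    case 0
    have "{\<omega>\<in>space M. X \<omega> \<in> space P} = space M" by (auto simp: X_def P_def space_PiM)
    then show ?case by (auto simp: abs_decreasing_def P_def prob_space)
  next
    case (Suc m)
    let ?I = "space P \<inter> (\<Inter>i\<in>{1..m}. E i)"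
    have IH: "(\<Prod>i=1..m. prob {\<omega>\<in>space M. X \<omega> \<in> E i}) \<le> prob {\<omega>\<in>space M. X \<omega> \<in> ?I}" "abs_decreasing (2*n*n) ?I"
      using Suc by auto
    have d: "abs_decreasing (2*n*n) (E (Suc m))" using Suc.prems by (intro dec) auto
    have I: "?I \<inter> E (Suc m) = space P \<inter> (\<Inter>i\<in>{1..Suc m}. E i)" by (auto simp: atLeastAtMostSuc_conv)
    have "(\<Prod>i=1..Suc m. prob {\<omega>\<in>space M. X \<omega> \<in> E i}) \<le> prob {\<omega>\<in>space M. X \<omega> \<in> ?I} * prob {\<omega>\<in>space M. X \<omega> \<in> E (Suc m)}"
      using IH(1) by (simp add: mult_right_mono)
    also have "\<dots> \<le> prob {\<omega>\<in>space M. X \<omega> \<in> ?I \<inter> E (Suc m)}"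
      unfolding X_def by (rule approx_process_correlation2[OF c n IH(2) d])
    finally show ?case
      using abs_decreasing_Int[OF IH(2) d] unfolding I by blast
  qed
  then have "(\<Prod>i=1..d. prob {\<omega>\<in>space M. X \<omega> \<in> E i}) \<le> prob {\<omega>\<in>space M. X \<omega> \<in> (space P \<inter> (\<Inter>i\<in>{1..d}. E i))}"
    by simp
  also have "{\<omega>\<in>space M. X \<omega> \<in> (space P \<inter> (\<Inter>i\<in>{1..d}. E i))} =
     {\<omega>\<in>space M. \<forall>i\<in>{1..d}. \<forall>s\<in>F i. Y s \<omega> - Y (t0 i) \<omega> \<le> b i}"
    unfolding incr E_def by (auto simp: X_def P_def space_PiM)
  finally show ?thesis unfolding ev .
qed

end

section \<open>Passage to the limit\<close>

lemma (in isonormal_process) approx_process_tendsto: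
  assumes H: "0 < H" "H < 2" and C0: "0 < C0" and t: "0 \<le> t"
    and X: "is_double_wiener_integral M W (rosenblatt_kernel H C0 t) X" and \<epsilon>: "0 < \<epsilon>"
  defines "\<kappa> \<equiv> C0 / (rGamma (H/2))\<^sup>2"
  shows "(\<lambda>n. prob {\<omega>\<in>space M. \<epsilon> \<le> \<bar>X \<omega> - approx_process \<kappa> (H/2) (Suc n) t \<omega>\<bar>}) \<longlonglongrightarrow> 0"
proof -
  let ?L = "lborel \<Otimes>\<^sub>M lborel :: (real \<times> real) measure"
  let ?Y = "\<lambda>n. approx_process \<kappa> (H/2) (Suc n) t"
  let ?k = "\<lambda>n. \<integral>\<^sup>+z. ennreal ((rosenblatt_kernel H C0 t z - approx_kernel \<kappa> (H/2) (Suc n) t z)\<^sup>2) \<partial>?L"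
  have [measurable]: "X \<in> borel_measurable M" "?Y n \<in> borel_measurable M" for n
    using X approx_process_measurable by (auto simp: is_double_wiener_integral_def)
  have "sq_int2 (rosenblatt_kernel H C0 t)" using X by (simp add: is_double_wiener_integral_def)
  from LIMSEQ_Suc[OF approx_kernel_L2[OF H C0 t this]] have k: "?k \<longlonglongrightarrow> 0"
    by (simp add: \<kappa>_def)
  \<comment> \<open>Chebyshev's inequality reduces convergence in probability to that of the mean
    square, which \<open>double_wiener_integral_approx\<close> bounds by the kernel
    distance.\<close>
  have le: "ennreal (prob {\<omega>\<in>space M. \<epsilon> \<le> \<bar>X \<omega> - ?Y n \<omega>\<bar>}) \<le> ennreal (1 / \<epsilon>\<^sup>2) * (8 * ?k n)" for n
  proof -
    let ?B = "{\<omega>\<in>space M. \<epsilon> \<le> \<bar>X \<omega> - ?Y n \<omega>\<bar>}"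
    have "ennreal (prob ?B) = (\<integral>\<^sup>+\<omega>. indicator ?B \<omega> \<partial>M)" by (simp add: emeasure_eq_measure)
    also have "\<dots> \<le> (\<integral>\<^sup>+\<omega>. ennreal (1 / \<epsilon>\<^sup>2) * ennreal ((X \<omega> - ?Y n \<omega>)\<^sup>2) \<partial>M)"
    proof (rule nn_integral_mono)
      fix \<omega>
      have "1 \<le> 1 / \<epsilon>\<^sup>2 * (X \<omega> - ?Y n \<omega>)\<^sup>2" if "\<epsilon> \<le> \<bar>X \<omega> - ?Y n \<omega>\<bar>"
        using power_mono[OF that, of 2] \<epsilon> by simp
      then have "ennreal 1 \<le> ennreal (1 / \<epsilon>\<^sup>2 * (X \<omega> - ?Y n \<omega>)\<^sup>2)" if "\<epsilon> \<le> \<bar>X \<omega> - ?Y n \<omega>\<bar>"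
        using that by (intro ennreal_leI)
      then show "indicator ?B \<omega> \<le> ennreal (1 / \<epsilon>\<^sup>2) * ennreal ((X \<omega> - ?Y n \<omega>)\<^sup>2)"
        by (auto simp: indicator_def ennreal_mult'[symmetric])
    qed
    also have "\<dots> = ennreal (1 / \<epsilon>\<^sup>2) * (\<integral>\<^sup>+\<omega>. ennreal ((X \<omega> - ?Y n \<omega>)\<^sup>2) \<partial>M)"
      by (rule nn_integral_cmult) measurable
    also have "\<dots> \<le> ennreal (1 / \<epsilon>\<^sup>2) * (8 * ?k n)"
      unfolding approx_process_def approx_kernel_def
      by (intro mult_left_mono double_wiener_integral_approx[OF X] sq_int_cell) auto
    finally show ?thesis .
  qed
  have "(\<lambda>n. ennreal (1 / \<epsilon>\<^sup>2) * (8 * ?k n)) \<longlonglongrightarrow> ennreal (1 / \<epsilon>\<^sup>2) * (8 * 0)"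
    by (intro ennreal_tendsto_cmult k) auto
  then have "(\<lambda>n. ennreal (prob {\<omega>\<in>space M. \<epsilon> \<le> \<bar>X \<omega> - ?Y n \<omega>\<bar>})) \<longlonglongrightarrow> 0"
    using le by (intro tendsto_sandwich[of "\<lambda>_. 0" "\<lambda>n. ennreal (prob {\<omega>\<in>space M. \<epsilon> \<le> \<bar>X \<omega> - ?Y n \<omega>\<bar>})"
      sequentially "\<lambda>n. ennreal (1 / \<epsilon>\<^sup>2) * (8 * ?k n)"]) (simp_all only: zero_le eventually_True tendsto_const mult_zero_right)
  then show ?thesis by (rule ennreal_tendsto_0_iff[THEN iffD1, rotated]) (rule measure_nonneg)
qed

text \<open>Distribution functions may jump at the thresholds, so convergence in probability
  transfers the inequality only with a loss: replacing Z by Y on the left costs 2 * \<epsilon>,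
  returning to Z on the right another 2 * \<epsilon>. The inequalities are not strict, so letting
  \<epsilon> decrease to 0 removes the loss by continuity from above.\<close>

lemma (in prob_space) increment_correlation_limit:
  fixes Z :: "real \<Rightarrow> 'a \<Rightarrow> real" and Y :: "nat \<Rightarrow> real \<Rightarrow> 'a \<Rightarrow> real" and d :: nat
  assumes Z: "\<And>s. s \<in> T \<Longrightarrow> Z s \<in> borel_measurable M"
    and Y: "\<And>n s. s \<in> T \<Longrightarrow> Y n s \<in> borel_measurable M"
    and F: "\<And>i. i \<in> {1..d} \<Longrightarrow> finite (F i)" "\<And>i. i \<in> {1..d} \<Longrightarrow> F i \<subseteq> T" "\<And>i. i \<in> {1..d} \<Longrightarrow> t0 i \<in> T"
    and conv: "\<And>s \<epsilon>. s \<in> T \<Longrightarrow> 0 < \<epsilon> \<Longrightarrow> (\<lambda>n. prob {\<omega>\<in>space M. \<epsilon> \<le> \<bar>Z s \<omega> - Y n s \<omega>\<bar>}) \<longlonglongrightarrow> 0"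
    and corr: "\<And>n b. (\<Prod>i=1..d. prob {\<omega>\<in>space M. \<forall>s\<in>F i. Y n s \<omega> - Y n (t0 i) \<omega> \<le> b i})
      \<le> prob {\<omega>\<in>space M. \<forall>i\<in>{1..d}. \<forall>s\<in>F i. Y n s \<omega> - Y n (t0 i) \<omega> \<le> b i}"
  shows "(\<Prod>i=1..d. prob {\<omega>\<in>space M. \<forall>s\<in>F i. Z s \<omega> - Z (t0 i) \<omega> \<le> a i})
      \<le> prob {\<omega>\<in>space M. \<forall>i\<in>{1..d}. \<forall>s\<in>F i. Z s \<omega> - Z (t0 i) \<omega> \<le> a i}"
proof -
  let ?A = "\<lambda>i. {\<omega>\<in>space M. \<forall>s\<in>F i. Z s \<omega> - Z (t0 i) \<omega> \<le> a i}"
  let ?G = "\<lambda>\<epsilon>. {\<omega>\<in>space M. \<forall>i\<in>{1..d}. \<forall>s\<in>F i. Z s \<omega> - Z (t0 i) \<omega> \<le> a i + 4 * \<epsilon>}"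
  define S where "S = (\<Union>i\<in>{1..d}. insert (t0 i) (F i))"
  have S: "finite S" "S \<subseteq> T"
    using F(1) F(2,3) unfolding S_def by (blast intro: finite_UN_I, blast)
  have FS: "s \<in> S" "t0 i \<in> S" if "i \<in> {1..d}" "s \<in> F i" for i s using that by (auto simp: S_def)
  have ZS [measurable]: "Z s \<in> borel_measurable M" and YS [measurable]: "Y n s \<in> borel_measurable M" if "s \<in> S" for s n
    using Z Y S that by auto
  have incr [measurable]: "(\<lambda>\<omega>. Z s \<omega> - Z (t0 i) \<omega>) \<in> borel_measurable M"
    "(\<lambda>\<omega>. Y n s \<omega> - Y n (t0 i) \<omega>) \<in> borel_measurable M" if "i \<in> {1..d}" "s \<in> F i" for i s n
    using ZS[OF FS(1)[OF that]] ZS[OF FS(2)[OF that]] YS[OF FS(1)[OF that]] YS[OF FS(2)[OF that]] by auto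
  have Gm: "?G \<epsilon> \<in> sets M" for \<epsilon>
    by (intro sets.sets_Collect_finite_All borel_measurable_le) (use F incr in auto)
  have eps: "(\<Prod>i=1..d. prob (?A i)) \<le> prob (?G \<epsilon>)" if \<epsilon>: "0 < \<epsilon>" for \<epsilon>
  proof -
    let ?B = "\<lambda>n s. {\<omega>\<in>space M. \<epsilon> \<le> \<bar>Z s \<omega> - Y n s \<omega>\<bar>}"
    define \<beta> where "\<beta> = (\<lambda>n. \<Sum>s\<in>S. prob (?B n s))"
    have \<beta>: "\<beta> \<longlonglongrightarrow> 0"
      unfolding \<beta>_def using S \<epsilon> by (intro tendsto_null_sum conv) auto
    have Bm: "?B n s \<in> sets M" if "s \<in> S" for n s using that by measurable
    have UB: "(\<Union>s\<in>S. ?B n s) \<in> sets M" "prob (\<Union>s\<in>S. ?B n s) \<le> \<beta> n" for n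
    proof -
      show "(\<Union>s\<in>S. ?B n s) \<in> sets M" using S(1) Bm by (intro sets.finite_UN) auto
      show "prob (\<Union>s\<in>S. ?B n s) \<le> \<beta> n"
        unfolding \<beta>_def using S(1) Bm by (intro finite_measure_subadditive_finite) auto
    qed
    let ?An = "\<lambda>n i. {\<omega>\<in>space M. \<forall>s\<in>F i. Y n s \<omega> - Y n (t0 i) \<omega> \<le> a i + 2 * \<epsilon>}"
    let ?Jn = "\<lambda>n. {\<omega>\<in>space M. \<forall>i\<in>{1..d}. \<forall>s\<in>F i. Y n s \<omega> - Y n (t0 i) \<omega> \<le> a i + 2 * \<epsilon>}"
    have Anm: "?An n i \<in> sets M" if "i \<in> {1..d}" for n i
      by (intro sets.sets_Collect_finite_All borel_measurable_le) (use F incr that in auto)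
    have close: "\<bar>Z s \<omega> - Y n s \<omega>\<bar> < \<epsilon>" "\<bar>Z (t0 i) \<omega> - Y n (t0 i) \<omega>\<bar> < \<epsilon>"
      if "\<omega> \<in> space M" "\<omega> \<notin> (\<Union>s\<in>S. ?B n s)" "i \<in> {1..d}" "s \<in> F i" for \<omega> n i s
      using that(1,2) FS[OF that(3,4)] by (auto simp: not_le)
    have 1: "prob (?A i) - \<beta> n \<le> prob (?An n i)" if i: "i \<in> {1..d}" for n i
    proof -
      have "?A i \<subseteq> ?An n i \<union> (\<Union>s\<in>S. ?B n s)"
      proof
        fix \<omega> assume \<omega>: "\<omega> \<in> ?A i"
        show "\<omega> \<in> ?An n i \<union> (\<Union>s\<in>S. ?B n s)"
        proof (cases "\<omega> \<in> (\<Union>s\<in>S. ?B n s)")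
          case False
          have "Y n s \<omega> - Y n (t0 i) \<omega> \<le> a i + 2 * \<epsilon>" if s: "s \<in> F i" for s
          proof -
            have "Z s \<omega> - Z (t0 i) \<omega> \<le> a i" "\<omega> \<in> space M" using \<omega> s by auto
            then show ?thesis using close[OF _ False i s] by linarith
          qed
          then show ?thesis using \<omega> by auto
        qed blast
      qed
      then have "prob (?A i) \<le> prob (?An n i \<union> (\<Union>s\<in>S. ?B n s))"
        by (rule finite_measure_mono) (intro sets.Un Anm[OF i] UB)
      also have "\<dots> \<le> prob (?An n i) + prob (\<Union>s\<in>S. ?B n s)"
        by (rule measure_Un_le) (use Anm[OF i] UB in auto)
      finally show ?thesis using UB(2)[of n] by linarith
    qed
    have 2: "prob (?Jn n) \<le> prob (?G \<epsilon>) + \<beta> n" for n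
    proof -
      have "?Jn n \<subseteq> ?G \<epsilon> \<union> (\<Union>s\<in>S. ?B n s)"
      proof
        fix \<omega> assume \<omega>: "\<omega> \<in> ?Jn n"
        show "\<omega> \<in> ?G \<epsilon> \<union> (\<Union>s\<in>S. ?B n s)"
        proof (cases "\<omega> \<in> (\<Union>s\<in>S. ?B n s)")
          case False
          have "Z s \<omega> - Z (t0 i) \<omega> \<le> a i + 4 * \<epsilon>" if ij: "i \<in> {1..d}" "s \<in> F i" for i s
          proof -
            have "Y n s \<omega> - Y n (t0 i) \<omega> \<le> a i + 2 * \<epsilon>" "\<omega> \<in> space M" using \<omega> ij by auto
            then show ?thesis using close[OF _ False ij] by linarith
          qed
          then show ?thesis using \<omega> by auto
        qed blast
      qed
      then have "prob (?Jn n) \<le> prob (?G \<epsilon> \<union> (\<Union>s\<in>S. ?B n s))"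
        by (rule finite_measure_mono) (intro sets.Un Gm UB)
      also have "\<dots> \<le> prob (?G \<epsilon>) + prob (\<Union>s\<in>S. ?B n s)"
        by (rule measure_Un_le) (use Gm UB in auto)
      finally show ?thesis using UB(2)[of n] by linarith
    qed
    \<comment> \<open>The cut-off at 0 is there because products are compared factor by factor,
      which needs nonnegative factors.\<close>
    have "(\<Prod>i=1..d. max 0 (prob (?A i) - \<beta> n)) \<le> prob (?G \<epsilon>) + \<beta> n" for n
    proof -
      have "(\<Prod>i=1..d. max 0 (prob (?A i) - \<beta> n)) \<le> (\<Prod>i=1..d. prob (?An n i))"
        using 1 by (intro prod_mono) auto
      also have "\<dots> \<le> prob (?Jn n)" by (rule corr)
      finally show ?thesis using 2[of n] by linarith
    qed
    moreover have "(\<lambda>n. \<Prod>i=1..d. max 0 (prob (?A i) - \<beta> n)) \<longlonglongrightarrow> (\<Prod>i=1..d. max 0 (prob (?A i) - 0))"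
      by (intro tendsto_prod tendsto_max tendsto_const tendsto_diff \<beta>)
    moreover have "(\<lambda>n. prob (?G \<epsilon>) + \<beta> n) \<longlonglongrightarrow> prob (?G \<epsilon>) + 0"
      by (intro tendsto_add tendsto_const \<beta>)
    ultimately have "(\<Prod>i=1..d. max 0 (prob (?A i) - 0)) \<le> prob (?G \<epsilon>) + 0"
      by (intro LIMSEQ_le) auto
    then show ?thesis by simp
  qed
  let ?e = "\<lambda>m. inverse (real (Suc m))"
  have "(\<lambda>m. prob (?G (?e m))) \<longlonglongrightarrow> prob (\<Inter>m. ?G (?e m))"
  proof (rule finite_Lim_measure_decseq)
    show "range (\<lambda>m. ?G (?e m)) \<subseteq> sets M" using Gm by auto
    show "decseq (\<lambda>m. ?G (?e m))"
    proof (rule decseq_SucI)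
      fix m
      have e: "?e (Suc m) \<le> ?e m" by (simp add: le_imp_inverse_le)
      show "?G (?e (Suc m)) \<subseteq> ?G (?e m)"
      proof
        fix \<omega> assume \<omega>: "\<omega> \<in> ?G (?e (Suc m))"
        have "Z s \<omega> - Z (t0 i) \<omega> \<le> a i + 4 * ?e m" if ij: "i \<in> {1..d}" "s \<in> F i" for i s
        proof -
          have "Z s \<omega> - Z (t0 i) \<omega> \<le> a i + 4 * ?e (Suc m)" using \<omega> ij by blast
          then show ?thesis using e by linarith
        qed
        then show "\<omega> \<in> ?G (?e m)" using \<omega> by blast
      qed
    qed
  qed
  moreover have "(\<Inter>m. ?G (?e m)) = {\<omega>\<in>space M. \<forall>i\<in>{1..d}. \<forall>s\<in>F i. Z s \<omega> - Z (t0 i) \<omega> \<le> a i}"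
  proof (intro set_eqI iffI)
    fix \<omega> assume \<omega>: "\<omega> \<in> (\<Inter>m. ?G (?e m))"
    have "Z s \<omega> - Z (t0 i) \<omega> \<le> a i" if ij: "i \<in> {1..d}" "s \<in> F i" for i s
    proof (rule LIMSEQ_le_const)
      show "(\<lambda>m. a i + 4 * ?e m) \<longlonglongrightarrow> a i"
        using tendsto_add[OF tendsto_const[of "a i"] tendsto_mult[OF tendsto_const[of 4] LIMSEQ_inverse_real_of_nat]] by simp
      show "\<exists>N. \<forall>m\<ge>N. Z s \<omega> - Z (t0 i) \<omega> \<le> a i + 4 * ?e m" using \<omega> ij by blast
    qed
    then show "\<omega> \<in> {\<omega>\<in>space M. \<forall>i\<in>{1..d}. \<forall>s\<in>F i. Z s \<omega> - Z (t0 i) \<omega> \<le> a i}"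
      using \<omega> by blast
  next
    fix \<omega> assume \<omega>: "\<omega> \<in> {\<omega>\<in>space M. \<forall>i\<in>{1..d}. \<forall>s\<in>F i. Z s \<omega> - Z (t0 i) \<omega> \<le> a i}"
    have nn: "0 \<le> 4 * ?e m" for m by simp
    have "Z s \<omega> - Z (t0 i) \<omega> \<le> a i + 4 * ?e m" if ij: "i \<in> {1..d}" "s \<in> F i" for i s m
    proof -
      have "Z s \<omega> - Z (t0 i) \<omega> \<le> a i" using \<omega> ij by blast
      then show ?thesis using nn[of m] by linarith
    qed
    then show "\<omega> \<in> (\<Inter>m. ?G (?e m))" using \<omega> by blast
  qed
  ultimately have "(\<lambda>m. prob (?G (?e m))) \<longlonglongrightarrow> prob {\<omega>\<in>space M. \<forall>i\<in>{1..d}. \<forall>s\<in>F i. Z s \<omega> - Z (t0 i) \<omega> \<le> a i}"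
    by (simp only:)
  then show ?thesis
    by (rule LIMSEQ_le_const) (use eps in auto)
qed

text \<open>Continuity up to s is used twice: it bounds the increments, without which the real
  \<open>SUP\<close> would carry no information, and it extends the bound from rational times to all
  times.\<close>

lemma cSUP_increment_le_iff:
  fixes z :: "real \<Rightarrow> real"
  assumes z: "continuous_on {r..s} z" and rs: "r < s"
  shows "(SUP u\<in>{r..<s}. z u - z r) \<le> a \<longleftrightarrow> (\<forall>u\<in>{r<..<s} \<inter> \<rat>. z u - z r \<le> a)"
proof -
  have cont: "continuous_on {r..s} (\<lambda>u. z u - z r)" using z by (intro continuous_intros)
  have "compact ((\<lambda>u. z u - z r) ` {r..s})" by (rule compact_continuous_image[OF cont]) simp
  then have "bdd_above ((\<lambda>u. z u - z r) ` {r..s})" by (rule bounded_imp_bdd_above[OF compact_imp_bounded])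
  then have bdd: "bdd_above ((\<lambda>u. z u - z r) ` {r..<s})" by (rule bdd_above_mono) auto
  have cl: "closure ({r<..<s} \<inter> \<rat>) = {r..s}"
  proof -
    have "{r<..<s} \<subseteq> closure ({r<..<s} \<inter> \<rat>)"
      using open_Int_closure_subset[of "{r<..<s}" \<rat>] by (simp add: Rats_closure_real)
    then have "closure {r<..<s} \<subseteq> closure ({r<..<s} \<inter> \<rat>)" by (rule closure_minimal) simp
    moreover have "closure ({r<..<s} \<inter> \<rat>) \<subseteq> closure {r<..<s}" by (rule closure_mono) auto
    ultimately show ?thesis using rs by simp
  qed
  have "(SUP u\<in>{r..<s}. z u - z r) \<le> a \<longleftrightarrow> (\<forall>u\<in>{r..<s}. z u - z r \<le> a)"
    using rs bdd by (intro cSUP_le_iff) auto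
  also have "\<dots> \<longleftrightarrow> (\<forall>u\<in>{r<..<s} \<inter> \<rat>. z u - z r \<le> a)"
  proof
    assume *: "\<forall>u\<in>{r<..<s} \<inter> \<rat>. z u - z r \<le> a"
    show "\<forall>u\<in>{r..<s}. z u - z r \<le> a"
    proof
      fix u assume u: "u \<in> {r..<s}"
      show "z u - z r \<le> a"
      proof (rule continuous_le_on_closure[of "{r<..<s} \<inter> \<rat>" "\<lambda>u. z u - z r" u a])
        show "continuous_on (closure ({r<..<s} \<inter> \<rat>)) (\<lambda>u. z u - z r)" unfolding cl by (rule cont)
        show "u \<in> closure ({r<..<s} \<inter> \<rat>)" unfolding cl using u by simp
      qed (use * in blast)
    qed
  qed auto
  finally show ?thesis .
qed

text \<open>Continuity of the measure from above, along the first m constraints of each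
  family.\<close>

lemma (in prob_space) prob_countable_constraints:
  fixes Q :: "'i \<Rightarrow> real \<Rightarrow> 'a \<Rightarrow> real" and f :: "'i \<Rightarrow> nat \<Rightarrow> real"
  assumes "finite I" and Q: "\<And>i k. i \<in> I \<Longrightarrow> Q i (f i k) \<in> borel_measurable M"
  shows "(\<lambda>m. prob {\<omega>\<in>space M. \<forall>i\<in>I. \<forall>s\<in>f i ` {..m}. Q i s \<omega> \<le> a i}) \<longlonglongrightarrow>
    prob {\<omega>\<in>space M. \<forall>i\<in>I. \<forall>s\<in>range (f i). Q i s \<omega> \<le> a i}"
proof -
  let ?E = "\<lambda>m. {\<omega>\<in>space M. \<forall>i\<in>I. \<forall>s\<in>f i ` {..m}. Q i s \<omega> \<le> a i}"
  have "(\<lambda>m. prob (?E m)) \<longlonglongrightarrow> prob (\<Inter>m. ?E m)"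
  proof (rule finite_Lim_measure_decseq)
    have "?E m \<in> sets M" for m
      by (intro sets.sets_Collect_finite_All borel_measurable_le) (use assms in auto)
    then show "range ?E \<subseteq> sets M" by auto
    show "decseq ?E" by (rule decseq_SucI) auto
  qed
  moreover have "(\<Inter>m. ?E m) = {\<omega>\<in>space M. \<forall>i\<in>I. \<forall>s\<in>range (f i). Q i s \<omega> \<le> a i}"
    by auto
  ultimately show ?thesis by (simp only:)
qed

theorem theorem1:
  fixes M :: "'a measure" and H :: real and Z :: "real \<Rightarrow> 'a \<Rightarrow> real"
    and d :: nat and t :: "nat \<Rightarrow> real" and a :: "nat \<Rightarrow> real"
  assumes "rosenblatt_process M H Z"
    and "0 \<le> t 0" and "\<forall>i<d. t i < t (Suc i)"
  shows "measure M {\<omega> \<in> space M. \<forall>i\<in>{1..d}.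
            (SUP s\<in>{t (i - 1)..<t i}. Z s \<omega> - Z (t (i - 1)) \<omega>) \<le> a i}
         \<ge> (\<Prod>i=1..d. measure M {\<omega> \<in> space M.
            (SUP s\<in>{t (i - 1)..<t i}. Z s \<omega> - Z (t (i - 1)) \<omega>) \<le> a i})"
proof -
  obtain W C0 where iso: "isonormal M W" and C0: "0 < C0"
    and I2: "\<And>t. 0 \<le> t \<Longrightarrow> is_double_wiener_integral M W (rosenblatt_kernel H C0 t) (Z t)"
    using assms(1) unfolding rosenblatt_process_def by blast
  have H: "0 < H" "H < 2" and Zm: "\<And>s. s \<in> {0..} \<Longrightarrow> Z s \<in> borel_measurable M"
    and cont: "\<And>\<omega>. \<omega> \<in> space M \<Longrightarrow> continuous_on {0..} (\<lambda>t. Z t \<omega>)"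
    using assms(1) unfolding rosenblatt_process_def by auto
  interpret isonormal_process M W by (unfold_locales) (rule iso)
  define \<kappa> where "\<kappa> = C0 / (rGamma (H/2))\<^sup>2"
  have \<kappa>: "0 \<le> \<kappa>" using C0 by (simp add: \<kappa>_def)
  \<comment> \<open>The shift skips n = 0, for which there is no mesh.\<close>
  define Y where "Y = (\<lambda>n. approx_process \<kappa> (H/2) (Suc n))"
  have tpos: "i \<le> d \<Longrightarrow> 0 \<le> t i" for i
  proof (induction i)
    case (Suc i)
    then have "t i < t (Suc i)" using assms(3) by simp
    then show ?case using Suc by simp
  qed (rule assms(2))
  have tlt: "t (i - 1) < t i" if "i \<in> {1..d}" for i
    using assms(3) that by (cases i) auto
  let ?D = "\<lambda>i. {t (i - 1)<..<t i} \<inter> \<rat>"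
  \<comment> \<open>Enumerating the rational times of each interval lets a single index m cut off
    all intervals at once.\<close>
  define f where "f = (\<lambda>i. from_nat_into (?D i))"
  have f: "range (f i) = ?D i" if i: "i \<in> {1..d}" for i
  proof -
    have "?D i \<noteq> {}" using Rats_dense_in_real[OF tlt[OF i]] by auto
    moreover have "countable (?D i)" by (rule countable_subset[OF _ countable_rat]) auto
    ultimately show ?thesis unfolding f_def by (rule range_from_nat_into)
  qed
  have fin: "f i k \<in> ?D i" if "i \<in> {1..d}" for i k using f[OF that] by blast
  let ?Q = "\<lambda>i s \<omega>. Z s \<omega> - Z (t (i - 1)) \<omega>"
  have fpos: "0 \<le> t (i - 1)" "0 \<le> f i k" "t (i - 1) \<le> f i k" if "i \<in> {1..d}" for i k
  proof -
    show "0 \<le> t (i - 1)" using tpos[of "i - 1"] that by auto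
    moreover show "t (i - 1) \<le> f i k" using fin[OF that, of k] by simp
    ultimately show "0 \<le> f i k" by (rule order_trans)
  qed
  have Qm: "?Q i (f i k) \<in> borel_measurable M" if "i \<in> {1..d}" for i k
    using Zm fpos[OF that] by auto
  have sup: "(SUP s\<in>{t (i - 1)..<t i}. ?Q i s \<omega>) \<le> a i \<longleftrightarrow> (\<forall>s\<in>range (f i). ?Q i s \<omega> \<le> a i)"
    if "i \<in> {1..d}" "\<omega> \<in> space M" for i \<omega>
    unfolding f[OF that(1)]
    by (rule cSUP_increment_le_iff[OF continuous_on_subset[OF cont[OF that(2)]] tlt[OF that(1)]])
       (use fpos[OF that(1)] in auto)
  have step: "(\<Prod>i=1..d. prob {\<omega>\<in>space M. \<forall>s\<in>f i ` {..m}. ?Q i s \<omega> \<le> a i})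
     \<le> prob {\<omega>\<in>space M. \<forall>i\<in>{1..d}. \<forall>s\<in>f i ` {..m}. ?Q i s \<omega> \<le> a i}" for m
  proof (rule increment_correlation_limit[where T = "{0..}" and Y = Y])
    show "Y n s \<in> borel_measurable M" for n s
      unfolding Y_def by (rule approx_process_measurable) simp
    show "(\<lambda>n. prob {\<omega>\<in>space M. \<epsilon> \<le> \<bar>Z s \<omega> - Y n s \<omega>\<bar>}) \<longlonglongrightarrow> 0" if "s \<in> {0..}" "0 < \<epsilon>" for s \<epsilon>
      unfolding Y_def \<kappa>_def using that by (intro approx_process_tendsto H C0 I2) auto
    show "(\<Prod>i=1..d. prob {\<omega>\<in>space M. \<forall>s\<in>f i ` {..m}. Y n s \<omega> - Y n (t (i - 1)) \<omega> \<le> b i})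
      \<le> prob {\<omega>\<in>space M. \<forall>i\<in>{1..d}. \<forall>s\<in>f i ` {..m}. Y n s \<omega> - Y n (t (i - 1)) \<omega> \<le> b i}" for n b
      unfolding Y_def
      by (rule approx_process_correlation) (use H \<kappa> fpos in auto)
  qed (use Zm fpos in auto)
  have "(\<lambda>m. \<Prod>i=1..d. prob {\<omega>\<in>space M. \<forall>s\<in>f i ` {..m}. ?Q i s \<omega> \<le> a i}) \<longlonglongrightarrow>
     (\<Prod>i=1..d. prob {\<omega>\<in>space M. \<forall>s\<in>range (f i). ?Q i s \<omega> \<le> a i})"
  proof (rule tendsto_prod)
    fix i assume i: "i \<in> {1..d}"
    show "(\<lambda>m. prob {\<omega>\<in>space M. \<forall>s\<in>f i ` {..m}. ?Q i s \<omega> \<le> a i}) \<longlonglongrightarrow> prob {\<omega>\<in>space M. \<forall>s\<in>range (f i). ?Q i s \<omega> \<le> a i}"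
      using prob_countable_constraints[of "{i}" ?Q f a] Qm[OF i] by simp
  qed
  moreover have "(\<lambda>m. prob {\<omega>\<in>space M. \<forall>i\<in>{1..d}. \<forall>s\<in>f i ` {..m}. ?Q i s \<omega> \<le> a i}) \<longlonglongrightarrow>
     prob {\<omega>\<in>space M. \<forall>i\<in>{1..d}. \<forall>s\<in>range (f i). ?Q i s \<omega> \<le> a i}"
    by (rule prob_countable_constraints) (use Qm in auto)
  ultimately have "(\<Prod>i=1..d. prob {\<omega>\<in>space M. \<forall>s\<in>range (f i). ?Q i s \<omega> \<le> a i})
     \<le> prob {\<omega>\<in>space M. \<forall>i\<in>{1..d}. \<forall>s\<in>range (f i). ?Q i s \<omega> \<le> a i}"
    by (rule LIMSEQ_le) (use step in auto)
  moreover have "(\<Prod>i=1..d. prob {\<omega>\<in>space M. (SUP s\<in>{t (i - 1)..<t i}. ?Q i s \<omega>) \<le> a i}) =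
     (\<Prod>i=1..d. prob {\<omega>\<in>space M. \<forall>s\<in>range (f i). ?Q i s \<omega> \<le> a i})"
    using sup by (intro prod.cong refl arg_cong[where f = prob]) blast
  moreover have "{\<omega>\<in>space M. \<forall>i\<in>{1..d}. (SUP s\<in>{t (i - 1)..<t i}. ?Q i s \<omega>) \<le> a i} =
     {\<omega>\<in>space M. \<forall>i\<in>{1..d}. \<forall>s\<in>range (f i). ?Q i s \<omega> \<le> a i}"
    using sup by blast
  ultimately show ?thesis by (simp only:)
qed

end
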